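(* There exist absolute constants $\epsilon_0>0$ and $C_0>0$ such that, for every planar convex domain $\Omega$ normalised as in the context, with length scale $L$ and first Dirichlet eigenfunction $u$, for all $(x,y)\in\Omega_{1-\epsilon_0}$, $$\left|\partial_{x}\partial_{y}\left(\log u(x,y)\right)\right| + \left|\nabla\partial_{x}\partial_{y}\left(\log u(x,y)\right)\right| \leq C_{0}L^{-3}.$$
   Context: Domain: $\Omega\subset\mathbb{R}^2$ is a bounded convex domain, normalised (by a rotation, dilation and translation) so that its projection onto the $y$-axis is the smallest among its projections onto all directions, and $$\Omega=\{(x,y)\in\mathbb{R}^2: x\in[a,b],\ f_1(x)\leq y\leq f_2(x)\},$$ where $f_1$ is convex and $f_2$ is concave on $[a,b]$, $\min_{[a,b]}f_1=0$ and $\max_{[a,b]}f_2=1$. No further regularity of $\partial\Omega$ is assumed. Length scale: let $h(x)=f_2(x)-f_1(x)$ (a concave function on $[a,b]$). $L$ is the largest value such that $h(x)\geq 1-L^{-2}$ for all $x\in I$, for some interval $I\subset[a,b]$ of length at least $L$. Eigenfunction: $\lambda$ is the first Dirichlet eigenvalue of $\Omega$ and $u$ the corresponding eigenfunction, $\Delta u=-\lambda u$ in $\Omega$, $u=0$ on $\partial\Omega$, normalised to be positive inside $\Omega$ with maximum value $1$. Superlevel sets: $\Omega_c=\{(x,y)\in\Omega: u(x,y)\geq c\}$. An absolute constant is one that does not depend on $\Omega$ or $L$. *)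

theory Defs
  imports "HOL-Analysis.Analysis"
begin

definition dx :: "(real \<times> real \<Rightarrow> real) \<Rightarrow> real \<times> real \<Rightarrow> real" where
  "dx f p = deriv (\<lambda>s. f (s, snd p)) (fst p)"

definition dy :: "(real \<times> real \<Rightarrow> real) \<Rightarrow> real \<times> real \<Rightarrow> real" where
  "dy f p = deriv (\<lambda>t. f (fst p, t)) (snd p)"

definition grad :: "(real \<times> real \<Rightarrow> real) \<Rightarrow> real \<times> real \<Rightarrow> real \<times> real" where
  "grad f p = (dx f p, dy f p)"

definition laplacian :: "(real \<times> real \<Rightarrow> real) \<Rightarrow> real \<times> real \<Rightarrow> real" where
  "laplacian f p = dx (dx f) p + dy (dy f) p"

definition C1_on :: "(real \<times> real) set \<Rightarrow> (real \<times> real \<Rightarrow> real) \<Rightarrow> bool" where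
  "C1_on S f \<longleftrightarrow>
     (\<forall>p\<in>S. f differentiable (at p)) \<and> continuous_on S (dx f) \<and> continuous_on S (dy f)"

definition C2_on :: "(real \<times> real) set \<Rightarrow> (real \<times> real \<Rightarrow> real) \<Rightarrow> bool" where
  "C2_on S f \<longleftrightarrow> C1_on S f \<and> C1_on S (dx f) \<and> C1_on S (dy f)"

text \<open>For a unit vector \<open>e\<close> and a bounded convex set, the projection onto the line spanned
  by \<open>e\<close> is an interval, and its diameter is its length.\<close>

definition projection_length :: "(real \<times> real) set \<Rightarrow> real \<times> real \<Rightarrow> real" where
  "projection_length S e = diameter ((\<lambda>p. p \<bullet> e) ` S)"

text \<open>\<open>\<Omega>\<close> is given with its boundary curves included. It need not be closed, since \<open>f1\<close>
  and \<open>f2\<close> may jump at the end points \<open>a\<close> and \<open>b\<close>. The open domain is \<open>interior \<Omega>\<close>.\<close>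

definition normalised_domain ::
  "(real \<times> real) set \<Rightarrow> real \<Rightarrow> real \<Rightarrow> (real \<Rightarrow> real) \<Rightarrow> (real \<Rightarrow> real) \<Rightarrow> bool" where
  "normalised_domain \<Omega> a b f1 f2 \<longleftrightarrow>
     bounded \<Omega> \<and> convex \<Omega> \<and>
     a < b \<and>
     convex_on {a..b} f1 \<and> concave_on {a..b} f2 \<and>
     (\<forall>x\<in>{a..b}. f1 x \<le> f2 x) \<and>
     \<Omega> = {(x, y). x \<in> {a..b} \<and> f1 x \<le> y \<and> y \<le> f2 x} \<and>
     (\<exists>x\<in>{a..b}. f1 x = 0) \<and> (\<forall>x\<in>{a..b}. 0 \<le> f1 x) \<and>
     (\<exists>x\<in>{a..b}. f2 x = 1) \<and> (\<forall>x\<in>{a..b}. f2 x \<le> 1) \<and>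
     (\<forall>e. norm e = 1 \<longrightarrow> projection_length \<Omega> (0, 1) \<le> projection_length \<Omega> e)"

text \<open>Intervals of any kind (open, closed, half-open) are allowed, so that the largest
  value is attained even when \<open>h\<close> jumps at an end point.\<close>

definition length_scale_admissible :: "real \<Rightarrow> real \<Rightarrow> (real \<Rightarrow> real) \<Rightarrow> real \<Rightarrow> bool" where
  "length_scale_admissible a b h L \<longleftrightarrow>
     L > 0 \<and>
     (\<exists>I. is_interval I \<and> I \<subseteq> {a..b} \<and> measure lborel I \<ge> L \<and>
          (\<forall>x\<in>I. h x \<ge> 1 - L powi (- 2)))"

definition is_length_scale :: "real \<Rightarrow> real \<Rightarrow> (real \<Rightarrow> real) \<Rightarrow> real \<Rightarrow> bool" where
  "is_length_scale a b h L \<longleftrightarrow>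
     length_scale_admissible a b h L \<and> (\<forall>M. length_scale_admissible a b h M \<longrightarrow> M \<le> L)"

text \<open>Eigenfunctions are classical: \<open>C\<^sup>2\<close> inside and continuous up to the boundary. On a
  bounded convex domain these are exactly the weak (\<open>H\<^sup>1\<^sub>0\<close>) eigenfunctions, so the spectrum
  is the usual one.\<close>

definition dirichlet_eigenfunction ::
  "(real \<times> real) set \<Rightarrow> real \<Rightarrow> (real \<times> real \<Rightarrow> real) \<Rightarrow> bool" where
  "dirichlet_eigenfunction \<Omega> lam v \<longleftrightarrow>
     continuous_on (closure \<Omega>) v \<and>
     C2_on (interior \<Omega>) v \<and>
     (\<forall>p\<in>interior \<Omega>. laplacian v p = - lam * v p) \<and>
     (\<forall>p\<in>frontier \<Omega>. v p = 0) \<and>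
     (\<exists>p\<in>interior \<Omega>. v p \<noteq> 0)"

definition is_dirichlet_eigenvalue :: "(real \<times> real) set \<Rightarrow> real \<Rightarrow> bool" where
  "is_dirichlet_eigenvalue \<Omega> lam \<longleftrightarrow> (\<exists>v. dirichlet_eigenfunction \<Omega> lam v)"

definition is_first_dirichlet_eigenvalue :: "(real \<times> real) set \<Rightarrow> real \<Rightarrow> bool" where
  "is_first_dirichlet_eigenvalue \<Omega> lam \<longleftrightarrow>
     is_dirichlet_eigenvalue \<Omega> lam \<and> (\<forall>\<mu>. is_dirichlet_eigenvalue \<Omega> \<mu> \<longrightarrow> lam \<le> \<mu>)"

definition normalised_eigenfunction ::
  "(real \<times> real) set \<Rightarrow> real \<Rightarrow> (real \<times> real \<Rightarrow> real) \<Rightarrow> bool" where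
  "normalised_eigenfunction \<Omega> lam u \<longleftrightarrow>
     dirichlet_eigenfunction \<Omega> lam u \<and>
     (\<forall>p\<in>interior \<Omega>. u p > 0) \<and>
     (\<exists>p\<in>\<Omega>. u p = 1) \<and> (\<forall>p\<in>\<Omega>. u p \<le> 1)"

definition superlevel ::
  "(real \<times> real) set \<Rightarrow> (real \<times> real \<Rightarrow> real) \<Rightarrow> real \<Rightarrow> (real \<times> real) set" where
  "superlevel \<Omega> u c = {p \<in> \<Omega>. u p \<ge> c}"

end

theory Submission
  imports Defs
begin

text \<open>The function \<open>F(x, y, x', y') = u(x, y) u(x', y') - u(x, y') u(x', y)\<close> satisfies
  \<open>\<Delta>F = -2 \<lambda> F\<close> in four variables, and \<open>\<partial>\<^sub>x \<partial>\<^sub>y F\<close> on the diagonal \<open>x = x'\<close>, \<open>y = y'\<close> is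
  \<open>u\<^sup>2 \<partial>\<^sub>x \<partial>\<^sub>y log u\<close>. By interior estimates it suffices to bound \<open>F\<close> itself by \<open>O(L\<^sup>-\<^sup>3)\<close>.
  Since \<open>F\<close> vanishes for \<open>y = y'\<close> and the first eigenvalue of the triangle \<open>0 < y < y' < 1\<close>
  is \<open>5 \<pi>\<^sup>2\<close>, well above \<open>2 \<lambda> \<approx> 2 \<pi>\<^sup>2\<close>, the maximum principle holds for \<open>F\<close> on \<open>y < y'\<close>, and
  the ends of a long piece of \<open>\<Omega>\<close> only have an exponentially small influence in its middle.
  On the lateral boundary \<open>F\<close> is controlled by the variation of \<open>f1\<close> and \<open>f2\<close> between \<open>x\<close> and
  \<open>x'\<close>; near the superlevel set their slopes are \<open>O(L\<^sup>-\<^sup>3)\<close>, because \<open>u\<close> decays where \<open>\<Omega>\<close> is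
  thinner than \<open>1 - A L\<^sup>-\<^sup>2\<close>. All estimates, including the smoothness of \<open>u\<close>, come from
  comparison with explicit functions.\<close>

section \<open>Second derivatives and comparison\<close>

text \<open>The mixed derivative of \<open>ln u\<close> solves no linear equation, and near the
  boundary, which may have corners, no derivative of \<open>u\<close> is controlled.
  \<open>cross u\<close> measures the same failure of \<open>u\<close> to be a product X(x) Y(y),
  but its equation is linear and its boundary data involve only values of \<open>u\<close>; these
  are at most 200 times the distance to the frontier, by supporting lines alone. A second obstacle
  is that \<open>u\<close> does not vanish on vertical cuts of \<Omega>. In two variables
  \<open>lam\<close> may exceed pi^2 by up to 320 / L^2, so a small value of \<open>u\<close> can be
  propagated only over a small multiple of \<open>L\<close>; hence the distances L / 100000 and L /
  200000. In four variables the spectral gap has a fixed size and pays for a weight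
  \<open>cosh\<close> in x and x', which takes care of the cuts. The constants are generous
  throughout. For \<open>L\<close> below 4000000 the bound 1 for \<open>cross u\<close> is enough,
  the constant being large. The level 1/2 serves as threshold because it keeps the points a fixed
  distance away from the frontier and the powers of 1 / u bounded.\<close>

definition has_D2 :: "(real \<Rightarrow> real) \<Rightarrow> real \<Rightarrow> bool" where
  "has_D2 g c \<longleftrightarrow> (\<exists>g'. (\<forall>\<^sub>F t in nhds 0. (g has_real_derivative g' t) (at t)) \<and>
     (g' has_real_derivative c) (at 0))"

lemma has_D2I:
  assumes "\<And>t. (g has_real_derivative g' t) (at t)" "(g' has_real_derivative c) (at 0)"
  shows "has_D2 g c"
  using assms unfolding has_D2_def by (intro exI[of _ g']) auto

lemma has_D2_add:
  assumes "has_D2 f a" "has_D2 g b"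
  shows "has_D2 (\<lambda>t. f t + g t) (a + b)"
proof -
  obtain f' g' where
    "\<forall>\<^sub>F t in nhds 0. (f has_real_derivative f' t) (at t)" "(f' has_real_derivative a) (at 0)"
    "\<forall>\<^sub>F t in nhds 0. (g has_real_derivative g' t) (at t)" "(g' has_real_derivative b) (at 0)"
    using assms unfolding has_D2_def by auto
  then show ?thesis unfolding has_D2_def
    by (intro exI[of _ "\<lambda>t. f' t + g' t"] conjI DERIV_add)
       (auto elim: eventually_elim2 intro: DERIV_add)
qed

lemma has_D2_cmult:
  assumes "has_D2 f a"
  shows "has_D2 (\<lambda>t. c * f t) (c * a)"
proof -
  obtain f' where
    "\<forall>\<^sub>F t in nhds 0. (f has_real_derivative f' t) (at t)" "(f' has_real_derivative a) (at 0)"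
    using assms unfolding has_D2_def by auto
  then show ?thesis unfolding has_D2_def
    by (intro exI[of _ "\<lambda>t. c * f' t"] conjI DERIV_cmult)
       (auto elim!: eventually_mono intro: DERIV_cmult)
qed

lemma has_D2_cmult_right:
  assumes "has_D2 f a"
  shows "has_D2 (\<lambda>t. f t * c) (a * c)"
  using has_D2_cmult[OF assms, of c] by (simp add: mult.commute)

lemma has_D2_uminus:
  assumes "has_D2 f a"
  shows "has_D2 (\<lambda>t. - f t) (- a)"
  using has_D2_cmult[OF assms, of "-1"] by simp

lemma has_D2_diff:
  assumes "has_D2 f a" "has_D2 g b"
  shows "has_D2 (\<lambda>t. f t - g t) (a - b)"
  using has_D2_add[OF assms(1) has_D2_uminus[OF assms(2)]] by simp

lemma has_D2_reflect:
  assumes "has_D2 f a"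
  shows "has_D2 (\<lambda>t. f (- t)) a"
proof -
  obtain f' where f': "\<forall>\<^sub>F t in nhds 0. (f has_real_derivative f' t) (at t)"
    and a: "(f' has_real_derivative a) (at 0)"
    using assms unfolding has_D2_def by auto
  have "filterlim uminus (nhds 0) (nhds (0::real))"
    using tendsto_minus[OF filterlim_ident, of "0::real"] by simp
  then have "\<forall>\<^sub>F t in nhds 0. (f has_real_derivative f' (- t)) (at (- t))"
    using f' by (rule eventually_compose_filterlim[rotated])
  then have "\<forall>\<^sub>F t in nhds 0. ((\<lambda>t. f (- t)) has_real_derivative - f' (- t)) (at t)"
    by (rule eventually_mono) (simp add: DERIV_mirror)
  moreover have "((\<lambda>t. - f' (- t)) has_real_derivative a) (at 0)"
    using DERIV_minus[OF iffD1[OF DERIV_mirror, of "f'" a 0]] a by simp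
  ultimately show ?thesis unfolding has_D2_def by (intro exI[of _ "\<lambda>t. - f' (- t)"]) auto
qed

lemma has_D2_const [simp]: "has_D2 (\<lambda>t. c) 0"
  by (rule has_D2I[where g' = "\<lambda>_. 0"]) auto

lemma has_D2_quadratic: "has_D2 (\<lambda>t. a + b * t + c * t\<^sup>2) (2 * c)"
  by (rule has_D2I[where g' = "\<lambda>t. b + 2 * c * t"]) (auto intro!: derivative_eq_intros)

lemma has_D2_quadratic':
  assumes "\<And>t. g t = a + b * t + (e / 2) * t\<^sup>2"
  shows "has_D2 g e"
proof -
  have "g = (\<lambda>t. a + b * t + (e / 2) * t\<^sup>2)" using assms by auto
  then show ?thesis using has_D2_quadratic[of a b "e / 2"] by (simp del: times_divide_eq_left)
qed

lemma has_D2_sin: "has_D2 (\<lambda>t. sin (a + b * t)) (- (b\<^sup>2) * sin a)"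
  by (rule has_D2I[where g' = "\<lambda>t. b * cos (a + b * t)"])
     (auto intro!: derivative_eq_intros simp: power2_eq_square)

lemma has_D2_cos: "has_D2 (\<lambda>t. cos (a + b * t)) (- (b\<^sup>2) * cos a)"
  by (rule has_D2I[where g' = "\<lambda>t. - b * sin (a + b * t)"])
     (auto intro!: derivative_eq_intros simp: power2_eq_square)

lemma has_D2_exp: "has_D2 (\<lambda>t. exp (a + b * t)) (b\<^sup>2 * exp (a::real))"
  by (rule has_D2I[where g' = "\<lambda>t. b * exp (a + b * t)"])
     (auto intro!: derivative_eq_intros simp: power2_eq_square)

lemma has_D2_cosh: "has_D2 (\<lambda>t. cosh (a + b * t)) (b\<^sup>2 * cosh (a::real))"
  by (rule has_D2I[where g' = "\<lambda>t. b * sinh (a + b * t)"])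
     (auto intro!: derivative_eq_intros simp: power2_eq_square)

text \<open>The second derivative is known at 0 only, so Taylor's formula is replaced by the sign of
  g' just to the right of 0 and the mean value theorem.\<close>

lemma has_D2_local_max:
  assumes "has_D2 g c" and max: "\<forall>\<^sub>F t in nhds 0. g t \<le> g 0"
  shows "c \<le> 0"
proof (rule ccontr)
  assume "\<not> c \<le> 0"
  obtain g' where g': "\<forall>\<^sub>F t in nhds 0. (g has_real_derivative g' t) (at t)"
    and c: "(g' has_real_derivative c) (at 0)"
    using assms unfolding has_D2_def by auto
  obtain d where d: "d > 0" "\<And>t. \<bar>t\<bar> < d \<Longrightarrow> (g has_real_derivative g' t) (at t) \<and> g t \<le> g 0"
    using eventually_conj[OF g' max] unfolding eventually_nhds_metric dist_real_def by auto
  have "g' 0 = 0"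
    by (rule DERIV_local_max[where f = g and x = 0 and d = d]) (use d in auto)
  moreover obtain e where e: "e > 0" "\<And>h. h > 0 \<Longrightarrow> h < e \<Longrightarrow> g' 0 < g' (0 + h)"
    using DERIV_pos_inc_right[OF c] \<open>\<not> c \<le> 0\<close> by auto
  ultimately have pos: "g' h > 0" if "h > 0" "h < e" for h using that by fastforce
  define t where "t = min d e / 2"
  have t: "t > 0" "t < d" "t < e" using d(1) e(1) by (auto simp: t_def)
  have "\<exists>z. 0 < z \<and> z < t \<and> g t - g 0 = (t - 0) * g' z"
    by (rule MVT2) (use t d(2) in auto)
  then obtain z where z: "0 < z" "z < t" "g t - g 0 = t * g' z" by auto
  then have "g t > g 0" using pos[of z] t mult_pos_pos[of t "g' z"] by linarith
  with d(2)[of t] t show False by auto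
qed

text \<open>Barta's argument: at an interior maximum point of \<open>f / \<Psi>\<close> with value \<open>m\<close>, the function
  \<open>f - m \<Psi>\<close> has a vanishing local maximum.\<close>

lemma comparison:
  fixes f \<Psi> :: "'a::euclidean_space \<Rightarrow> real"
  assumes K: "compact K" and f: "continuous_on K f" and \<Psi>: "continuous_on K \<Psi>"
    and pos: "\<And>p. p \<in> K \<Longrightarrow> \<Psi> p > 0"
    and alt: "\<And>p. p \<in> K \<Longrightarrow> f p \<le> \<Psi> p \<or>
      (\<exists>c e. (\<forall>k\<in>Basis. (\<forall>\<^sub>F t in nhds 0. p + t *\<^sub>R k \<in> K) \<and>
          has_D2 (\<lambda>t. f (p + t *\<^sub>R k)) (c k) \<and> has_D2 (\<lambda>t. \<Psi> (p + t *\<^sub>R k)) (e k)) \<and>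
        (\<Sum>k\<in>Basis. c k) = - lam * f p \<and> (\<Sum>k\<in>Basis. e k) < - lam * \<Psi> p)"
    and p: "p \<in> K"
  shows "f p \<le> \<Psi> p"
proof (rule ccontr)
  assume less: "\<not> f p \<le> \<Psi> p"
  have "continuous_on K (\<lambda>q. f q / \<Psi> q)"
    by (intro continuous_on_divide f \<Psi>) (use pos in force)
  then obtain q where q: "q \<in> K" "\<And>r. r \<in> K \<Longrightarrow> f r / \<Psi> r \<le> f q / \<Psi> q"
    using continuous_attains_sup[OF K, of "\<lambda>q. f q / \<Psi> q"] p by blast
  define m where "m = f q / \<Psi> q"
  have "1 < f p / \<Psi> p" using less pos[OF p] by (simp add: field_simps)
  then have m1: "m > 1" using q(2)[OF p] by (simp add: m_def)
  have fq: "f q = m * \<Psi> q" using pos[OF q(1)] by (simp add: m_def)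
  have le: "f r - m * \<Psi> r \<le> 0" if "r \<in> K" for r
    using q(2)[OF that] pos[OF that] by (simp add: m_def[symmetric] field_simps)
  have "\<not> f q \<le> \<Psi> q" using m1 pos[OF q(1)] fq by simp
  then obtain c e where ce: "\<And>k. k \<in> Basis \<Longrightarrow> \<forall>\<^sub>F t in nhds 0. q + t *\<^sub>R k \<in> K"
      "\<And>k. k \<in> Basis \<Longrightarrow> has_D2 (\<lambda>t. f (q + t *\<^sub>R k)) (c k)"
      "\<And>k. k \<in> Basis \<Longrightarrow> has_D2 (\<lambda>t. \<Psi> (q + t *\<^sub>R k)) (e k)"
      "(\<Sum>k\<in>Basis. c k) = - lam * f q" "(\<Sum>k\<in>Basis. e k) < - lam * \<Psi> q"
    using alt[OF q(1)] by blast
  have "c k - m * e k \<le> 0" if k: "k \<in> Basis" for k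
  proof (rule has_D2_local_max)
    show "has_D2 (\<lambda>t. f (q + t *\<^sub>R k) - m * \<Psi> (q + t *\<^sub>R k)) (c k - m * e k)"
      by (intro has_D2_diff has_D2_cmult ce k)
    show "\<forall>\<^sub>F t in nhds 0. f (q + t *\<^sub>R k) - m * \<Psi> (q + t *\<^sub>R k)
        \<le> f (q + 0 *\<^sub>R k) - m * \<Psi> (q + 0 *\<^sub>R k)"
      using ce(1)[OF k] by eventually_elim (use le fq in auto)
  qed
  then have "(\<Sum>k\<in>Basis. c k - m * e k) \<le> 0" by (intro sum_nonpos) auto
  then have "- lam * f q - m * (\<Sum>k\<in>Basis. e k) \<le> 0"
    by (simp add: sum_subtractf ce sum_distrib_left[symmetric])
  moreover have "m * (\<Sum>k\<in>Basis. e k) < m * (- lam * \<Psi> q)"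
    using m1 ce(5) by (intro mult_strict_left_mono) auto
  ultimately show False using fq by (simp add: algebra_simps)
qed

section \<open>Solutions of the Helmholtz equation along coordinate lines\<close>

definition pdir :: "'a::real_normed_vector \<Rightarrow> ('a \<Rightarrow> real) \<Rightarrow> 'a \<Rightarrow> real" where
  "pdir k f p = deriv (\<lambda>t. f (p + t *\<^sub>R k)) 0"

text \<open>Only pure second derivatives along coordinate lines are required, which makes the class
  of solutions closed under \<open>cross\<close> below and under differentiation.\<close>

definition helm :: "'a::euclidean_space set \<Rightarrow> real \<Rightarrow> ('a \<Rightarrow> real) \<Rightarrow> bool" where
  "helm S lam f \<longleftrightarrow> continuous_on S f \<and>
     (\<forall>p\<in>S. \<forall>k\<in>Basis.
        ((\<lambda>t. f (p + t *\<^sub>R k)) has_real_derivative pdir k f p) (at 0) \<and>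
        ((\<lambda>t. pdir k f (p + t *\<^sub>R k)) has_real_derivative pdir k (pdir k f) p) (at 0)) \<and>
     (\<forall>p\<in>S. (\<Sum>k\<in>Basis. pdir k (pdir k f) p) = - lam * f p)"

lemma pdir_eqI: "((\<lambda>t. f (p + t *\<^sub>R k)) has_real_derivative c) (at 0) \<Longrightarrow> pdir k f p = c"
  unfolding pdir_def by (rule DERIV_imp_deriv)

lemma eventually_line_in_open:
  assumes "open S" "p \<in> S"
  shows "\<forall>\<^sub>F t in nhds 0. p + t *\<^sub>R (k::'a::real_normed_vector) \<in> S"
proof -
  have "((\<lambda>t. p + t *\<^sub>R k) \<longlongrightarrow> p + 0 *\<^sub>R k) (nhds 0)"
    by (intro tendsto_intros filterlim_ident)
  then show ?thesis using assms by (auto simp: tendsto_def)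
qed

lemma helm_subset: "helm S lam f \<Longrightarrow> T \<subseteq> S \<Longrightarrow> helm T lam f"
  unfolding helm_def by (auto intro: continuous_on_subset)

lemma helm_deriv_line:
  assumes "helm S lam f" "p + t *\<^sub>R k \<in> S" "k \<in> Basis"
  shows "((\<lambda>t. f (p + t *\<^sub>R k)) has_real_derivative pdir k f (p + t *\<^sub>R k)) (at t)"
    and "((\<lambda>t. pdir k f (p + t *\<^sub>R k)) has_real_derivative pdir k (pdir k f) (p + t *\<^sub>R k)) (at t)"
proof -
  have *: "((\<lambda>s. f ((p + t *\<^sub>R k) + s *\<^sub>R k)) has_real_derivative pdir k f (p + t *\<^sub>R k)) (at 0)"
    "((\<lambda>s. pdir k f ((p + t *\<^sub>R k) + s *\<^sub>R k)) has_real_derivative pdir k (pdir k f) (p + t *\<^sub>R k)) (at 0)"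
    using assms unfolding helm_def by auto
  show "((\<lambda>t. f (p + t *\<^sub>R k)) has_real_derivative pdir k f (p + t *\<^sub>R k)) (at t)"
    using *(1) DERIV_shift[of "\<lambda>t. f (p + t *\<^sub>R k)" _ 0 t] by (simp add: algebra_simps)
  show "((\<lambda>t. pdir k f (p + t *\<^sub>R k)) has_real_derivative pdir k (pdir k f) (p + t *\<^sub>R k)) (at t)"
    using *(2) DERIV_shift[of "\<lambda>t. pdir k f (p + t *\<^sub>R k)" _ 0 t] by (simp add: algebra_simps)
qed

lemma helm_has_D2:
  assumes "helm S lam f" "open S" "p \<in> S" "k \<in> Basis"
  shows "has_D2 (\<lambda>t. f (p + t *\<^sub>R k)) (pdir k (pdir k f) p)"
  unfolding has_D2_def
proof (intro exI conjI)
  show "\<forall>\<^sub>F t in nhds 0. ((\<lambda>t. f (p + t *\<^sub>R k)) has_real_derivative pdir k f (p + t *\<^sub>R k)) (at t)"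
    using eventually_line_in_open[OF assms(2,3), of k]
    by eventually_elim (rule helm_deriv_line(1)[OF assms(1) _ assms(4)])
  show "((\<lambda>t. pdir k f (p + t *\<^sub>R k)) has_real_derivative pdir k (pdir k f) p) (at 0)"
    using assms unfolding helm_def by blast
qed

lemma helm_sum: "helm S lam f \<Longrightarrow> p \<in> S \<Longrightarrow> (\<Sum>k\<in>Basis. pdir k (pdir k f) p) = - lam * f p"
  unfolding helm_def by blast

text \<open>\<open>pdir\<close> has an unspecified value where no derivative exists, hence the
  candidates \<open>g\<close> and \<open>h\<close>. Agreement of \<open>pdir k f\<close> with
  \<open>g k\<close> on the whole open set is what allows \<open>g k\<close> to be differentiated in
  its place.\<close>

lemma helmI:
  assumes "open S" "continuous_on S f"
    and d1: "\<And>p k. p \<in> S \<Longrightarrow> k \<in> Basis \<Longrightarrow> ((\<lambda>t. f (p + t *\<^sub>R k)) has_real_derivative g k p) (at 0)"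
    and d2: "\<And>p k. p \<in> S \<Longrightarrow> k \<in> Basis \<Longrightarrow> ((\<lambda>t. g k (p + t *\<^sub>R k)) has_real_derivative h k p) (at 0)"
    and sum: "\<And>p. p \<in> S \<Longrightarrow> (\<Sum>k\<in>Basis. h k p) = - lam * f p"
  shows "helm S lam f"
    and "\<And>p k. p \<in> S \<Longrightarrow> k \<in> Basis \<Longrightarrow> pdir k f p = g k p"
    and "\<And>p k. p \<in> S \<Longrightarrow> k \<in> Basis \<Longrightarrow> pdir k (pdir k f) p = h k p"
proof -
  show 1: "pdir k f p = g k p" if "p \<in> S" "k \<in> Basis" for p k
    using d1[OF that] by (rule pdir_eqI)
  have 2: "((\<lambda>t. pdir k f (p + t *\<^sub>R k)) has_real_derivative h k p) (at 0)"
    if "p \<in> S" "k \<in> Basis" for p k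
  proof -
    have "\<forall>\<^sub>F t in nhds 0. g k (p + t *\<^sub>R k) = pdir k f (p + t *\<^sub>R k)"
      using eventually_line_in_open[OF \<open>open S\<close> \<open>p \<in> S\<close>, of k]
      by eventually_elim (rule 1[symmetric, OF _ that(2)])
    then show ?thesis using d2[OF that] by (subst (asm) DERIV_cong_ev[OF refl _ refl])
  qed
  show 3: "pdir k (pdir k f) p = h k p" if "p \<in> S" "k \<in> Basis" for p k
    using 2[OF that] by (rule pdir_eqI)
  show "helm S lam f" unfolding helm_def using assms 1 2 3 by auto
qed

section \<open>Interior estimates for the Helmholtz equation\<close>

text \<open>Balls of the maximum norm are invariant under reflection in coordinate hyperplanes
  through the centre, and regrouping the coordinates of a point of \<open>cube (p, p) r\<close>
  gives points of \<open>cube p r\<close>.\<close>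

definition cube :: "'a::euclidean_space \<Rightarrow> real \<Rightarrow> 'a set" where
  "cube p d = {q. \<forall>k\<in>Basis. \<bar>(q - p) \<bullet> k\<bar> \<le> d}"

lemma cube_eq_cbox: "cube p d = cbox (p - d *\<^sub>R One) (p + d *\<^sub>R One)"
  by (auto simp: cube_def mem_box inner_diff_left inner_add_left abs_le_iff algebra_simps)

lemma compact_cube: "compact (cube p d)"
  by (simp add: cube_eq_cbox)

lemma cube_trans: "q \<in> cube p d \<Longrightarrow> r \<in> cube q e \<Longrightarrow> r \<in> cube p (d + e)"
  unfolding cube_def by (fastforce simp: inner_diff_left)

lemma cube_line: "k \<in> Basis \<Longrightarrow> \<bar>t\<bar> \<le> d \<Longrightarrow> p + t *\<^sub>R k \<in> cube p d"
  unfolding cube_def by (auto simp: inner_Basis)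

lemma cube_self: "0 \<le> d \<Longrightarrow> p \<in> cube p d"
  by (simp add: cube_def)

lemma cube_mono: "d \<le> e \<Longrightarrow> cube p d \<subseteq> cube p e"
  by (force simp: cube_def)

lemma cube_subset: "q \<in> cube p d \<Longrightarrow> cube q e \<subseteq> cube p (d + e)"
  using cube_trans by blast

lemma cube_in_open:
  fixes p :: "'a::euclidean_space"
  assumes "open S" "p \<in> S"
  obtains d where "d > 0" "cube p d \<subseteq> S"
proof -
  obtain e where e: "e > 0" "cball p e \<subseteq> S"
    using assms open_contains_cball by blast
  define d where "d = e / DIM('a)"
  have "cube p d \<subseteq> cball p e"
  proof
    fix q assume "q \<in> cube p d"
    then have "norm (q - p) \<le> (\<Sum>k\<in>Basis. \<bar>(q - p) \<bullet> k\<bar>)" "\<And>k. k \<in> Basis \<Longrightarrow> \<bar>(q - p) \<bullet> k\<bar> \<le> d"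
      by (auto simp: cube_def norm_le_l1)
    then have "norm (q - p) \<le> (\<Sum>k\<in>(Basis::'a set). d)"
      using sum_mono[of "Basis::'a set" "\<lambda>k. \<bar>(q - p) \<bullet> k\<bar>" "\<lambda>k. d"] by (meson order_trans)
    then show "q \<in> cball p e" by (simp add: d_def dist_norm norm_minus_commute)
  qed
  moreover have "d > 0" using e by (simp add: d_def)
  ultimately show ?thesis using that e by blast
qed

text \<open>Slope at the origin of the barrier \<open>\<psi>\<close> of
  \<open>helm_gradient_signed\<close>, divided by M. It is the classical gradient bound n/d sup|f| +
  d/2 sup|g| for Poisson's equation with right-hand side g = - lam f; the summand 1 makes the
  comparison strict.\<close>

definition grad_const :: "'a::euclidean_space itself \<Rightarrow> real \<Rightarrow> real \<Rightarrow> real" where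
  "grad_const T lam d = real DIM('a) / d + (\<bar>lam\<bar> + 1) * d / 2"

lemma grad_const_pos: "d > 0 \<Longrightarrow> grad_const TYPE('a::euclidean_space) lam d > 0"
  unfolding grad_const_def by (intro add_pos_nonneg divide_pos_pos) auto

text \<open>The odd part of \<open>f\<close> with respect to the hyperplane through \<open>p\<close> orthogonal to \<open>i\<close> vanishes
  on that hyperplane, where it is compared with an explicit quadratic barrier.\<close>

lemma helm_gradient_signed:
  fixes f :: "'a::euclidean_space \<Rightarrow> real"
  assumes S: "open S" "helm S lam f" and d: "d > 0" and cube: "cube p d \<subseteq> S"
    and M: "\<And>q. q \<in> cube p d \<Longrightarrow> \<bar>f q\<bar> \<le> M" "M > 0" and i: "i \<in> Basis" and \<sigma>: "\<bar>\<sigma>\<bar> = 1"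
  shows "\<sigma> * pdir i f p \<le> grad_const TYPE('a) lam d * M"
proof -
  define n where "n = real DIM('a)"
  define N where "N = (\<bar>lam\<bar> + 1) * M"
  define R where "R = (\<lambda>z::'a. z - (2 * (z \<bullet> i)) *\<^sub>R i)"
  define \<phi> where "\<phi> = (\<lambda>z. \<sigma> / 2 * (f (p + z) - f (p + R z)))"
  \<comment> \<open>The first bracket is harmonic, since n (z \<bullet> i)^2 cancels the Laplacian 2
    n of |z|^2; the second term has Laplacian - N. On the outer faces the term |z|^2 alone gives
    \<psi> \<ge> M \<ge> \<phi>. At an interior maximum of \<phi> - \<psi> one would get N \<le> lam
    \<phi> \<le> |lam| M, which is less than N.\<close>
  define \<psi> where "\<psi> = (\<lambda>z. M / d\<^sup>2 * (z \<bullet> z + n * d * (z \<bullet> i) - n * (z \<bullet> i)\<^sup>2)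
      + N / 2 * ((z \<bullet> i) * (d - z \<bullet> i)))"
  define H where "H = {z. (\<forall>k\<in>Basis. \<bar>z \<bullet> k\<bar> \<le> d) \<and> 0 \<le> z \<bullet> i}"
  have n: "n \<ge> 0" by (simp add: n_def)
  have N: "N > 0" using M(2) by (simp add: N_def)
  have ii: "i \<bullet> i = 1" using i by (simp add: inner_Basis)
  have R: "R z \<bullet> k = (if k = i then - (z \<bullet> k) else z \<bullet> k)" if "k \<in> Basis" for z k
    using that i by (simp add: R_def inner_diff_left inner_Basis)
  have mem: "p + z \<in> cube p d" "p + R z \<in> cube p d" if "z \<in> H" for z
    using that by (auto simp: H_def cube_def R)
  have \<phi>_le: "\<bar>\<phi> z\<bar> \<le> M" if "z \<in> H" for z
    using M(1)[OF mem(1)[OF that]] M(1)[OF mem(2)[OF that]] \<sigma>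
    by (auto simp: \<phi>_def abs_mult)
  have compact: "compact H"
  proof -
    have "H = cube 0 d \<inter> {z. 0 \<le> z \<bullet> i}" by (auto simp: H_def cube_def)
    moreover have "closed {z. 0 \<le> z \<bullet> i}"
      using closed_halfspace_ge[of 0 i] by (simp add: inner_commute)
    ultimately show ?thesis using compact_Int_closed[OF compact_cube] by metis
  qed
  have cf: "continuous_on (cube p d) f"
    using S(2) cube unfolding helm_def by (blast intro: continuous_on_subset)
  have cont: "continuous_on H (\<lambda>z. \<phi> z - \<psi> z)"
  proof -
    have "continuous_on H (\<lambda>z. f (p + z))"
      by (rule continuous_on_compose2[OF cf]) (auto intro!: continuous_intros mem)
    moreover have "continuous_on H R" unfolding R_def by (intro continuous_intros)
    then have "continuous_on H (\<lambda>z. f (p + R z))"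
      by (intro continuous_on_compose2[OF cf]) (auto intro!: continuous_intros mem)
    ultimately show ?thesis unfolding \<phi>_def \<psi>_def by (intro continuous_intros)
  qed
  have key: "\<phi> w \<le> \<psi> w" if w: "w \<in> H" for w
  proof (rule ccontr)
    assume "\<not> \<phi> w \<le> \<psi> w"
    obtain z where z: "z \<in> H" "\<And>y. y \<in> H \<Longrightarrow> \<phi> y - \<psi> y \<le> \<phi> z - \<psi> z"
      using continuous_attains_sup[OF compact _ cont] w by blast
    have gt: "\<phi> z > \<psi> z" using z(2)[OF w] \<open>\<not> \<phi> w \<le> \<psi> w\<close> by linarith
    have zi: "0 \<le> z \<bullet> i" "z \<bullet> i \<le> d" using z(1) i by (auto simp: H_def)
    have prod: "0 \<le> (z \<bullet> i) * (d - z \<bullet> i)" using zi by simp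
    have \<psi>_ge: "\<psi> z \<ge> M / d\<^sup>2 * (z \<bullet> z)"
    proof -
      have "\<psi> z = M / d\<^sup>2 * (z \<bullet> z) + (M / d\<^sup>2 * n + N / 2) * ((z \<bullet> i) * (d - z \<bullet> i))"
        by (simp add: \<psi>_def algebra_simps power2_eq_square)
      moreover have "0 \<le> (M / d\<^sup>2 * n + N / 2) * ((z \<bullet> i) * (d - z \<bullet> i))"
        by (intro mult_nonneg_nonneg prod add_nonneg_nonneg) (use M(2) n N in auto)
      ultimately show ?thesis by linarith
    qed
    have "z \<bullet> i \<noteq> 0"
    proof
      assume "z \<bullet> i = 0"
      then have "\<phi> z = 0" by (simp add: \<phi>_def R_def)
      moreover have "0 \<le> M / d\<^sup>2 * (z \<bullet> z)" using M(2) by auto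
      ultimately show False using \<psi>_ge gt by linarith
    qed
    moreover have "\<bar>z \<bullet> k\<bar> \<noteq> d" if k: "k \<in> Basis" for k
    proof
      assume "\<bar>z \<bullet> k\<bar> = d"
      moreover have "\<bar>z \<bullet> k\<bar> \<le> norm z" using k by (rule Basis_le_norm)
      ultimately have "d\<^sup>2 \<le> z \<bullet> z" using d by (simp add: power2_norm_eq_inner[symmetric])
      then have "M / d\<^sup>2 * d\<^sup>2 \<le> M / d\<^sup>2 * (z \<bullet> z)" using M(2) by (intro mult_left_mono) auto
      then have "M \<le> \<psi> z" using \<psi>_ge d by simp
      then show False using \<phi>_le[OF z(1)] gt by linarith
    qed
    ultimately have zin: "z \<in> box (- (d *\<^sub>R One)) (d *\<^sub>R One) \<inter> {z. 0 < z \<bullet> i}"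
      using z(1) zi by (force simp: H_def mem_box)
    have op: "open (box (- (d *\<^sub>R One)) (d *\<^sub>R One) \<inter> {z. 0 < z \<bullet> i})"
      using open_halfspace_gt[of 0 i] by (intro open_Int) (auto simp: inner_commute)
    define c where "c = (\<lambda>k. \<sigma> / 2 * (pdir k (pdir k f) (p + z) - pdir k (pdir k f) (p + R z)))"
    define e where "e = (\<lambda>k. M / d\<^sup>2 * (2 - (if k = i then 2 * n else 0)) - (if k = i then N else 0))"
    have "c k - e k \<le> 0" if k: "k \<in> Basis" for k
    proof (rule has_D2_local_max)
      have D: "has_D2 (\<lambda>t. f (p + z + t *\<^sub>R k)) (pdir k (pdir k f) (p + z))"
        "has_D2 (\<lambda>t. f (p + R z + t *\<^sub>R k)) (pdir k (pdir k f) (p + R z))"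
        using helm_has_D2[OF S(2,1) _ k] mem[OF z(1)] cube by blast+
      \<comment> \<open>The reflection turns t into - t when k = i and does nothing otherwise; a
        second derivative does not notice the sign.\<close>
      have D': "has_D2 (\<lambda>t. f (p + R (z + t *\<^sub>R k))) (pdir k (pdir k f) (p + R z))"
      proof (cases "k = i")
        case True
        have "p + R (z + t *\<^sub>R k) = p + R z + (- t) *\<^sub>R k" for t
          using True ii by (simp add: R_def algebra_simps) (simp add: scaleR_add_left[symmetric])
        then show ?thesis using has_D2_reflect[OF D(2)] by (simp add: add_diff_eq)
      next
        case False
        have "p + R (z + t *\<^sub>R k) = p + R z + t *\<^sub>R k" for t
          using False i k by (simp add: R_def algebra_simps inner_Basis)
        then show ?thesis using D(2) by (simp add: add.assoc)
      qed
      have 1: "has_D2 (\<lambda>t. \<phi> (z + t *\<^sub>R k)) (c k)"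
        unfolding \<phi>_def c_def using D(1) D'
        by (intro has_D2_cmult has_D2_diff) (simp_all add: add.assoc)
      have kk: "k \<bullet> k = 1" using k by (simp add: inner_Basis)
      have 2: "has_D2 (\<lambda>t. \<psi> (z + t *\<^sub>R k)) (e k)"
      proof (cases "k = i")
        case True
        have "\<psi> (z + t *\<^sub>R k) = \<psi> z + (M / d\<^sup>2 * (2 * (z \<bullet> i) + n * d - 2 * n * (z \<bullet> i))
            + N / 2 * (d - 2 * (z \<bullet> i))) * t + (e k / 2) * t\<^sup>2" for t
          using True ii unfolding \<psi>_def e_def
          by (simp add: inner_add_left inner_add_right inner_commute[of i z] field_simps)
            (simp add: algebra_simps power2_eq_square add_divide_distrib diff_divide_distrib)
        then show ?thesis by (rule has_D2_quadratic')
      next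
        case False
        then have "k \<bullet> i = 0" using i k by (simp add: inner_Basis)
        then have "\<psi> (z + t *\<^sub>R k) = \<psi> z + (M / d\<^sup>2 * (2 * (z \<bullet> k))) * t + (e k / 2) * t\<^sup>2" for t
          using False kk unfolding \<psi>_def e_def
          by (simp add: inner_add_left inner_add_right inner_commute[of k z] algebra_simps power2_eq_square)
        then show ?thesis by (rule has_D2_quadratic')
      qed
      show "has_D2 (\<lambda>t. \<phi> (z + t *\<^sub>R k) - \<psi> (z + t *\<^sub>R k)) (c k - e k)"
        by (rule has_D2_diff[OF 1 2])
      show "\<forall>\<^sub>F t in nhds 0. \<phi> (z + t *\<^sub>R k) - \<psi> (z + t *\<^sub>R k) \<le> \<phi> (z + 0 *\<^sub>R k) - \<psi> (z + 0 *\<^sub>R k)"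
        using eventually_line_in_open[OF op zin, of k]
      proof eventually_elim
        case (elim t)
        then have "z + t *\<^sub>R k \<in> H" by (force simp: H_def mem_box abs_le_iff)
        then show ?case using z(2) by simp
      qed
    qed
    then have "(\<Sum>k\<in>Basis. c k - e k) \<le> 0" by (intro sum_nonpos) auto
    moreover have "(\<Sum>k\<in>Basis. c k) = - lam * \<phi> z"
    proof -
      have "(\<Sum>k\<in>Basis. c k) = \<sigma> / 2 * ((\<Sum>k\<in>Basis. pdir k (pdir k f) (p + z))
          - (\<Sum>k\<in>Basis. pdir k (pdir k f) (p + R z)))"
        unfolding c_def sum_distrib_left[symmetric] sum_subtractf ..
      also have "\<dots> = \<sigma> / 2 * (- lam * f (p + z) - - lam * f (p + R z))"
        using helm_sum[OF S(2), of "p + z"] helm_sum[OF S(2), of "p + R z"] mem[OF z(1)] cube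
        by (simp add: subset_iff)
      finally show ?thesis by (simp add: \<phi>_def algebra_simps)
    qed
    moreover have "(\<Sum>k\<in>Basis. e k) = - N"
    proof -
      have "(\<Sum>k\<in>Basis. e k) = M / d\<^sup>2 * (\<Sum>k\<in>Basis. 2 - (if k = i then 2 * n else 0))
          - (\<Sum>k\<in>Basis. (if k = i then N else 0))"
        unfolding e_def by (simp only: sum_distrib_left sum_subtractf[symmetric])
      then show ?thesis using i by (simp add: sum_subtractf sum.delta n_def)
    qed
    ultimately have "N \<le> lam * \<phi> z" by (simp add: sum_subtractf)
    also have "\<dots> \<le> \<bar>lam\<bar> * \<bar>\<phi> z\<bar>" by (metis abs_ge_self abs_mult)
    also have "\<dots> \<le> \<bar>lam\<bar> * M" using \<phi>_le[OF z(1)] by (intro mult_left_mono) auto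
    finally show False using M(2) by (simp add: N_def algebra_simps)
  qed
  define D where "D = pdir i f p"
  have "p \<in> S" using cube cube_self[of d p] d by auto
  then have fD: "((\<lambda>t. f (p + t *\<^sub>R i)) has_real_derivative D) (at 0)"
    using S(2) i unfolding helm_def D_def by blast
  then have "((\<lambda>t. f (p + (- t) *\<^sub>R i)) has_real_derivative - D) (at 0)"
    using DERIV_mirror[of "\<lambda>t. f (p + t *\<^sub>R i)" D 0] by simp
  with fD have "((\<lambda>t. \<sigma> / 2 * (f (p + t *\<^sub>R i) - f (p + (- t) *\<^sub>R i)))
      has_real_derivative \<sigma> / 2 * (D - - D)) (at 0)"
    by (intro DERIV_cmult DERIV_diff)
  moreover have "R (t *\<^sub>R i) = (- t) *\<^sub>R i" for t
    using ii by (simp add: R_def scaleR_left_diff_distrib[symmetric] del: scaleR_minus_left)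
  then have "\<phi> (t *\<^sub>R i) = \<sigma> / 2 * (f (p + t *\<^sub>R i) - f (p + (- t) *\<^sub>R i))" for t
    by (simp add: \<phi>_def)
  moreover have "\<sigma> / 2 * (D - - D) = \<sigma> * D" by simp
  ultimately have d\<phi>: "((\<lambda>t. \<phi> (t *\<^sub>R i)) has_real_derivative \<sigma> * D) (at 0)"
    by (simp only:)
  have "\<psi> (t *\<^sub>R i) = M / d\<^sup>2 * (t * t + n * d * t - n * t\<^sup>2) + N / 2 * (t * (d - t))" for t
    using ii by (simp add: \<psi>_def)
  moreover have "((\<lambda>t. a * (t * t + n * d * t - n * t\<^sup>2) + N / 2 * (t * (d - t)))
      has_real_derivative a * (n * d) + N / 2 * d) (at 0)" for a
    by (auto intro!: derivative_eq_intros)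
  ultimately have d\<psi>: "((\<lambda>t. \<psi> (t *\<^sub>R i)) has_real_derivative M / d\<^sup>2 * (n * d) + N / 2 * d) (at 0)"
    by presburger
  \<comment> \<open>\<phi> and \<psi> agree at the origin and \<phi> \<le> \<psi> on the ray t \<ge>
    0, so their slopes there are ordered.\<close>
  have "\<sigma> * D \<le> M / d\<^sup>2 * (n * d) + N / 2 * d"
  proof (rule ccontr)
    assume "\<not> ?thesis"
    then obtain \<delta> where \<delta>: "\<delta> > 0"
      "\<And>h. h > 0 \<Longrightarrow> h < \<delta> \<Longrightarrow> \<psi> (0 *\<^sub>R i) - \<phi> (0 *\<^sub>R i) > \<psi> ((0 + h) *\<^sub>R i) - \<phi> ((0 + h) *\<^sub>R i)"
      using DERIV_neg_dec_right[OF DERIV_diff[OF d\<psi> d\<phi>]] by auto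
    define h where "h = min \<delta> d / 2"
    have h: "h > 0" "h < \<delta>" "h \<le> d" using \<delta>(1) d by (auto simp: h_def)
    have "h *\<^sub>R i \<in> H" using h i ii by (auto simp: H_def inner_Basis)
    then have "\<phi> (h *\<^sub>R i) \<le> \<psi> (h *\<^sub>R i)" by (rule key)
    moreover have "\<psi> (0 *\<^sub>R i) - \<phi> (0 *\<^sub>R i) = 0" by (simp add: \<psi>_def \<phi>_def R_def)
    ultimately show False using \<delta>(2)[OF h(1,2)] by simp
  qed
  also have "\<dots> = grad_const TYPE('a) lam d * M"
    using d by (simp add: grad_const_def n_def N_def field_simps power2_eq_square)
  finally show ?thesis by (simp add: D_def)
qed

lemma helm_gradient:
  fixes f :: "'a::euclidean_space \<Rightarrow> real"
  assumes "open S" "helm S lam f" "d > 0" "cube p d \<subseteq> S"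
    "\<And>q. q \<in> cube p d \<Longrightarrow> \<bar>f q\<bar> \<le> M" "M > 0" "i \<in> Basis"
  shows "\<bar>pdir i f p\<bar> \<le> grad_const TYPE('a) lam d * M"
  using helm_gradient_signed[OF assms, of 1] helm_gradient_signed[OF assms, of "-1"] by simp

section \<open>Linear combinations, translates and difference quotients of solutions\<close>

lemma helm_cmult_add:
  assumes "open S" "helm S lam f" "helm S lam g"
  shows "helm S lam (\<lambda>q. a * f q + b * g q)"
    and "\<And>p k. p \<in> S \<Longrightarrow> k \<in> Basis \<Longrightarrow>
      pdir k (\<lambda>q. a * f q + b * g q) p = a * pdir k f p + b * pdir k g p"
    and "\<And>p k. p \<in> S \<Longrightarrow> k \<in> Basis \<Longrightarrow> pdir k (pdir k (\<lambda>q. a * f q + b * g q)) p =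
      a * pdir k (pdir k f) p + b * pdir k (pdir k g) p"
proof -
  have cont: "continuous_on S (\<lambda>q. a * f q + b * g q)"
    using assms(2,3) unfolding helm_def by (intro continuous_intros) auto
  have 1: "((\<lambda>t. a * f (p + t *\<^sub>R k) + b * g (p + t *\<^sub>R k)) has_real_derivative
      a * pdir k f p + b * pdir k g p) (at 0)"
    and 2: "((\<lambda>t. a * pdir k f (p + t *\<^sub>R k) + b * pdir k g (p + t *\<^sub>R k)) has_real_derivative
      a * pdir k (pdir k f) p + b * pdir k (pdir k g) p) (at 0)"
    if "p \<in> S" "k \<in> Basis" for p k
    using assms(2,3) that unfolding helm_def by (auto intro!: DERIV_add DERIV_cmult)
  have 3: "(\<Sum>k\<in>Basis. a * pdir k (pdir k f) p + b * pdir k (pdir k g) p) =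
      - lam * (a * f p + b * g p)" if "p \<in> S" for p
    using helm_sum[OF assms(2) that] helm_sum[OF assms(3) that]
    by (simp add: sum.distrib sum_distrib_left[symmetric] algebra_simps)
  note * = helmI[OF \<open>open S\<close> cont 1 2 3]
  show "helm S lam (\<lambda>q. a * f q + b * g q)" by (rule *(1))
  show "pdir k (\<lambda>q. a * f q + b * g q) p = a * pdir k f p + b * pdir k g p"
    if "p \<in> S" "k \<in> Basis" for p k by (rule *(2)[OF _ _ _ _ _ that])
  show "pdir k (pdir k (\<lambda>q. a * f q + b * g q)) p =
      a * pdir k (pdir k f) p + b * pdir k (pdir k g) p"
    if "p \<in> S" "k \<in> Basis" for p k by (rule *(3)[OF _ _ _ _ _ that])
qed

lemma pdir_translate: "pdir k (\<lambda>q. f (q + v)) p = pdir k f (p + v)"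
  unfolding pdir_def by (simp add: algebra_simps)

lemma helm_translate:
  assumes S: "helm S lam f" and T: "\<And>q. q \<in> T \<Longrightarrow> q + v \<in> S"
  shows "helm T lam (\<lambda>q. f (q + v))"
proof -
  have eq: "pdir k (\<lambda>q. f (q + v)) = (\<lambda>p. pdir k f (p + v))" for k
    by (rule ext) (rule pdir_translate)
  have eq2: "pdir k (\<lambda>p. pdir k f (p + v)) = (\<lambda>p. pdir k (pdir k f) (p + v))" for k
    by (rule ext) (rule pdir_translate)
  have "continuous_on T (\<lambda>q. f (q + v))"
    by (rule continuous_on_compose2[of S f]) (use S T in \<open>auto simp: helm_def intro!: continuous_intros\<close>)
  moreover have *: "(\<lambda>t. g (p + t *\<^sub>R k + v)) = (\<lambda>t. g ((p + v) + t *\<^sub>R k))" for g :: "'a \<Rightarrow> real" and p k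
    by (simp add: algebra_simps)
  have "((\<lambda>t. f (p + t *\<^sub>R k + v)) has_real_derivative pdir k f (p + v)) (at 0) \<and>
      ((\<lambda>t. pdir k f (p + t *\<^sub>R k + v)) has_real_derivative pdir k (pdir k f) (p + v)) (at 0)"
    if "p \<in> T" "k \<in> Basis" for p k
    unfolding *[of f] *[of "pdir k f"] using S T[OF that(1)] that(2) unfolding helm_def by blast
  moreover have "(\<Sum>k\<in>Basis. pdir k (pdir k f) (p + v)) = - lam * f (p + v)" if "p \<in> T" for p
    by (rule helm_sum[OF S T[OF that]])
  ultimately show ?thesis unfolding helm_def eq eq2 by blast
qed

definition diffq :: "'a::real_vector \<Rightarrow> real \<Rightarrow> ('a \<Rightarrow> real) \<Rightarrow> 'a \<Rightarrow> real" where
  "diffq i s f q = (f (q + s *\<^sub>R i) - f q) / s"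

lemma helm_diffq:
  fixes f :: "'a::euclidean_space \<Rightarrow> real" and s :: real and i :: 'a
  assumes "open S" "helm S lam f"
  defines "T \<equiv> S \<inter> (\<lambda>q. q + s *\<^sub>R i) -` S"
  shows "open T" "helm T lam (diffq i s f)"
    and "\<And>p k. p \<in> T \<Longrightarrow> k \<in> Basis \<Longrightarrow> pdir k (diffq i s f) p = diffq i s (pdir k f) p"
proof -
  show T: "open T" unfolding T_def
    by (intro open_Int open_vimage assms continuous_intros)
  have h: "helm T lam (\<lambda>q. f (q + s *\<^sub>R i))" "helm T lam f"
    by (rule helm_translate[OF assms(2)]) (auto simp: T_def intro: helm_subset[OF assms(2)])
  have eq: "diffq i s f = (\<lambda>q. (1 / s) * f (q + s *\<^sub>R i) + (- 1 / s) * f q)"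
    by (rule ext) (simp add: diffq_def field_simps diff_divide_distrib)
  note * = helm_cmult_add[OF T h, where a = "1 / s" and b = "- 1 / s"]
  show "helm T lam (diffq i s f)" unfolding eq by (rule *(1))
  show "pdir k (diffq i s f) p = diffq i s (pdir k f) p" if "p \<in> T" "k \<in> Basis" for p k
    unfolding eq using *(2)[OF that] by (simp add: pdir_translate diffq_def diff_divide_distrib)
qed

lemma deriv_line_bound:
  assumes "\<And>t. \<bar>t\<bar> \<le> \<bar>s\<bar> \<Longrightarrow> (h has_real_derivative h' t) (at t)"
    and "\<And>t. \<bar>t\<bar> \<le> \<bar>s\<bar> \<Longrightarrow> \<bar>h' t\<bar> \<le> B"
  shows "\<bar>h s - h 0\<bar> \<le> B * \<bar>s\<bar>"
proof -
  have "norm (h s - h 0) \<le> B * norm (s - 0)"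
    by (rule field_differentiable_bound[of "{- \<bar>s\<bar>..\<bar>s\<bar>}" h h'])
       (use assms in \<open>auto simp: abs_le_iff intro: has_field_derivative_at_within\<close>)
  then show ?thesis by simp
qed

lemma diffq_bound:
  fixes f :: "'a::euclidean_space \<Rightarrow> real"
  assumes "helm S lam f" "cube q \<bar>s\<bar> \<subseteq> S" "i \<in> Basis"
    and "\<And>r. r \<in> cube q \<bar>s\<bar> \<Longrightarrow> \<bar>pdir i f r\<bar> \<le> B" "B \<ge> 0"
  shows "\<bar>diffq i s f q\<bar> \<le> B"
\<comment> \<open>For s = 0 the quotient is 0, by the convention on division by zero.\<close>
proof (cases "s = 0")
  case False
  have "\<bar>f (q + s *\<^sub>R i) - f (q + 0 *\<^sub>R i)\<bar> \<le> B * \<bar>s\<bar>"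
    using assms(2,4) cube_line[OF assms(3), of _ "\<bar>s\<bar>" q]
    by (intro deriv_line_bound[of s "\<lambda>t. f (q + t *\<^sub>R i)" "\<lambda>t. pdir i f (q + t *\<^sub>R i)"]
        helm_deriv_line(1)[OF assms(1) _ assms(3)]) auto
  then show ?thesis using False by (simp add: diffq_def field_simps)
qed (use assms in \<open>auto simp: diffq_def\<close>)

text \<open>The gradient estimate is applied twice: to \<open>f\<close>, which bounds the difference
  quotient in direction i, and then to that quotient, which is itself a solution. Each application,
  and the shift by t, uses up one r of the radius 3 r.\<close>

lemma helm_pdir_Lipschitz:
  fixes f :: "'a::euclidean_space \<Rightarrow> real"
  assumes S: "open S" "helm S lam f" and r: "r > 0" and cube: "cube p (3 * r) \<subseteq> S"
    and M: "\<And>q. q \<in> cube p (3 * r) \<Longrightarrow> \<bar>f q\<bar> \<le> M" "M > 0"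
    and i: "i \<in> Basis" and k: "k \<in> Basis" and t: "\<bar>t\<bar> \<le> r"
  shows "\<bar>pdir k f (p + t *\<^sub>R i) - pdir k f p\<bar> \<le> (grad_const TYPE('a) lam r)\<^sup>2 * M * \<bar>t\<bar>"
proof (cases "t = 0")
  case False
  define G where "G = grad_const TYPE('a) lam r"
  have G: "G > 0" unfolding G_def by (rule grad_const_pos[OF r])
  define T where "T = S \<inter> (\<lambda>q. q + t *\<^sub>R i) -` S"
  note w = helm_diffq[OF S, where s = t and i = i, folded T_def]
  have D: "\<bar>pdir i f q\<bar> \<le> G * M" if "q \<in> cube p (2 * r)" for q
  proof -
    have "cube q r \<subseteq> cube p (3 * r)" using cube_subset[OF that, of r] by simp
    then show ?thesis unfolding G_def using cube M
      by (intro helm_gradient[OF S r _ _ M(2) i]) auto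
  qed
  have sub: "cube p r \<subseteq> T"
  proof
    fix q assume q: "q \<in> cube p r"
    have "q + t *\<^sub>R i \<in> cube p (r + r)" by (rule cube_trans[OF q cube_line[OF i t]])
    then have "q \<in> cube p (3 * r)" "q + t *\<^sub>R i \<in> cube p (3 * r)"
      using q cube_mono[of r "3 * r" p] cube_mono[of "r + r" "3 * r" p] r by auto
    then show "q \<in> T" using cube by (auto simp: T_def)
  qed
  have "\<bar>diffq i t f q\<bar> \<le> G * M" if q: "q \<in> cube p r" for q
  proof (rule diffq_bound[OF S(2) _ i])
    have sub': "cube q \<bar>t\<bar> \<subseteq> cube p (2 * r)"
      using cube_subset[OF q, of "\<bar>t\<bar>"] cube_mono[of "r + \<bar>t\<bar>" "2 * r" p] t by force
    then show "cube q \<bar>t\<bar> \<subseteq> S" using cube cube_mono[of "2 * r" "3 * r" p] r by force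
    show "\<bar>pdir i f x\<bar> \<le> G * M" if "x \<in> cube q \<bar>t\<bar>" for x using that sub' D by blast
  qed (use G M in auto)
  then have "\<bar>pdir k (diffq i t f) p\<bar> \<le> G * (G * M)"
    unfolding G_def using M G by (intro helm_gradient[OF w(1,2) r sub _ _ k]) (auto simp: G_def)
  moreover have "p \<in> T" using sub cube_self[of r p] r by auto
  ultimately show ?thesis using w(3)[OF _ k] False
    by (simp add: diffq_def G_def[symmetric] power2_eq_square divide_le_eq mult.assoc)
qed simp

lemma deriv_le_of_Lipschitz:
  assumes h: "(h has_real_derivative D) (at 0)" and "r > 0"
    and L: "\<And>t. \<bar>t\<bar> \<le> r \<Longrightarrow> \<bar>h t - h 0\<bar> \<le> B * \<bar>t\<bar>"
  shows "\<bar>D\<bar> \<le> B"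
proof -
  have "((\<lambda>t. \<bar>(h (0 + t) - h 0) / t\<bar>) \<longlongrightarrow> \<bar>D\<bar>) (at 0)"
    using h unfolding DERIV_def by (intro tendsto_intros)
  moreover have "\<forall>\<^sub>F t in at 0. \<bar>(h (0 + t) - h 0) / t\<bar> \<le> B"
    unfolding eventually_at
    by (rule exI[of _ r]) (use L \<open>r > 0\<close> in \<open>auto simp: divide_le_eq dist_real_def\<close>)
  ultimately show ?thesis by (rule tendsto_upperbound) simp
qed

lemma helm_pdir2_bound:
  fixes f :: "'a::euclidean_space \<Rightarrow> real"
  assumes S: "open S" "helm S lam f" and r: "r > 0" and cube: "cube p (3 * r) \<subseteq> S"
    and M: "\<And>q. q \<in> cube p (3 * r) \<Longrightarrow> \<bar>f q\<bar> \<le> M" "M > 0" and k: "k \<in> Basis"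
  shows "\<bar>pdir k (pdir k f) p\<bar> \<le> (grad_const TYPE('a) lam r)\<^sup>2 * M"
proof (rule deriv_le_of_Lipschitz[OF _ r])
  have "p \<in> S" using cube cube_self[of "3 * r" p] r by auto
  then show "((\<lambda>t. pdir k f (p + t *\<^sub>R k)) has_real_derivative pdir k (pdir k f) p) (at 0)"
    using S(2) k unfolding helm_def by blast
qed (use helm_pdir_Lipschitz[OF S r cube M k k] in auto)

section \<open>Smoothness of solutions\<close>

lemma has_real_derivative_limit:
  fixes F :: "nat \<Rightarrow> real \<Rightarrow> real"
  assumes der: "\<And>n t. \<bar>t\<bar> < d \<Longrightarrow> (F n has_real_derivative F' n t) (at t)"
    and lim: "\<And>t. \<bar>t\<bar> < d \<Longrightarrow> (\<lambda>n. F n t) \<longlonglongrightarrow> g t"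
    and unif: "\<And>n t. \<bar>t\<bar> < d \<Longrightarrow> \<bar>F' n t - A t\<bar> \<le> e n" and e: "e \<longlonglongrightarrow> 0"
    and s: "\<bar>s\<bar> < d"
  shows "(g has_real_derivative A s) (at s)"
proof -
  define S where "S = {- d<..<d}"
  have S: "open S" "s \<in> S" using s by (auto simp: S_def)
  have "\<exists>h. \<forall>x\<in>S. (\<lambda>n. F n x) \<longlonglongrightarrow> h x \<and> (h has_derivative (*) (A x)) (at x within S)"
  proof (rule has_derivative_sequence)
    show "convex S" by (simp add: S_def)
    show "(F n has_derivative (*) (F' n x)) (at x within S)" if "x \<in> S" for n x
      using der[of x n] that
      by (auto simp: S_def has_field_derivative_def intro: has_derivative_at_withinI)
    show "\<forall>\<^sub>F n in sequentially. \<forall>x\<in>S. \<forall>h. norm (F' n x * h - A x * h) \<le> \<epsilon> * norm h"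
      if "\<epsilon> > 0" for \<epsilon>
    proof -
      have "\<forall>\<^sub>F n in sequentially. e n < \<epsilon>" using e that by (rule order_tendstoD)
      then show ?thesis
      proof eventually_elim
        case (elim n)
        have "\<bar>F' n x * h - A x * h\<bar> \<le> \<epsilon> * \<bar>h\<bar>" if "x \<in> S" for x h
        proof -
          have "\<bar>F' n x - A x\<bar> \<le> \<epsilon>" using unif[of x n] elim that by (auto simp: S_def abs_less_iff)
          then have "\<bar>F' n x - A x\<bar> * \<bar>h\<bar> \<le> \<epsilon> * \<bar>h\<bar>" by (intro mult_right_mono) auto
          then show ?thesis by (simp add: abs_mult[symmetric] left_diff_distrib)
        qed
        then show ?case by simp
      qed
    qed
    show "(\<lambda>n. F n s) \<longlonglongrightarrow> g s" using lim s by auto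
  qed (rule S)
  then obtain h where h: "\<And>x. x \<in> S \<Longrightarrow> (\<lambda>n. F n x) \<longlonglongrightarrow> h x"
    "\<And>x. x \<in> S \<Longrightarrow> (h has_derivative (*) (A x)) (at x within S)" by blast
  have "h x = g x" if "x \<in> S" for x
    using LIMSEQ_unique[OF h(1)[OF that] lim] that by (auto simp: S_def)
  then have ev: "\<forall>\<^sub>F x in nhds s. h x = g x"
    using eventually_nhds_in_open[OF S] by (auto elim: eventually_mono)
  have "(h has_real_derivative A s) (at s)"
    using h(2)[OF S(2)] S unfolding has_field_derivative_def by (simp only: at_within_open)
  then show ?thesis by (rule iffD1[OF DERIV_cong_ev[OF refl ev refl]])
qed

text \<open>Keeping the rate \<open>e\<close> in the limit makes the convergence uniform in any
  parameter on which \<open>e\<close> does not depend.\<close>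

lemma Cauchy_limit_bound:
  fixes a :: "nat \<Rightarrow> real"
  assumes b: "\<And>n m. \<bar>a n - a m\<bar> \<le> e n + e m" and e: "e \<longlonglongrightarrow> 0"
  obtains l where "a \<longlonglongrightarrow> l" "\<And>n. \<bar>a n - l\<bar> \<le> e n"
proof -
  have "Cauchy a"
  proof (rule metric_CauchyI)
    fix \<epsilon> :: real assume "\<epsilon> > 0"
    then have "\<forall>\<^sub>F n in sequentially. e n < \<epsilon> / 2" using e by (intro order_tendstoD) auto
    then obtain N where "\<And>n. n \<ge> N \<Longrightarrow> e n < \<epsilon> / 2" unfolding eventually_sequentially by blast
    then have "\<bar>a m - a n\<bar> < \<epsilon>" if "m \<ge> N" "n \<ge> N" for m n
      using b[of m n] that by (smt (verit) field_sum_of_halves)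
    then show "\<exists>M. \<forall>m\<ge>M. \<forall>n\<ge>M. dist (a m) (a n) < \<epsilon>"
      unfolding dist_real_def by blast
  qed
  then obtain l where l: "a \<longlonglongrightarrow> l" using Cauchy_convergent_iff convergent_def by blast
  have "\<bar>a n - l\<bar> \<le> e n" for n
  proof -
    have "(\<lambda>m. \<bar>a n - a m\<bar>) \<longlonglongrightarrow> \<bar>a n - l\<bar>" by (intro tendsto_intros l)
    moreover have "(\<lambda>m. e n + e m) \<longlonglongrightarrow> e n + 0" by (intro tendsto_intros e)
    ultimately have "\<bar>a n - l\<bar> \<le> e n + 0" by (rule LIMSEQ_le) (use b in auto)
    then show ?thesis by simp
  qed
  with l that show ?thesis by blast
qed

text \<open>Difference quotients of \<open>f\<close> are solutions and converge uniformly to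
  \<open>pdir i f\<close> at rate O(s). The interior estimates carry this rate over to their first
  and second derivatives, so the limit is again a solution. Iterating gives the third derivatives in
  the theorem, although \<open>u\<close> is only assumed to be C2.\<close>

lemma helm_pdir:
  fixes f :: "'a::euclidean_space \<Rightarrow> real"
  assumes S: "open S" "helm S lam f" and i: "i \<in> Basis"
  shows "helm S lam (pdir i f)"
proof -
  have main: "isCont (pdir i f) p \<and>
      (\<forall>k\<in>Basis. ((\<lambda>t. pdir i f (p + t *\<^sub>R k)) has_real_derivative pdir k (pdir i f) p) (at 0) \<and>
        ((\<lambda>t. pdir k (pdir i f) (p + t *\<^sub>R k)) has_real_derivative pdir k (pdir k (pdir i f)) p) (at 0)) \<and>
      (\<Sum>k\<in>Basis. pdir k (pdir k (pdir i f)) p) = - lam * pdir i f p" if p: "p \<in> S" for p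
  proof -
    obtain d where d: "d > 0" "cube p d \<subseteq> S" using cube_in_open[OF S(1) p] .
    \<comment> \<open>The quotients are controlled on \<open>cube p (2 * r)\<close>, and the
      Lipschitz estimate needs 3 r more.\<close>
    define r where "r = d / 5"
    have r: "r > 0" and cube: "cube p (5 * r) \<subseteq> S" using d by (auto simp: r_def)
    have "continuous_on (cube p (5 * r)) f"
      using S(2) cube unfolding helm_def by (blast intro: continuous_on_subset)
    then have "bounded (f ` cube p (5 * r))"
      using compact_cube compact_continuous_image compact_imp_bounded by blast
    then obtain M where M: "M > 0" "\<And>q. q \<in> cube p (5 * r) \<Longrightarrow> \<bar>f q\<bar> \<le> M"
      unfolding bounded_pos by auto
    define B where "B = (grad_const TYPE('a) lam r)\<^sup>2 * M"
    define G where "G = grad_const TYPE('a) lam (r / 3)"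
    define s where "s = (\<lambda>n. r / real (Suc n))"
    define w where "w = (\<lambda>n. diffq i (s n) f)"
    have B: "B > 0" unfolding B_def using M(1) grad_const_pos[OF r, where 'a='a, of lam]
      by (intro mult_pos_pos) auto
    have G: "G > 0" unfolding G_def by (rule grad_const_pos) (use r in simp)
    have s: "s n > 0" "s n \<le> r" for n using r by (auto simp: s_def divide_le_eq)
    have s0: "s \<longlonglongrightarrow> 0" unfolding s_def by (rule LIMSEQ_Suc[OF lim_const_over_n])
    have sub: "cube q e \<subseteq> cube p (5 * r)" if "q \<in> cube p c" "c + e \<le> 5 * r" for q c e
      using cube_subset[OF that(1), of e] cube_mono[OF that(2), of p] by blast
    have lip: "\<bar>pdir j f (q + \<xi> *\<^sub>R i) - pdir j f q\<bar> \<le> B * \<bar>\<xi>\<bar>"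
      if "q \<in> cube p (2 * r)" "\<bar>\<xi>\<bar> \<le> r" "j \<in> Basis" for q \<xi> j
      unfolding B_def using sub[OF that(1), of "3 * r"] cube M(2) that(2)
      by (intro helm_pdir_Lipschitz[OF S r _ _ M(1) i that(3)]) auto
    have conv: "\<bar>w n q - pdir i f q\<bar> \<le> B * s n" if q: "q \<in> cube p (2 * r)" for n q
    proof -
      \<comment> \<open>After the linear part is subtracted, the derivative along the line is an
        increment of \<open>pdir i f\<close>, which \<open>lip\<close> makes O(s n).\<close>
      have "\<bar>(f (q + s n *\<^sub>R i) - s n * pdir i f q) - (f (q + 0 *\<^sub>R i) - 0 * pdir i f q)\<bar> \<le> (B * s n) * \<bar>s n\<bar>"
      proof (rule deriv_line_bound)
        fix t assume t: "\<bar>t\<bar> \<le> \<bar>s n\<bar>"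
        then have tr: "\<bar>t\<bar> \<le> r" "\<bar>t\<bar> \<le> s n" using s[of n] by auto
        have "q + t *\<^sub>R i \<in> cube p (5 * r)"
          using cube_line[OF i tr(1), of q] sub[OF q, of r] r by auto
        then have "((\<lambda>t. f (q + t *\<^sub>R i)) has_real_derivative pdir i f (q + t *\<^sub>R i)) (at t)"
          using cube by (intro helm_deriv_line(1)[OF S(2) _ i]) auto
        then show "((\<lambda>t. f (q + t *\<^sub>R i) - t * pdir i f q) has_real_derivative
            pdir i f (q + t *\<^sub>R i) - pdir i f q) (at t)"
          by (auto intro!: derivative_eq_intros)
        have "\<bar>pdir i f (q + t *\<^sub>R i) - pdir i f q\<bar> \<le> B * \<bar>t\<bar>" by (rule lip[OF q tr(1) i])
        also have "\<dots> \<le> B * s n" using B tr by (intro mult_left_mono) auto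
        finally show "\<bar>pdir i f (q + t *\<^sub>R i) - pdir i f q\<bar> \<le> B * s n" .
      qed
      moreover have "w n q - pdir i f q = ((f (q + s n *\<^sub>R i) - s n * pdir i f q) - f q) / s n"
        using s(1)[of n] by (simp add: w_def diffq_def field_simps)
      ultimately show ?thesis using s(1)[of n] by (simp add: divide_le_eq)
    qed
    define T where "T = (\<lambda>n. S \<inter> (\<lambda>q. q + s n *\<^sub>R i) -` S)"
    have T: "open (T n)" "helm (T n) lam (w n)" for n
      using helm_diffq[OF S, where s = "s n" and i = i] unfolding T_def w_def by auto
    have cT: "cube p (2 * r) \<subseteq> T n" for n
    proof
      fix q assume q: "q \<in> cube p (2 * r)"
      have "q + s n *\<^sub>R i \<in> cube q r" using s[of n] by (intro cube_line[OF i]) auto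
      then have "q + s n *\<^sub>R i \<in> S" using sub[OF q, of r] r cube by auto
      moreover have "q \<in> S" using sub[OF q, of r] r cube cube_self[of r q] by auto
      ultimately show "q \<in> T n" by (simp add: T_def)
    qed
    have cauchy: "\<bar>pdir k (w n) q - pdir k (w m) q\<bar> \<le> G * B * s n + G * B * s m"
      "\<bar>pdir k (pdir k (w n)) q - pdir k (pdir k (w m)) q\<bar> \<le> G\<^sup>2 * B * s n + G\<^sup>2 * B * s m"
      if q: "q \<in> cube p r" and k: "k \<in> Basis" for k n m q
    proof -
      have o: "open (T n \<inter> T m)" using T by auto
      have h: "helm (T n \<inter> T m) lam (w n)" "helm (T n \<inter> T m) lam (w m)"
        by (auto intro: helm_subset[OF T(2)])
      \<comment> \<open>The difference of two quotients solves the same equation, so its sup bound B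
        (s n + s m) passes to its derivatives.\<close>
      note v = helm_cmult_add[OF o h, where a = 1 and b = "-1"]
      have sub2: "cube q (3 * (r / 3)) \<subseteq> cube p (2 * r)" using cube_subset[OF q, of r] by simp
      then have sub1: "cube q (r / 3) \<subseteq> cube p (2 * r)"
        using cube_mono[of "r / 3" "3 * (r / 3)" q] r by force
      have qT: "q \<in> T n \<inter> T m" using sub1 cT cube_self[of "r / 3" q] r by fastforce
      have bd: "\<bar>1 * w n x + - 1 * w m x\<bar> \<le> B * (s n + s m)" if "x \<in> cube p (2 * r)" for x
        using conv[OF that, of n] conv[OF that, of m] by (simp add: distrib_left)
      have pos: "B * (s n + s m) > 0" using B s[of n] s[of m] by (intro mult_pos_pos) auto
      have r3: "r / 3 > 0" using r by simp
      have "\<bar>pdir k (\<lambda>q. 1 * w n q + - 1 * w m q) q\<bar> \<le> G * (B * (s n + s m))"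
        unfolding G_def using sub1 cT bd
        by (intro helm_gradient[OF o v(1) r3 _ _ pos k]) blast+
      then show "\<bar>pdir k (w n) q - pdir k (w m) q\<bar> \<le> G * B * s n + G * B * s m"
        unfolding v(2)[OF qT k] by (simp add: algebra_simps)
      have "\<bar>pdir k (pdir k (\<lambda>q. 1 * w n q + - 1 * w m q)) q\<bar> \<le> G\<^sup>2 * (B * (s n + s m))"
        unfolding G_def using sub2 cT bd
        by (intro helm_pdir2_bound[OF o v(1) r3 _ _ pos k]) blast+
      then show "\<bar>pdir k (pdir k (w n)) q - pdir k (pdir k (w m)) q\<bar> \<le> G\<^sup>2 * B * s n + G\<^sup>2 * B * s m"
        unfolding v(3)[OF qT k] by (simp add: algebra_simps)
    qed
    have lims0: "(\<lambda>n. c * s n) \<longlonglongrightarrow> 0" for c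
      using tendsto_mult[OF tendsto_const s0, of c] by simp
    define A where "A = (\<lambda>k q. lim (\<lambda>n. pdir k (w n) q))"
    have A: "(\<lambda>n. pdir k (w n) q) \<longlonglongrightarrow> A k q"
      "\<bar>pdir k (w n) q - A k q\<bar> \<le> G * B * s n"
      if "q \<in> cube p r" "k \<in> Basis" for k q n
      by (rule Cauchy_limit_bound[OF cauchy(1)[OF that] lims0], simp add: A_def limI)+
    define H where "H = (\<lambda>k q. lim (\<lambda>n. pdir k (pdir k (w n)) q))"
    have H: "(\<lambda>n. pdir k (pdir k (w n)) q) \<longlonglongrightarrow> H k q"
      "\<bar>pdir k (pdir k (w n)) q - H k q\<bar> \<le> G\<^sup>2 * B * s n"
      if "q \<in> cube p r" "k \<in> Basis" for k q n
      by (rule Cauchy_limit_bound[OF cauchy(2)[OF that] lims0], simp add: H_def limI)+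
    have in2: "q \<in> cube p (2 * r)" if "q \<in> cube p r" for q
      using that cube_mono[of r "2 * r" p] r by auto
    have wlim: "(\<lambda>n. w n q) \<longlonglongrightarrow> pdir i f q" if "q \<in> cube p r" for q
    proof -
      have "(\<lambda>n. w n q - pdir i f q) \<longlonglongrightarrow> 0"
        by (rule Lim_null_comparison[OF _ lims0[of B]]) (use conv[OF in2[OF that]] in auto)
      then show ?thesis using Lim_null by blast
    qed
    have Lin: "p + t *\<^sub>R k \<in> cube p r" if "k \<in> Basis" "\<bar>t\<bar> < r" for k t
      using that by (intro cube_line) auto
    have LT: "p + t *\<^sub>R k \<in> T n" if "k \<in> Basis" "\<bar>t\<bar> < r" for k t n
      using cT in2[OF Lin[OF that]] by auto
    have dA: "((\<lambda>t. pdir i f (p + t *\<^sub>R k)) has_real_derivative A k (p + t *\<^sub>R k)) (at t)"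
      if k: "k \<in> Basis" and t: "\<bar>t\<bar> < r" for k t
      by (rule has_real_derivative_limit[where d = r and e = "\<lambda>n. G * B * s n" and
            F = "\<lambda>n t. w n (p + t *\<^sub>R k)" and F' = "\<lambda>n t. pdir k (w n) (p + t *\<^sub>R k)" and
            A = "\<lambda>t. A k (p + t *\<^sub>R k)"])
         (use helm_deriv_line(1)[OF T(2) LT[OF k] k] wlim[OF Lin[OF k]] A[OF Lin[OF k] k] lims0 t in auto)
    have dH: "((\<lambda>t. A k (p + t *\<^sub>R k)) has_real_derivative H k (p + 0 *\<^sub>R k)) (at 0)"
      if k: "k \<in> Basis" for k
      by (rule has_real_derivative_limit[where d = r and e = "\<lambda>n. G\<^sup>2 * B * s n" and
            F = "\<lambda>n t. pdir k (w n) (p + t *\<^sub>R k)" and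
            F' = "\<lambda>n t. pdir k (pdir k (w n)) (p + t *\<^sub>R k)" and
            A = "\<lambda>t. H k (p + t *\<^sub>R k)"])
         (use helm_deriv_line(2)[OF T(2) LT[OF k] k] A[OF Lin[OF k] k] H[OF Lin[OF k] k] lims0 r in auto)
    have eqA: "pdir k (pdir i f) (p + t *\<^sub>R k) = A k (p + t *\<^sub>R k)"
      if k: "k \<in> Basis" and t: "\<bar>t\<bar> < r" for k t
      using dA[OF that] DERIV_shift[of "\<lambda>t. pdir i f (p + t *\<^sub>R k)" _ 0 t]
      by (intro pdir_eqI) (simp add: algebra_simps)
    have d1: "((\<lambda>t. pdir i f (p + t *\<^sub>R k)) has_real_derivative pdir k (pdir i f) p) (at 0)"
      if k: "k \<in> Basis" for k
      using dA[OF k, of 0] eqA[OF k, of 0] r by simp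
    have d2: "((\<lambda>t. pdir k (pdir i f) (p + t *\<^sub>R k)) has_real_derivative H k p) (at 0)"
      if k: "k \<in> Basis" for k
    proof -
      have "\<forall>\<^sub>F t in nhds 0. pdir k (pdir i f) (p + t *\<^sub>R k) = A k (p + t *\<^sub>R k)"
        unfolding eventually_nhds_metric using eqA[OF k] r by auto
      then show ?thesis using dH[OF k] by (subst DERIV_cong_ev[OF refl _ refl]) auto
    qed
    have H_eq: "pdir k (pdir k (pdir i f)) p = H k p" if "k \<in> Basis" for k
      by (rule pdir_eqI) (rule d2[OF that])
    have pr: "p \<in> cube p r" using cube_self[of r p] r by auto
    have "(\<lambda>n. \<Sum>k\<in>Basis. pdir k (pdir k (w n)) p) \<longlonglongrightarrow> (\<Sum>k\<in>Basis. H k p)"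
      by (intro tendsto_sum) (use H[OF pr] in auto)
    moreover have "(\<lambda>n. - lam * w n p) \<longlonglongrightarrow> - lam * pdir i f p"
      by (intro tendsto_intros wlim pr)
    moreover have "(\<Sum>k\<in>Basis. pdir k (pdir k (w n)) p) = - lam * w n p" for n
      using helm_sum[OF T(2)] cT in2[OF pr] by blast
    ultimately have sum: "(\<Sum>k\<in>Basis. H k p) = - lam * pdir i f p"
      using LIMSEQ_unique by auto
    have "uniform_limit (cube p r) w (pdir i f) sequentially"
    proof (rule uniform_limitI)
      fix \<epsilon> :: real assume "\<epsilon> > 0"
      then have "\<forall>\<^sub>F n in sequentially. B * s n < \<epsilon>" by (intro order_tendstoD[OF lims0])
      then show "\<forall>\<^sub>F n in sequentially. \<forall>x\<in>cube p r. dist (w n x) (pdir i f x) < \<epsilon>"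
        by eventually_elim (use conv[OF in2] in \<open>auto simp: dist_real_def intro: le_less_trans\<close>)
    qed
    moreover have "continuous_on (cube p r) (w n)" for n
      using T(2)[of n] cT[of n] in2 unfolding helm_def by (blast intro: continuous_on_subset)
    ultimately have "continuous_on (cube p r) (pdir i f)"
      by (intro uniform_limit_theorem[where f = w and F = sequentially]) auto
    moreover have "p \<in> interior (cube p r)"
      unfolding cube_eq_cbox using r by (simp add: interior_cbox mem_box inner_diff_left inner_add_left)
    ultimately have "isCont (pdir i f) p" by (rule continuous_on_interior)
    with d1 d2 H_eq sum show ?thesis by simp
  qed
  have "continuous_on S (pdir i f)" using main by (intro continuous_at_imp_continuous_on) auto
  with main show ?thesis unfolding helm_def by blast
qed

section \<open>Mixed derivatives of the logarithm\<close>

lemma Basis_real2: "(Basis :: (real \<times> real) set) = {(1, 0), (0, 1)}"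
  by (auto simp: Basis_prod_def)

lemma Basis_real4:
  "(Basis :: ((real \<times> real) \<times> (real \<times> real)) set) =
    {((1, 0), (0, 0)), ((0, 1), (0, 0)), ((0, 0), (1, 0)), ((0, 0), (0, 1))}"
  unfolding Basis_prod_def by (auto simp: zero_prod_def)

lemma sum_Basis_real4:
  fixes \<phi> :: "(real \<times> real) \<times> (real \<times> real) \<Rightarrow> real"
  shows "(\<Sum>k\<in>Basis. \<phi> k) =
    \<phi> ((1, 0), (0, 0)) + \<phi> ((0, 1), (0, 0)) + \<phi> ((0, 0), (1, 0)) + \<phi> ((0, 0), (0, 1))"
  unfolding Basis_real4 by simp

lemma sum_Basis_real2:
  fixes \<phi> :: "real \<times> real \<Rightarrow> real"
  shows "(\<Sum>k\<in>Basis. \<phi> k) = \<phi> (1, 0) + \<phi> (0, 1)"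
  unfolding Basis_real2 by simp

lemma deriv_shift: "deriv (\<lambda>t. f (a + t)) 0 = deriv f (a::real)"
  unfolding deriv_def using DERIV_shift[of f _ 0 a] by (simp add: add.commute)

lemma dx_eq_pdir: "dx f p = pdir (1, 0) f p"
  unfolding dx_def pdir_def
  using deriv_shift[of "\<lambda>s. f (s, snd p)" "fst p"] by (cases p) simp

lemma dy_eq_pdir: "dy f p = pdir (0, 1) f p"
  unfolding dy_def pdir_def
  using deriv_shift[of "\<lambda>s. f (fst p, s)" "snd p"] by (cases p) simp

text \<open>The determinant of \<open>u\<close> on the grid {x, x'} times {y, y'}. It vanishes when
  \<open>u\<close> is a product X(x) Y(y), as for a rectangle.\<close>

definition cross :: "(real \<times> real \<Rightarrow> real) \<Rightarrow> (real \<times> real) \<times> (real \<times> real) \<Rightarrow> real" where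
  "cross u P = u (fst P) * u (snd P)
     - u (fst (fst P), snd (snd P)) * u (fst (snd P), snd (fst P))"

definition cross_dom :: "(real \<times> real) set \<Rightarrow> ((real \<times> real) \<times> (real \<times> real)) set" where
  "cross_dom S = {P. fst P \<in> S \<and> snd P \<in> S \<and>
     (fst (fst P), snd (snd P)) \<in> S \<and> (fst (snd P), snd (fst P)) \<in> S}"

lemma open_cross_dom: "open S \<Longrightarrow> open (cross_dom S)"
proof -
  assume S: "open S"
  have "cross_dom S = fst -` S \<inter> snd -` S \<inter> (\<lambda>P. (fst (fst P), snd (snd P))) -` S
      \<inter> (\<lambda>P. (fst (snd P), snd (fst P))) -` S"
    by (auto simp: cross_dom_def)
  then show ?thesis using S
    by (auto intro!: open_Int open_vimage continuous_intros)
qed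

text \<open>A step in one of the four coordinates leaves two of the four grid points fixed. Treating
  these as moving in direction 0 gives one product rule for all coordinates.\<close>

lemma pdir_0 [simp]: "pdir 0 f p = 0"
  by (rule pdir_eqI) simp

lemma helm_deriv_Basis_0:
  assumes "helm S lam u" "p \<in> S" "v \<in> Basis \<or> v = 0"
  shows "((\<lambda>t. u (p + t *\<^sub>R v)) has_real_derivative pdir v u p) (at 0)"
    and "((\<lambda>t. pdir v u (p + t *\<^sub>R v)) has_real_derivative pdir v (pdir v u) p) (at 0)"
  using assms unfolding helm_def by auto

text \<open>The last two facts say that no coordinate moves both factors of a product in
  \<open>cross\<close>; hence second derivatives of the products have no mixed terms.\<close>

lemma cross_directions:
  fixes k :: "(real \<times> real) \<times> (real \<times> real)"
  assumes "k \<in> Basis"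
  shows "fst k \<in> Basis \<or> fst k = 0" "snd k \<in> Basis \<or> snd k = 0"
    "(fst (fst k), snd (snd k)) \<in> Basis \<or> (fst (fst k), snd (snd k)) = 0"
    "(fst (snd k), snd (fst k)) \<in> Basis \<or> (fst (snd k), snd (fst k)) = 0"
    "fst k = 0 \<or> snd k = 0"
    "(fst (fst k), snd (snd k)) = 0 \<or> (fst (snd k), snd (fst k)) = 0"
  using assms unfolding Basis_real4 by (auto simp: Basis_real2 zero_prod_def)

text \<open>Over the four coordinates every grid point is moved once in x and once in y, so each
  factor contributes its own Laplacian and each product collects - lam twice.\<close>

lemma
  assumes S: "open S" "helm S lam u"
  shows helm_cross: "helm (cross_dom S) (2 * lam) (cross u)"
    and pdir_cross: "\<And>P k. P \<in> cross_dom S \<Longrightarrow> k \<in> Basis \<Longrightarrow> pdir k (cross u) P =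
      pdir (fst k) u (fst P) * u (snd P) + u (fst P) * pdir (snd k) u (snd P)
      - (pdir (fst (fst k), snd (snd k)) u (fst (fst P), snd (snd P)) * u (fst (snd P), snd (fst P))
        + u (fst (fst P), snd (snd P)) * pdir (fst (snd k), snd (fst k)) u (fst (snd P), snd (fst P)))"
proof -
  define h where "h = (\<lambda>k P.
      pdir (fst k) (pdir (fst k) u) (fst P) * u (snd P) + u (fst P) * pdir (snd k) (pdir (snd k) u) (snd P)
      - (pdir (fst (fst k), snd (snd k)) (pdir (fst (fst k), snd (snd k)) u) (fst (fst P), snd (snd P))
          * u (fst (snd P), snd (fst P))
        + u (fst (fst P), snd (snd P)) *
          pdir (fst (snd k), snd (fst k)) (pdir (fst (snd k), snd (fst k)) u) (fst (snd P), snd (fst P))))"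
  have cu: "continuous_on S u" using S(2) by (simp add: helm_def)
  have cont: "continuous_on (cross_dom S) (cross u)"
    unfolding cross_def
    by (intro continuous_intros continuous_on_compose2[OF cu]) (auto simp: cross_dom_def)
  have eq: "fst (P + t *\<^sub>R k) = fst P + t *\<^sub>R fst k" "snd (P + t *\<^sub>R k) = snd P + t *\<^sub>R snd k"
    "(fst (fst P + t *\<^sub>R fst k), snd (snd P + t *\<^sub>R snd k)) =
      (fst (fst P), snd (snd P)) + t *\<^sub>R (fst (fst k), snd (snd k))"
    "(fst (snd P + t *\<^sub>R snd k), snd (fst P + t *\<^sub>R fst k)) =
      (fst (snd P), snd (fst P)) + t *\<^sub>R (fst (snd k), snd (fst k))"
    for P k :: "(real \<times> real) \<times> (real \<times> real)" and t
    by auto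
  have 1: "((\<lambda>t. cross u (P + t *\<^sub>R k)) has_real_derivative
      pdir (fst k) u (fst P) * u (snd P) + u (fst P) * pdir (snd k) u (snd P)
      - (pdir (fst (fst k), snd (snd k)) u (fst (fst P), snd (snd P)) * u (fst (snd P), snd (fst P))
        + u (fst (fst P), snd (snd P)) * pdir (fst (snd k), snd (fst k)) u (fst (snd P), snd (fst P))))
      (at 0)"
    if P: "P \<in> cross_dom S" and k: "k \<in> Basis" for P k
  proof -
    have mem: "fst P \<in> S" "snd P \<in> S" "(fst (fst P), snd (snd P)) \<in> S"
      "(fst (snd P), snd (fst P)) \<in> S" using P by (auto simp: cross_dom_def)
    note d = helm_deriv_Basis_0[OF S(2) mem(1) cross_directions(1)[OF k]]
      helm_deriv_Basis_0[OF S(2) mem(2) cross_directions(2)[OF k]]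
      helm_deriv_Basis_0[OF S(2) mem(3) cross_directions(3)[OF k]]
      helm_deriv_Basis_0[OF S(2) mem(4) cross_directions(4)[OF k]]
    show ?thesis unfolding cross_def eq
      by (rule DERIV_cong[OF DERIV_diff[OF DERIV_mult[OF d(1) d(3)] DERIV_mult[OF d(5) d(7)]]])
        (simp add: algebra_simps)
  qed
  have 2: "((\<lambda>t. pdir (fst k) u (fst (P + t *\<^sub>R k)) * u (snd (P + t *\<^sub>R k))
      + u (fst (P + t *\<^sub>R k)) * pdir (snd k) u (snd (P + t *\<^sub>R k))
      - (pdir (fst (fst k), snd (snd k)) u (fst (fst (P + t *\<^sub>R k)), snd (snd (P + t *\<^sub>R k)))
          * u (fst (snd (P + t *\<^sub>R k)), snd (fst (P + t *\<^sub>R k)))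
        + u (fst (fst (P + t *\<^sub>R k)), snd (snd (P + t *\<^sub>R k)))
          * pdir (fst (snd k), snd (fst k)) u (fst (snd (P + t *\<^sub>R k)), snd (fst (P + t *\<^sub>R k)))))
      has_real_derivative h k P) (at 0)"
    if P: "P \<in> cross_dom S" and k: "k \<in> Basis" for P k
  proof -
    have z: "pdir (fst k) u (fst P) * pdir (snd k) u (snd P) = 0"
      "pdir (fst (fst k), snd (snd k)) u (fst (fst P), snd (snd P)) *
        pdir (fst (snd k), snd (fst k)) u (fst (snd P), snd (fst P)) = 0"
      using cross_directions(5,6)[OF k] by auto
    have mem: "fst P \<in> S" "snd P \<in> S" "(fst (fst P), snd (snd P)) \<in> S"
      "(fst (snd P), snd (fst P)) \<in> S" using P by (auto simp: cross_dom_def)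
    note d = helm_deriv_Basis_0[OF S(2) mem(1) cross_directions(1)[OF k]]
      helm_deriv_Basis_0[OF S(2) mem(2) cross_directions(2)[OF k]]
      helm_deriv_Basis_0[OF S(2) mem(3) cross_directions(3)[OF k]]
      helm_deriv_Basis_0[OF S(2) mem(4) cross_directions(4)[OF k]]
    show ?thesis unfolding eq
      by (rule DERIV_cong[OF DERIV_diff[OF DERIV_add[OF DERIV_mult[OF d(2) d(3)] DERIV_mult[OF d(1) d(4)]]
            DERIV_add[OF DERIV_mult[OF d(6) d(7)] DERIV_mult[OF d(5) d(8)]]]])
        (use z in \<open>auto simp: h_def algebra_simps\<close>)
  qed
  have 3: "(\<Sum>k\<in>Basis. h k P) = - (2 * lam) * cross u P" if P: "P \<in> cross_dom S" for P
  proof -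
    have s: "pdir (1, 0) (pdir (1, 0) u) q = - lam * u q - pdir (0, 1) (pdir (0, 1) u) q"
      if "q \<in> S" for q
      using helm_sum[OF S(2) that] unfolding sum_Basis_real2 by simp
    have z: "pdir (0, 0) f q = 0" for f :: "real \<times> real \<Rightarrow> real" and q
      using pdir_0[of f q] by (simp add: zero_prod_def)
    show ?thesis unfolding sum_Basis_real4 h_def
      using P by (simp add: z s cross_dom_def cross_def algebra_simps)
  qed
  note * = helmI[OF open_cross_dom[OF S(1)] cont 1 2 3]
  show "helm (cross_dom S) (2 * lam) (cross u)" by (rule *(1))
  show "pdir k (cross u) P =
      pdir (fst k) u (fst P) * u (snd P) + u (fst P) * pdir (snd k) u (snd P)
      - (pdir (fst (fst k), snd (snd k)) u (fst (fst P), snd (snd P)) * u (fst (snd P), snd (fst P))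
        + u (fst (fst P), snd (snd P)) * pdir (fst (snd k), snd (fst k)) u (fst (snd P), snd (fst P)))"
    if "P \<in> cross_dom S" "k \<in> Basis" for P k
    by (rule *(2)[OF _ _ _ _ _ that])
qed

lemma cube_cross_dom: "cube p r \<subseteq> S \<Longrightarrow> cube (p, p) r \<subseteq> cross_dom S"
proof
  fix P assume "cube p r \<subseteq> S" and P: "P \<in> cube (p, p) r"
  moreover have "fst P \<in> cube p r" "snd P \<in> cube p r"
    "(fst (fst P), snd (snd P)) \<in> cube p r" "(fst (snd P), snd (fst P)) \<in> cube p r"
    using P by (auto simp: cube_def Basis_real2 Basis_real4 inner_prod_def)
  ultimately show "P \<in> cross_dom S" by (auto simp: cross_dom_def)
qed

lemma grad_const_mono:
  "\<bar>lam\<bar> \<le> \<bar>\<Lambda>\<bar> \<Longrightarrow> d > 0 \<Longrightarrow> grad_const T lam d \<le> grad_const T \<Lambda> d"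
  unfolding grad_const_def by (intro add_mono divide_right_mono mult_right_mono) auto

text \<open>Three derivatives of \<open>cross u\<close> are estimated, each on a third of the cube;
  \<open>2 * \<Lambda>\<close> is the eigenvalue in four variables and \<open>G1\<close> bounds the
  gradient of \<open>u\<close>. With u \<ge> 1/2, division by u^2 and u^3 costs factors 4 and 8, and
  the three bounds \<open>v1\<close>, \<open>v2\<close>, \<open>v3\<close> of
  \<open>mixed_log_bound\<close> add up to this.\<close>

definition mixed_const :: "real \<Rightarrow> real \<Rightarrow> real" where
  "mixed_const \<Lambda> r = (let G = grad_const TYPE((real \<times> real) \<times> (real \<times> real)) (2 * \<Lambda>) (r / 3);
      G1 = grad_const TYPE(real \<times> real) \<Lambda> r in 4 * G\<^sup>2 + 12 * G ^ 3 + 32 * G\<^sup>2 * G1)"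

lemma pdir_cong:
  assumes "open S" "p \<in> S" "\<And>q. q \<in> S \<Longrightarrow> f q = g q"
  shows "pdir k f p = pdir k g p"
proof -
  have "\<forall>\<^sub>F t in nhds 0. f (p + t *\<^sub>R k) = g (p + t *\<^sub>R k)"
    using eventually_line_in_open[OF assms(1,2), of k] by eventually_elim (rule assms(3))
  then show ?thesis unfolding pdir_def by (intro deriv_cong_ev) auto
qed

lemma helm_deriv:
  assumes "helm S lam f" "p \<in> S" "k \<in> Basis"
  shows "((\<lambda>t. f (p + t *\<^sub>R k)) has_real_derivative pdir k f p) (at 0)"
  using assms unfolding helm_def by blast

lemma quotient_square_derivative:
  fixes c N W d :: real
  assumes "c \<noteq> 0"
  shows "(N * c\<^sup>2 - W * (real 2 * (d * c ^ (2 - Suc 0)))) / (c\<^sup>2 * c\<^sup>2) = N / c\<^sup>2 - 2 * W * d / c ^ 3"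
  using assms by (simp add: field_simps power2_eq_square power3_eq_cube)

text \<open>Mixed derivatives stand in the order in which differentiation produces them, which is
  also the order in which \<open>cross u\<close> yields them in
  \<open>mixed_log_bound\<close>.\<close>

lemma mixed_log_derivative:
  assumes S: "open S" "helm S lam u" and p: "p \<in> S" and pos: "\<And>q. q \<in> S \<Longrightarrow> u q > 0"
  defines "ux \<equiv> pdir (1, 0) u" and "uy \<equiv> pdir (0, 1) u"
  defines "uxy \<equiv> pdir (1, 0) uy"
  shows "dx (dy (\<lambda>q. ln (u q))) p = (u p * uxy p - ux p * uy p) / (u p)\<^sup>2"
    and "dx (dx (dy (\<lambda>q. ln (u q)))) p =
      (u p * pdir (1, 0) uxy p - pdir (1, 0) ux p * uy p) / (u p)\<^sup>2
        - 2 * (u p * uxy p - ux p * uy p) * ux p / (u p) ^ 3"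
    and "dy (dx (dy (\<lambda>q. ln (u q)))) p =
      (uy p * uxy p + u p * pdir (0, 1) uxy p - pdir (0, 1) ux p * uy p - ux p * pdir (0, 1) uy p) / (u p)\<^sup>2
        - 2 * (u p * uxy p - ux p * uy p) * uy p / (u p) ^ 3"
proof -
  have e: "(1, 0) \<in> (Basis :: (real \<times> real) set)" "(0, 1) \<in> (Basis :: (real \<times> real) set)"
    by (auto simp: Basis_real2)
  have h: "helm S lam ux" "helm S lam uy" "helm S lam uxy"
    unfolding ux_def uy_def uxy_def by (intro helm_pdir S e)+
  note D = helm_deriv
  have 1: "dy (\<lambda>q. ln (u q)) q = uy q / u q" if q: "q \<in> S" for q
    unfolding dy_eq_pdir
    by (rule pdir_eqI, rule DERIV_cong[OF DERIV_chain2[OF DERIV_ln D[OF S(2) q e(2)]]])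
      (use pos[OF q] in \<open>auto simp: uy_def divide_inverse mult.commute simp flip: zero_prod_def\<close>)
  have 2: "dx (dy (\<lambda>q. ln (u q))) q = (u q * uxy q - ux q * uy q) / (u q)\<^sup>2" if q: "q \<in> S" for q
  proof -
    have "dx (dy (\<lambda>q. ln (u q))) q = pdir (1, 0) (\<lambda>q. uy q / u q) q"
      unfolding dx_eq_pdir by (rule pdir_cong[OF S(1) q 1])
    also have "\<dots> = (u q * uxy q - ux q * uy q) / (u q)\<^sup>2"
      by (rule pdir_eqI, rule DERIV_cong[OF DERIV_divide[OF D[OF h(2) q e(1)] D[OF S(2) q e(1)]]])
        (use pos[OF q] in \<open>auto simp: uxy_def ux_def power2_eq_square algebra_simps simp flip: zero_prod_def\<close>)
    finally show ?thesis .
  qed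
  show "dx (dy (\<lambda>q. ln (u q))) p = (u p * uxy p - ux p * uy p) / (u p)\<^sup>2" by (rule 2[OF p])
  have 3: "pdir k (dx (dy (\<lambda>q. ln (u q)))) p =
      (pdir k u p * uxy p + u p * pdir k uxy p - pdir k ux p * uy p - ux p * pdir k uy p) / (u p)\<^sup>2
        - 2 * (u p * uxy p - ux p * uy p) * pdir k u p / (u p) ^ 3" if k: "k \<in> Basis" for k
  proof -
    have ne: "(u (p + 0 *\<^sub>R k))\<^sup>2 \<noteq> 0" using pos[OF p] by simp
    have "pdir k (dx (dy (\<lambda>q. ln (u q)))) p = pdir k (\<lambda>q. (u q * uxy q - ux q * uy q) / (u q)\<^sup>2) p"
      by (rule pdir_cong[OF S(1) p 2])
    also have "\<dots> = (pdir k u p * uxy p + u p * pdir k uxy p - pdir k ux p * uy p - ux p * pdir k uy p) / (u p)\<^sup>2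
        - 2 * (u p * uxy p - ux p * uy p) * pdir k u p / (u p) ^ 3"
      by (rule pdir_eqI, rule DERIV_cong[OF DERIV_divide[OF DERIV_diff[OF
            DERIV_mult[OF D[OF S(2) p k] D[OF h(3) p k]] DERIV_mult[OF D[OF h(1) p k] D[OF h(2) p k]]]
            DERIV_power[OF D[OF S(2) p k], of 2] ne]])
        (simp only: scaleR_zero_left add_0_right, subst quotient_square_derivative,
          use pos[OF p] in \<open>simp_all add: algebra_simps\<close>)
    finally show ?thesis .
  qed
  show "dx (dx (dy (\<lambda>q. ln (u q)))) p =
      (u p * pdir (1, 0) uxy p - pdir (1, 0) ux p * uy p) / (u p)\<^sup>2
        - 2 * (u p * uxy p - ux p * uy p) * ux p / (u p) ^ 3"
    using 3[OF e(1)] by (simp add: dx_eq_pdir[of _ p] uxy_def[symmetric] ux_def[symmetric] algebra_simps)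
  show "dy (dx (dy (\<lambda>q. ln (u q)))) p =
      (uy p * uxy p + u p * pdir (0, 1) uxy p - pdir (0, 1) ux p * uy p - ux p * pdir (0, 1) uy p) / (u p)\<^sup>2
        - 2 * (u p * uxy p - ux p * uy p) * uy p / (u p) ^ 3"
    using 3[OF e(2)] by (simp add: dy_eq_pdir[of "dx _" p] uy_def[symmetric])
qed

text \<open>On the diagonal, the numerator \<open>u u\<^sub>x\<^sub>y - u\<^sub>x u\<^sub>y\<close> of the mixed derivative of \<open>ln u\<close> is a mixed
  derivative of \<open>cross u\<close>.\<close>

lemma mixed_log_bound:
  assumes S: "open S" "helm S lam u" and lam: "\<bar>lam\<bar> \<le> \<bar>\<Lambda>\<bar>" and r: "r > 0" and cube: "cube p r \<subseteq> S"
    and pos: "\<And>q. q \<in> S \<Longrightarrow> u q > 0" and le1: "\<And>q. q \<in> S \<Longrightarrow> u q \<le> 1" and half: "u p \<ge> 1 / 2"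
    and \<delta>: "\<And>P. P \<in> cube (p, p) r \<Longrightarrow> \<bar>cross u P\<bar> \<le> \<delta>" "\<delta> > 0"
  shows "\<bar>dx (dy (\<lambda>q. ln (u q))) p\<bar> + norm (grad (dx (dy (\<lambda>q. ln (u q)))) p) \<le> mixed_const \<Lambda> r * \<delta>"
proof -
  define e :: "(real \<times> real) \<times> (real \<times> real)" where "e = ((1, 0), (0, 0))"
  define f :: "(real \<times> real) \<times> (real \<times> real)" where "f = ((0, 1), (0, 0))"
  define e' :: "(real \<times> real) \<times> (real \<times> real)" where "e' = ((0, 0), (1, 0))"
  define f' :: "(real \<times> real) \<times> (real \<times> real)" where "f' = ((0, 0), (0, 1))"
  have B4: "e \<in> Basis" "f \<in> Basis" "e' \<in> Basis" "f' \<in> Basis"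
    by (auto simp: Basis_real4 e_def f_def e'_def f'_def)
  have B2: "(1, 0) \<in> (Basis :: (real \<times> real) set)" "(0, 1) \<in> (Basis :: (real \<times> real) set)"
    by (auto simp: Basis_real2)
  define ux where "ux = pdir (1, 0) u"
  define uy where "uy = pdir (0, 1) u"
  define uxy where "uxy = pdir (1, 0) uy"
  have h: "helm S lam ux" "helm S lam uy" "helm S lam uxy"
    unfolding ux_def uy_def uxy_def by (intro helm_pdir S B2)+
  note D = helm_deriv
  define U where "U = cross_dom S"
  have U: "open U" unfolding U_def by (rule open_cross_dom[OF S(1)])
  \<comment> \<open>Both derivatives are taken at the first point only; x and y then hit different
    factors of the second product, which produces the term ux uy.\<close>
  define F1 where "F1 = pdir f (cross u)"
  define F2 where "F2 = pdir e F1"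
  have hF: "helm U (2 * lam) (cross u)" "helm U (2 * lam) F1" "helm U (2 * lam) F2"
    unfolding F1_def F2_def U_def
    by (intro helm_pdir open_cross_dom S B4 helm_cross)+
  have z: "pdir (0, 0) g q = 0" for g :: "real \<times> real \<Rightarrow> real" and q
    using pdir_0[of g q] by (simp add: zero_prod_def)
  have F1: "F1 P = uy (fst P) * u (snd P) - u (fst (fst P), snd (snd P)) * uy (fst (snd P), snd (fst P))"
    if "P \<in> U" for P
    using pdir_cross[OF S that[unfolded U_def] B4(2)] by (simp add: F1_def f_def z uy_def)
  have F2: "F2 P = uxy (fst P) * u (snd P) - ux (fst (fst P), snd (snd P)) * uy (fst (snd P), snd (fst P))"
    if P: "P \<in> U" for P
  proof -
    have mem: "fst P \<in> S" "(fst (fst P), snd (snd P)) \<in> S" using P by (auto simp: U_def cross_dom_def)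
    have "F2 P = pdir e (\<lambda>P. uy (fst P) * u (snd P)
        - u (fst (fst P), snd (snd P)) * uy (fst (snd P), snd (fst P))) P"
      unfolding F2_def by (rule pdir_cong[OF U P F1])
    also have "\<dots> = uxy (fst P) * u (snd P) - ux (fst (fst P), snd (snd P)) * uy (fst (snd P), snd (fst P))"
      using DERIV_diff[OF DERIV_cmult_right[OF D[OF h(2) mem(1) B2(1)], of "u (snd P)"]
          DERIV_cmult_right[OF D[OF S(2) mem(2) B2(1)], of "uy (fst (snd P), snd (fst P))"]]
      by (intro pdir_eqI) (cases P, auto simp: e_def uxy_def ux_def)
    finally show ?thesis .
  qed
  have pS: "p \<in> S" using cube cube_self[of r p] r by auto
  have cubeU: "cube (p, p) r \<subseteq> U" unfolding U_def by (rule cube_cross_dom[OF cube])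
  have pU: "(p, p) \<in> U" using pS by (simp add: U_def cross_dom_def)
  have F2p: "F2 (p, p) = u p * uxy p - ux p * uy p" using F2[OF pU] by simp
  have F2_pdir: "pdir k F2 (p, p) = c"
    if "((\<lambda>t. uxy (fst ((p, p) + t *\<^sub>R k)) * u (snd ((p, p) + t *\<^sub>R k))
        - ux (fst (fst ((p, p) + t *\<^sub>R k)), snd (snd ((p, p) + t *\<^sub>R k)))
          * uy (fst (snd ((p, p) + t *\<^sub>R k)), snd (fst ((p, p) + t *\<^sub>R k)))) has_real_derivative c) (at 0)" for k c
    using pdir_cong[OF U pU F2, where k = k] pdir_eqI[OF that] by simp
  \<comment> \<open>Along the diagonal x' moves together with x, but the x'-derivative of
    \<open>F2\<close> there is uxy ux - ux uxy = 0, so the direction \<open>e\<close> alone accounts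
    for \<open>Ax\<close>.\<close>
  have d1: "pdir e F2 (p, p) = u p * pdir (1, 0) uxy p - pdir (1, 0) ux p * uy p"
    using DERIV_diff[OF DERIV_cmult_right[OF D[OF h(3) pS B2(1)], of "u p"]
        DERIV_cmult_right[OF D[OF h(1) pS B2(1)], of "uy p"]]
    by (intro F2_pdir) (cases p, auto simp: e_def mult.commute)
  have d2: "pdir f F2 (p, p) = u p * pdir (0, 1) uxy p - ux p * pdir (0, 1) uy p"
    using DERIV_diff[OF DERIV_cmult_right[OF D[OF h(3) pS B2(2)], of "u p"]
        DERIV_cmult[OF D[OF h(2) pS B2(2)], of "ux p"]]
    by (intro F2_pdir) (cases p, auto simp: f_def mult.commute)
  have d3: "pdir f' F2 (p, p) = uy p * uxy p - pdir (0, 1) ux p * uy p"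
    using DERIV_diff[OF DERIV_cmult[OF D[OF S(2) pS B2(2)], of "uxy p"]
        DERIV_cmult_right[OF D[OF h(1) pS B2(2)], of "uy p"]]
    by (intro F2_pdir) (cases p, auto simp: f'_def uy_def mult.commute)
  define G where "G = grad_const TYPE((real \<times> real) \<times> (real \<times> real)) (2 * \<Lambda>) (r / 3)"
  have r3: "r / 3 > 0" using r by simp
  have G: "G > 0" unfolding G_def by (rule grad_const_pos[OF r3])
  have grad4: "\<bar>pdir k g P\<bar> \<le> G * M"
    if "helm U (2 * lam) g" "cube P (r / 3) \<subseteq> U" "\<And>Q. Q \<in> cube P (r / 3) \<Longrightarrow> \<bar>g Q\<bar> \<le> M" "M > 0" "k \<in> Basis"
    for g P M k
  proof -
    have "\<bar>pdir k g P\<bar> \<le> grad_const TYPE((real \<times> real) \<times> (real \<times> real)) (2 * lam) (r / 3) * M"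
      by (rule helm_gradient[OF U that(1) r3 that(2-5)])
    also have "\<dots> \<le> G * M"
      unfolding G_def using that(4) lam r3 by (intro mult_right_mono grad_const_mono) auto
    finally show ?thesis .
  qed
  have sub: "cube P (r / 3) \<subseteq> cube (p, p) (c + r / 3)" if "P \<in> cube (p, p) c" for P c
    by (rule cube_subset[OF that])
  have sub2: "cube (p, p) (2 * r / 3) \<subseteq> cube (p, p) r" "cube (p, p) (r / 3) \<subseteq> cube (p, p) (2 * r / 3)"
    by (rule cube_mono, use r in simp)+
  \<comment> \<open>The radii r, 2 r / 3, r / 3 lose one third per derivative.\<close>
  have bF1: "\<bar>F1 P\<bar> \<le> G * \<delta>" if "P \<in> cube (p, p) (2 * r / 3)" for P
    unfolding F1_def using sub[OF that] cubeU \<delta> r by (intro grad4 hF B4) auto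
  have bF2: "\<bar>F2 P\<bar> \<le> G * (G * \<delta>)" if "P \<in> cube (p, p) (r / 3)" for P
    unfolding F2_def using sub[OF that] cubeU sub2 \<delta>(2) G bF1 by (intro grad4 hF B4) auto
  have bF3: "\<bar>pdir k F2 (p, p)\<bar> \<le> G * (G * (G * \<delta>))" if "k \<in> Basis" for k
    using cubeU sub2 \<delta>(2) G bF2 by (intro grad4 hF that) auto
  define A where "A = u p * uxy p - ux p * uy p"
  have A: "\<bar>A\<bar> \<le> G\<^sup>2 * \<delta>"
    using bF2[of "(p, p)"] cube_self[of "r / 3" "(p, p)"] r F2p
    by (simp add: A_def power2_eq_square mult.assoc)
  define Ax where "Ax = u p * pdir (1, 0) uxy p - pdir (1, 0) ux p * uy p"
  have Ax: "\<bar>Ax\<bar> \<le> G ^ 3 * \<delta>"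
    using bF3[OF B4(1)] d1 by (simp add: Ax_def power3_eq_cube mult.assoc)
  define Ay where "Ay = uy p * uxy p + u p * pdir (0, 1) uxy p - pdir (0, 1) ux p * uy p - ux p * pdir (0, 1) uy p"
  \<comment> \<open>A vertical step along the diagonal moves y and y' together, and here both
    contribute.\<close>
  have "Ay = pdir f F2 (p, p) + pdir f' F2 (p, p)" unfolding d2 d3 by (simp add: Ay_def)
  then have Ay: "\<bar>Ay\<bar> \<le> 2 * G ^ 3 * \<delta>"
    using bF3[OF B4(2)] bF3[OF B4(4)] by (simp add: power3_eq_cube mult.assoc)
  define G1 where "G1 = grad_const TYPE(real \<times> real) \<Lambda> r"
  have G1: "G1 > 0" unfolding G1_def by (rule grad_const_pos[OF r])
  have grad2: "\<bar>pdir k u p\<bar> \<le> G1" if k: "k \<in> Basis" for k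
  proof -
    have "\<bar>pdir k u p\<bar> \<le> grad_const TYPE(real \<times> real) lam r * 1"
    proof (rule helm_gradient[OF S r cube _ _ k])
      show "\<bar>u q\<bar> \<le> 1" if "q \<in> cube p r" for q
        using pos[of q] le1[of q] subsetD[OF cube that] by simp
    qed simp
    also have "\<dots> \<le> G1 * 1" unfolding G1_def by (intro mult_right_mono grad_const_mono lam r) auto
    finally show ?thesis by simp
  qed
  have up: "u p > 0" using half by simp
  have i2: "\<bar>a / (u p)\<^sup>2\<bar> \<le> 4 * \<bar>a\<bar>" for a
  proof -
    have "(1 / 2)\<^sup>2 \<le> (u p)\<^sup>2" using half by (intro power_mono) auto
    then have "1 \<le> 4 * (u p)\<^sup>2" by (simp add: power_divide)
    then have "\<bar>a\<bar> * 1 \<le> \<bar>a\<bar> * (4 * (u p)\<^sup>2)" by (rule mult_left_mono) simp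
    then show ?thesis using up by (simp add: abs_divide divide_le_eq mult.assoc mult.left_commute)
  qed
  have i3: "\<bar>a / (u p) ^ 3\<bar> \<le> 8 * \<bar>a\<bar>" for a
  proof -
    have "(1 / 2) ^ 3 \<le> (u p) ^ 3" using half by (intro power_mono) auto
    then have "1 \<le> 8 * (u p) ^ 3" by (simp add: power_divide)
    then have "\<bar>a\<bar> * 1 \<le> \<bar>a\<bar> * (8 * (u p) ^ 3)" by (rule mult_left_mono) simp
    then show ?thesis using up by (simp add: abs_divide divide_le_eq mult.assoc mult.left_commute)
  qed
  have prod: "\<bar>2 * A * c\<bar> \<le> 2 * G\<^sup>2 * \<delta> * G1" if "\<bar>c\<bar> \<le> G1" for c
  proof -
    have "\<bar>A\<bar> * \<bar>c\<bar> \<le> (G\<^sup>2 * \<delta>) * G1" using A that by (intro mult_mono) auto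
    then show ?thesis by (simp add: abs_mult)
  qed
  note L = mixed_log_derivative[OF S pS pos, folded ux_def uy_def, folded uxy_def, folded A_def, folded Ax_def Ay_def]
  have v1: "\<bar>dx (dy (\<lambda>q. ln (u q))) p\<bar> \<le> 4 * G\<^sup>2 * \<delta>"
    using L(1) i2[of A] A by simp
  have v2: "\<bar>dx (dx (dy (\<lambda>q. ln (u q)))) p\<bar> \<le> 4 * (G ^ 3 * \<delta>) + 8 * (2 * G\<^sup>2 * \<delta> * G1)"
    using L(2) i2[of Ax] i3[of "2 * A * ux p"] Ax prod[of "ux p"] grad2[OF B2(1)]
    unfolding ux_def[symmetric] by linarith
  have v3: "\<bar>dy (dx (dy (\<lambda>q. ln (u q)))) p\<bar> \<le> 4 * (2 * G ^ 3 * \<delta>) + 8 * (2 * G\<^sup>2 * \<delta> * G1)"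
    using L(3) i2[of Ay] i3[of "2 * A * uy p"] Ay prod[of "uy p"] grad2[OF B2(2)]
    unfolding uy_def[symmetric] by linarith
  have "norm (grad (dx (dy (\<lambda>q. ln (u q)))) p)
      \<le> \<bar>dx (dx (dy (\<lambda>q. ln (u q)))) p\<bar> + \<bar>dy (dx (dy (\<lambda>q. ln (u q)))) p\<bar>"
    unfolding grad_def real_norm_def[symmetric] by (rule norm_Pair_le)
  then have "\<bar>dx (dy (\<lambda>q. ln (u q))) p\<bar> + norm (grad (dx (dy (\<lambda>q. ln (u q)))) p)
      \<le> (4 * G\<^sup>2 + 12 * G ^ 3 + 32 * G\<^sup>2 * G1) * \<delta>"
    using v1 v2 v3 by (simp add: algebra_simps)
  then show ?thesis by (simp add: mixed_const_def G_def G1_def Let_def)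
qed

section \<open>Ground states of normalised domains\<close>

text \<open>The part of \<open>K\<close> outside \<open>V\<close> plays the role of the boundary. It
  need not be the topological boundary, so cuts through \<Omega> and its frontier are treated
  alike.\<close>

lemma helm_comparison:
  fixes f \<Psi> :: "'a::euclidean_space \<Rightarrow> real"
  assumes K: "compact K" "continuous_on K f" "continuous_on K \<Psi>" "\<And>p. p \<in> K \<Longrightarrow> \<Psi> p > 0"
    and V: "open V" "V \<subseteq> K" "helm V lam f"
    and bd: "\<And>p. p \<in> K \<Longrightarrow> p \<notin> V \<Longrightarrow> f p \<le> \<Psi> p"
    and super: "\<And>p. p \<in> V \<Longrightarrow> \<exists>e. (\<forall>k\<in>Basis. has_D2 (\<lambda>t. \<Psi> (p + t *\<^sub>R k)) (e k)) \<and>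
        (\<Sum>k\<in>Basis. e k) < - lam * \<Psi> p"
    and p: "p \<in> K"
  shows "f p \<le> \<Psi> p"
proof (rule comparison[OF K _ p])
  fix p assume "p \<in> K"
  show "f p \<le> \<Psi> p \<or> (\<exists>c e. (\<forall>k\<in>Basis. (\<forall>\<^sub>F t in nhds 0. p + t *\<^sub>R k \<in> K) \<and>
      has_D2 (\<lambda>t. f (p + t *\<^sub>R k)) (c k) \<and> has_D2 (\<lambda>t. \<Psi> (p + t *\<^sub>R k)) (e k)) \<and>
      (\<Sum>k\<in>Basis. c k) = - lam * f p \<and> (\<Sum>k\<in>Basis. e k) < - lam * \<Psi> p)"
  proof (cases "p \<in> V")
    case True
    then obtain e where e: "\<forall>k\<in>Basis. has_D2 (\<lambda>t. \<Psi> (p + t *\<^sub>R k)) (e k)"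
      "(\<Sum>k\<in>Basis. e k) < - lam * \<Psi> p" using super by blast
    have "\<forall>\<^sub>F t in nhds 0. p + t *\<^sub>R k \<in> K" for k
      using eventually_line_in_open[OF V(1) True, of k] by eventually_elim (use V(2) in auto)
    then show ?thesis
      using e helm_has_D2[OF V(3,1) True] helm_sum[OF V(3) True]
      by (intro disjI2 exI[of _ "\<lambda>k. pdir k (pdir k f) p"] exI[of _ e]) auto
  next
    case False
    with bd \<open>p \<in> K\<close> show ?thesis by blast
  qed
qed

lemma has_D2_shifted:
  fixes b c x :: real
  shows "has_D2 (\<lambda>t. sin (b * (x + t - c))) (- (b\<^sup>2) * sin (b * (x - c)))"
    and "has_D2 (\<lambda>t. cos (b * (x + t - c))) (- (b\<^sup>2) * cos (b * (x - c)))"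
    and "has_D2 (\<lambda>t. exp (b * (x + t - c))) (b\<^sup>2 * exp (b * (x - c)))"
    and "has_D2 (\<lambda>t. cosh (b * (x + t - c))) (b\<^sup>2 * cosh (b * (x - c)))"
proof -
  have "b * (x + t - c) = b * (x - c) + b * t" for t by (simp add: algebra_simps)
  then show "has_D2 (\<lambda>t. sin (b * (x + t - c))) (- (b\<^sup>2) * sin (b * (x - c)))"
    "has_D2 (\<lambda>t. cos (b * (x + t - c))) (- (b\<^sup>2) * cos (b * (x - c)))"
    "has_D2 (\<lambda>t. exp (b * (x + t - c))) (b\<^sup>2 * exp (b * (x - c)))"
    "has_D2 (\<lambda>t. cosh (b * (x + t - c))) (b\<^sup>2 * cosh (b * (x - c)))"
    by (simp_all only: has_D2_sin has_D2_cos has_D2_exp has_D2_cosh)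
qed

lemma has_D2_product:
  fixes X Y :: "real \<Rightarrow> real"
  assumes "has_D2 (\<lambda>t. X (fst p + t)) X2" "has_D2 (\<lambda>t. Y (snd p + t)) Y2"
  shows "\<exists>e. (\<forall>k\<in>Basis. has_D2 (\<lambda>t. X (fst (p + t *\<^sub>R k)) * Y (snd (p + t *\<^sub>R k))) (e k)) \<and>
    (\<Sum>k\<in>Basis. e k) = X2 * Y (snd p) + X (fst p) * Y2"
  using has_D2_cmult_right[OF assms(1), of "Y (snd p)"] has_D2_cmult[OF assms(2), of "X (fst p)"]
  by (intro exI[of _ "\<lambda>k. if k = (1, 0) then X2 * Y (snd p) else X (fst p) * Y2"])
     (auto simp: sum_Basis_real2 Basis_real2)

lemma C2_on_line_derivatives:
  assumes "C2_on S f" "p \<in> S" and k: "k = (1, 0) \<or> k = (0, 1)"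
  shows "((\<lambda>t. f (p + t *\<^sub>R k)) has_real_derivative pdir k f p) (at 0)"
    and "((\<lambda>t. pdir k f (p + t *\<^sub>R k)) has_real_derivative pdir k (pdir k f) p) (at 0)"
proof -
  have line: "((\<lambda>t. g (p + t *\<^sub>R k)) has_real_derivative pdir k g p) (at 0)"
    if "g differentiable (at p)" for g :: "real \<times> real \<Rightarrow> real"
  proof -
    have "(\<lambda>t. p + t *\<^sub>R k) differentiable (at 0)"
      by (intro derivative_intros)
    moreover have "g differentiable (at (p + 0 *\<^sub>R k))" using that by simp
    ultimately have "(g \<circ> (\<lambda>t. p + t *\<^sub>R k)) differentiable (at 0)"
      by (intro differentiable_chain_at)
    then show ?thesis unfolding pdir_def o_def DERIV_deriv_iff_real_differentiable .
  qed
  show "((\<lambda>t. f (p + t *\<^sub>R k)) has_real_derivative pdir k f p) (at 0)"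
    using assms by (intro line) (auto simp: C2_on_def C1_on_def)
  have "pdir k f differentiable (at p)"
    using assms unfolding C2_on_def C1_on_def
    by (auto simp: dx_eq_pdir[abs_def] dy_eq_pdir[abs_def])
  then show "((\<lambda>t. pdir k f (p + t *\<^sub>R k)) has_real_derivative pdir k (pdir k f) p) (at 0)"
    by (rule line)
qed

locale ground_state =
  fixes \<Omega> :: "(real \<times> real) set" and a b :: real and f1 f2 :: "real \<Rightarrow> real"
    and lam :: real and u :: "real \<times> real \<Rightarrow> real"
  assumes dom: "normalised_domain \<Omega> a b f1 f2" and eig: "normalised_eigenfunction \<Omega> lam u"
begin

lemma bounded: "bounded \<Omega>" and convex: "convex \<Omega>" and ab: "a < b"
  and f1_convex: "convex_on {a..b} f1" and f2_concave: "concave_on {a..b} f2"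
  and f1_le_f2: "\<And>x. x \<in> {a..b} \<Longrightarrow> f1 x \<le> f2 x"
  and mem_iff: "(x, y) \<in> \<Omega> \<longleftrightarrow> x \<in> {a..b} \<and> f1 x \<le> y \<and> y \<le> f2 x"
  and f1_nonneg: "\<And>x. x \<in> {a..b} \<Longrightarrow> 0 \<le> f1 x"
  and f2_le_1: "\<And>x. x \<in> {a..b} \<Longrightarrow> f2 x \<le> 1"
  and f1_zero: "\<exists>x\<in>{a..b}. f1 x = 0" and f2_one: "\<exists>x\<in>{a..b}. f2 x = 1"
  and projection: "\<And>e. norm e = 1 \<Longrightarrow> projection_length \<Omega> (0, 1) \<le> projection_length \<Omega> e"
  using dom unfolding normalised_domain_def by auto

lemma cont: "continuous_on (closure \<Omega>) u" and C2: "C2_on (interior \<Omega>) u"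
  and laplace: "\<And>p. p \<in> interior \<Omega> \<Longrightarrow> laplacian u p = - lam * u p"
  and zero: "\<And>p. p \<in> frontier \<Omega> \<Longrightarrow> u p = 0"
  and pos: "\<And>p. p \<in> interior \<Omega> \<Longrightarrow> u p > 0"
  and max1: "\<exists>p\<in>\<Omega>. u p = 1" and le1': "\<And>p. p \<in> \<Omega> \<Longrightarrow> u p \<le> 1"
  and interior_ne: "interior \<Omega> \<noteq> {}"
  using eig unfolding normalised_eigenfunction_def dirichlet_eigenfunction_def by auto

lemma helm: "helm (interior \<Omega>) lam u"
  unfolding helm_def
proof (intro conjI ballI)
  show "continuous_on (interior \<Omega>) u"
    using cont interior_subset closure_subset by (metis continuous_on_subset)
  show "(\<Sum>k\<in>Basis. pdir k (pdir k u) p) = - lam * u p" if "p \<in> interior \<Omega>" for p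
    using laplace[OF that] unfolding laplacian_def sum_Basis_real2
    by (simp add: dx_eq_pdir[abs_def] dy_eq_pdir[abs_def])
qed (use C2_on_line_derivatives[OF C2] in \<open>auto simp: Basis_real2\<close>)

lemma closure_cases: "p \<in> closure \<Omega> \<Longrightarrow> p \<in> interior \<Omega> \<or> p \<in> frontier \<Omega>"
  by (auto simp: frontier_def)

lemma interior_in_closure: "p \<in> interior \<Omega> \<Longrightarrow> p \<in> closure \<Omega>"
  using interior_subset closure_subset by blast

lemma le1: "p \<in> closure \<Omega> \<Longrightarrow> u p \<le> 1"
  using closure_cases[of p] le1'[of p] zero[of p] interior_subset[of \<Omega>] by auto

lemma nonneg: "p \<in> closure \<Omega> \<Longrightarrow> 0 \<le> u p"
  using closure_cases[of p] pos[of p] zero[of p] by auto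

lemma pos_imp_interior: "p \<in> closure \<Omega> \<Longrightarrow> u p > 0 \<Longrightarrow> p \<in> interior \<Omega>"
  using closure_cases[of p] zero[of p] by auto

lemma compact_closure: "compact (closure \<Omega>)"
  using bounded by (simp add: compact_closure)

text \<open>At the maximum point all pure second derivatives are at most 0, while their sum is -
  lam.\<close>

lemma lam_nonneg: "0 \<le> lam"
proof -
  obtain p where p: "p \<in> \<Omega>" "u p = 1" using max1 by blast
  then have i: "p \<in> interior \<Omega>"
    using pos_imp_interior[of p] closure_subset[of \<Omega>] by auto
  have "pdir k (pdir k u) p \<le> 0" if k: "k \<in> Basis" for k
  proof (rule has_D2_local_max)
    show "has_D2 (\<lambda>t. u (p + t *\<^sub>R k)) (pdir k (pdir k u) p)"
      by (rule helm_has_D2[OF helm open_interior i k])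
    show "\<forall>\<^sub>F t in nhds 0. u (p + t *\<^sub>R k) \<le> u (p + 0 *\<^sub>R k)"
      using eventually_line_in_open[OF open_interior i, of k]
      by eventually_elim (use p le1 interior_in_closure in auto)
  qed
  then have "(\<Sum>k\<in>Basis. pdir k (pdir k u) p) \<le> 0" by (intro sum_nonpos) auto
  then show ?thesis using helm_sum[OF helm i] p by simp
qed

text \<open>Domain monotonicity with the roles in Barta's argument exchanged: if lam were larger
  than the eigenvalue of the rectangle, every small multiple of \<open>u\<close> would be a positive
  strict supersolution there and would dominate the ground state \<phi> of the rectangle.\<close>

lemma lam_le_rectangle:
  assumes "\<alpha> < \<beta>" "\<gamma> < \<delta>" and R: "{\<alpha>..\<beta>} \<times> {\<gamma>..\<delta>} \<subseteq> interior \<Omega>"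
  shows "lam \<le> (pi / (\<beta> - \<alpha>))\<^sup>2 + (pi / (\<delta> - \<gamma>))\<^sup>2"
proof (rule ccontr)
  define \<mu> where "\<mu> = (pi / (\<beta> - \<alpha>))\<^sup>2 + (pi / (\<delta> - \<gamma>))\<^sup>2"
  define X where "X = (\<lambda>x. sin (pi / (\<beta> - \<alpha>) * (x - \<alpha>)))"
  define Y where "Y = (\<lambda>y. sin (pi / (\<delta> - \<gamma>) * (y - \<gamma>)))"
  define \<phi> where "\<phi> = (\<lambda>p. X (fst p) * Y (snd p))"
  define K where "K = {\<alpha>..\<beta>} \<times> {\<gamma>..\<delta>}"
  define c where "c = ((\<alpha> + \<beta>) / 2, (\<gamma> + \<delta>) / 2)"
  \<comment> \<open>Chosen so that \<epsilon> u takes the value 1/2 at the centre, where \<phi> is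
    1.\<close>
  define \<epsilon> where "\<epsilon> = 1 / (2 * u c)"
  assume "\<not> lam \<le> (pi / (\<beta> - \<alpha>))\<^sup>2 + (pi / (\<delta> - \<gamma>))\<^sup>2"
  then have \<mu>: "\<mu> < lam" by (simp add: \<mu>_def)
  have c: "c \<in> K" using assms by (auto simp: c_def K_def)
  have uc: "u c > 0" using c R pos by (auto simp: K_def)
  have \<epsilon>: "\<epsilon> > 0" using uc by (simp add: \<epsilon>_def)
  have "\<phi> c \<le> \<epsilon> * u c"
  proof (rule comparison[where K = K and f = \<phi> and \<Psi> = "\<lambda>p. \<epsilon> * u p" and lam = \<mu>])
    show "compact K" unfolding K_def by (intro compact_Times) auto
    show "continuous_on K \<phi>" unfolding \<phi>_def X_def Y_def by (intro continuous_intros)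
    show "continuous_on K (\<lambda>p. \<epsilon> * u p)"
      using helm R unfolding helm_def K_def
      by (intro continuous_intros) (blast intro: continuous_on_subset)
    show "\<epsilon> * u p > 0" if "p \<in> K" for p using that R pos \<epsilon> unfolding K_def by (meson mult_pos_pos subsetD)
    show "c \<in> K" by (rule c)
    fix p assume p: "p \<in> K"
    show "\<phi> p \<le> \<epsilon> * u p \<or> (\<exists>c e. (\<forall>k\<in>Basis. (\<forall>\<^sub>F t in nhds 0. p + t *\<^sub>R k \<in> K) \<and>
      has_D2 (\<lambda>t. \<phi> (p + t *\<^sub>R k)) (c k) \<and> has_D2 (\<lambda>t. \<epsilon> * u (p + t *\<^sub>R k)) (e k)) \<and>
      (\<Sum>k\<in>Basis. c k) = - \<mu> * \<phi> p \<and> (\<Sum>k\<in>Basis. e k) < - \<mu> * (\<epsilon> * u p))"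
    proof (cases "p \<in> {\<alpha><..<\<beta>} \<times> {\<gamma><..<\<delta>}")
      case True
      have o: "open ({\<alpha><..<\<beta>} \<times> {\<gamma><..<\<delta>})" by (intro open_Times) auto
      have ev: "\<forall>\<^sub>F t in nhds 0. p + t *\<^sub>R k \<in> K" for k
        using eventually_line_in_open[OF o True, of k]
        by eventually_elim (auto simp: K_def)
      have i: "p \<in> interior \<Omega>" using p R by (auto simp: K_def)
      have "has_D2 (\<lambda>t. X (fst p + t)) (- ((pi / (\<beta> - \<alpha>))\<^sup>2) * X (fst p))"
        unfolding X_def by (rule has_D2_shifted(1))
      moreover have "has_D2 (\<lambda>t. Y (snd p + t)) (- ((pi / (\<delta> - \<gamma>))\<^sup>2) * Y (snd p))"
        unfolding Y_def by (rule has_D2_shifted(1))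
      ultimately obtain e where e: "\<forall>k\<in>Basis. has_D2 (\<lambda>t. \<phi> (p + t *\<^sub>R k)) (e k)"
          "(\<Sum>k\<in>Basis. e k) = - \<mu> * \<phi> p"
        using has_D2_product[of X p _ Y] unfolding \<phi>_def \<mu>_def by (force simp: algebra_simps)
      have "- lam * (\<epsilon> * u p) < - \<mu> * (\<epsilon> * u p)"
        using \<mu> \<epsilon> pos[OF i] by (intro mult_strict_right_mono mult_pos_pos) auto
      moreover have "(\<Sum>k\<in>Basis. \<epsilon> * pdir k (pdir k u) p) = - lam * (\<epsilon> * u p)"
        using helm_sum[OF helm i] by (simp add: sum_distrib_left[symmetric] algebra_simps)
      ultimately show ?thesis
        using e ev has_D2_cmult[OF helm_has_D2[OF helm open_interior i]]
        by (intro disjI2 exI[of _ e] exI[of _ "\<lambda>k. \<epsilon> * pdir k (pdir k u) p"]) auto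
    next
      case False
      then have "fst p = \<alpha> \<or> fst p = \<beta> \<or> snd p = \<gamma> \<or> snd p = \<delta>"
        using p by (cases p) (auto simp: K_def)
      then have "\<phi> p = 0" using assms by (auto simp: \<phi>_def X_def Y_def)
      moreover have "u p > 0" using p R pos by (auto simp: K_def)
      ultimately show ?thesis using \<epsilon> by simp
    qed
  qed
  moreover have "pi / (\<beta> - \<alpha>) * ((\<alpha> + \<beta>) / 2 - \<alpha>) = pi / 2" "pi / (\<delta> - \<gamma>) * ((\<gamma> + \<delta>) / 2 - \<gamma>) = pi / 2"
    using assms by (simp_all add: field_simps)
  then have "\<phi> c = 1" unfolding \<phi>_def X_def Y_def c_def by (simp only: fst_conv snd_conv sin_pi_half)
  moreover have "\<epsilon> * u c = 1 / 2" using uc by (simp add: \<epsilon>_def)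
  ultimately show False by simp
qed

text \<open>Convexity places \<Omega> on one side of a line through q. A sine of the distance to
  this line, with frequency \<omega> above the square root of lam, is a supersolution on the strip
  where its argument stays below pi / 2. On the inner edge of the strip it equals 1, which bounds
  \<open>u\<close>, and beyond that edge the claim is trivial.\<close>

lemma le_dist_frontier:
  assumes \<omega>: "\<omega> > 0" "lam < \<omega>\<^sup>2" and q: "q \<in> frontier \<Omega>" and p: "p \<in> closure \<Omega>"
  shows "u p \<le> \<omega> * dist p q"
proof -
  have "rel_interior \<Omega> = interior \<Omega>" using interior_ne by (rule rel_interior_nonempty_interior)
  then have "q \<in> closure \<Omega>" "q \<notin> rel_interior \<Omega>" using q by (auto simp: frontier_def)
  then obtain m where m: "m \<noteq> 0" "\<And>y. y \<in> closure \<Omega> \<Longrightarrow> m \<bullet> q \<le> m \<bullet> y"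
    using supporting_hyperplane_relative_frontier[OF convex] by metis
  define n where "n = m /\<^sub>R norm m"
  have n: "norm n = 1" "n \<bullet> n = 1" using m(1) by (simp_all add: n_def power2_norm_eq_inner[symmetric] norm_eq_1)
  have n_ge: "0 \<le> n \<bullet> (y - q)" if "y \<in> closure \<Omega>" for y
    using m(2)[OF that] by (simp add: n_def inner_diff_right mult_left_mono)
  \<comment> \<open>The shift \<delta> keeps the barrier positive up to the supporting line; it
    tends to 0 afterwards.\<close>
  have main: "u p \<le> \<omega> * (n \<bullet> (p - q)) + \<delta>" if \<delta>: "0 < \<delta>" "\<delta> < 1" for \<delta>
  proof (cases "\<omega> * (n \<bullet> (p - q)) + \<delta> \<le> pi / 2")
    case True
    define s where "s = (\<lambda>r. \<omega> * (n \<bullet> (r - q)) + \<delta>)"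
    define K where "K = closure \<Omega> \<inter> {r. s r \<le> pi / 2}"
    have cs: "continuous_on A s" for A unfolding s_def by (intro continuous_intros)
    have s_ge: "s r \<ge> \<delta>" if "r \<in> closure \<Omega>" for r using n_ge[OF that] \<omega>(1) by (simp add: s_def)
    have "u p \<le> sin (s p)"
    proof (rule helm_comparison[where K = K and V = "interior \<Omega> \<inter> {r. s r < pi / 2}" and lam = lam])
      have "closed {r. s r \<le> pi / 2}" by (intro closed_Collect_le cs continuous_on_const)
      then show "compact K" unfolding K_def using compact_closure by (rule compact_Int_closed[rotated])
      show "continuous_on K u" using cont by (rule continuous_on_subset) (simp add: K_def)
      show "continuous_on K (\<lambda>r. sin (s r))" by (intro continuous_intros cs)
      show "0 < sin (s r)" if "r \<in> K" for r
        using that s_ge[of r] \<delta> pi_gt_zero by (intro sin_gt_zero) (auto simp: K_def)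
      show "open (interior \<Omega> \<inter> {r. s r < pi / 2})"
        by (intro open_Int open_interior open_Collect_less cs continuous_on_const)
      show "interior \<Omega> \<inter> {r. s r < pi / 2} \<subseteq> K" using interior_in_closure by (auto simp: K_def)
      show "helm (interior \<Omega> \<inter> {r. s r < pi / 2}) lam u" by (rule helm_subset[OF helm]) auto
      show "u r \<le> sin (s r)" if r: "r \<in> K" "r \<notin> interior \<Omega> \<inter> {r. s r < pi / 2}" for r
      proof (cases "r \<in> interior \<Omega>")
        case True
        then have "s r = pi / 2" using r by (auto simp: K_def)
        then have "sin (s r) = 1" by (simp only: sin_pi_half)
        then show ?thesis using le1[of r] r by (simp add: K_def)
      next
        case False
        then have "u r = 0" using r zero[of r] closure_cases[of r] by (auto simp: K_def)
        moreover have "0 \<le> sin (s r)"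
          using r s_ge[of r] \<delta> pi_gt_zero by (intro sin_ge_zero) (auto simp: K_def)
        ultimately show ?thesis by simp
      qed
      show "\<exists>e. (\<forall>k\<in>Basis. has_D2 (\<lambda>t. sin (s (r + t *\<^sub>R k))) (e k)) \<and>
          (\<Sum>k\<in>Basis. e k) < - lam * sin (s r)" if r: "r \<in> interior \<Omega> \<inter> {r. s r < pi / 2}" for r
      proof (intro exI conjI ballI)
        show "has_D2 (\<lambda>t. sin (s (r + t *\<^sub>R k))) (- ((\<omega> * (n \<bullet> k))\<^sup>2) * sin (s r))" for k
          using has_D2_sin[of "s r" "\<omega> * (n \<bullet> k)"]
          by (simp add: s_def inner_add_right inner_diff_right algebra_simps)
        have "(\<Sum>k\<in>Basis. (n \<bullet> k)\<^sup>2) = 1"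
          using n(2) euclidean_inner[of n n] by (simp add: power2_eq_square)
        then have "(\<Sum>k\<in>Basis. - ((\<omega> * (n \<bullet> k))\<^sup>2) * sin (s r)) = - (\<omega>\<^sup>2) * sin (s r)"
          by (simp add: power_mult_distrib sum_negf sum_distrib_right[symmetric] sum_distrib_left[symmetric])
        moreover have "0 < sin (s r)"
          using r s_ge[of r] \<delta> pi_gt_zero interior_in_closure[of r] by (intro sin_gt_zero) auto
        ultimately show "(\<Sum>k\<in>Basis. - ((\<omega> * (n \<bullet> k))\<^sup>2) * sin (s r)) < - lam * sin (s r)"
          using \<omega>(2) by simp
      qed
      show "p \<in> K" using p True by (simp add: K_def s_def)
    qed
    also have "\<dots> \<le> s p" using s_ge[OF p] \<delta> by (intro sin_x_le_x) auto
    finally show ?thesis by (simp add: s_def)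
  next
    case False
    then show ?thesis using le1[OF p] pi_ge_two by linarith
  qed
  have "u p \<le> \<omega> * (n \<bullet> (p - q))"
  proof (rule field_le_epsilon)
    fix e :: real assume "e > 0"
    then show "u p \<le> \<omega> * (n \<bullet> (p - q)) + e"
      using main[of "min e (1 / 2)"] by linarith
  qed
  also have "\<dots> \<le> \<omega> * dist p q"
    using \<omega>(1) norm_cauchy_schwarz[of n "p - q"] n(1) by (intro mult_left_mono) (auto simp: dist_norm)
  finally show ?thesis .
qed


section \<open>Consequences of the minimal projection\<close>

lemma bounded_projection: "bounded ((\<lambda>p. p \<bullet> e) ` \<Omega>)"
  using bounded by (rule bounded_linear_image) (simp add: bounded_linear_inner_left)

lemma projection_ge_1:
  assumes "norm e = 1"
  shows "1 \<le> projection_length \<Omega> e"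
proof -
  obtain x0 x1 where x: "x0 \<in> {a..b}" "f1 x0 = 0" "x1 \<in> {a..b}" "f2 x1 = 1"
    using f1_zero f2_one by blast
  then have "(x0, 0) \<in> \<Omega>" "(x1, 1) \<in> \<Omega>"
    using f1_le_f2[of x0] f1_le_f2[of x1] by (auto simp: mem_iff)
  then have "(x0, 0) \<bullet> (0, 1::real) \<in> (\<lambda>p. p \<bullet> (0, 1)) ` \<Omega>" "(x1, 1) \<bullet> (0, 1::real) \<in> (\<lambda>p. p \<bullet> (0, 1)) ` \<Omega>"
    by blast+
  then have "dist ((x0, 0) \<bullet> (0, 1::real)) ((x1, 1) \<bullet> (0, 1::real)) \<le> projection_length \<Omega> (0, 1)"
    unfolding projection_length_def by (rule diameter_bounded_bound[OF bounded_projection])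
  then have "1 \<le> projection_length \<Omega> (0, 1)" by (simp add: dist_real_def)
  also have "\<dots> \<le> projection_length \<Omega> e" by (rule projection[OF assms])
  finally show ?thesis .
qed

lemma ab_ge_1: "b - a \<ge> 1"
proof -
  have "projection_length \<Omega> (1, 0) \<le> b - a" unfolding projection_length_def
  proof (rule diameter_le)
    show "norm (x - y) \<le> b - a" if "x \<in> (\<lambda>p. p \<bullet> (1, 0)) ` \<Omega>" "y \<in> (\<lambda>p. p \<bullet> (1, 0)) ` \<Omega>" for x y
      using that by (auto simp: mem_iff)
  qed (use ab in auto)
  moreover have "1 \<le> projection_length \<Omega> (1, 0)" by (rule projection_ge_1) simp
  ultimately show ?thesis by linarith
qed

text \<open>A line separating the region below the graph of \<open>f2\<close> from a translate of the region above
  the graph of \<open>f1\<close> puts \<open>\<Omega>\<close> into a slanted strip.\<close>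

lemma height_ge:
  assumes "H < 1"
  shows "\<exists>x\<in>{a..b}. f2 x - f1 x \<ge> H"
proof (rule ccontr)
  assume no: "\<not> (\<exists>x\<in>{a..b}. f2 x - f1 x \<ge> H)"
  have h: "f2 x < f1 x + H" if "x \<in> {a..b}" for x
  proof -
    have "\<not> H \<le> f2 x - f1 x" using that no by blast
    then show ?thesis by linarith
  qed
  define A where "A = {p. fst p \<in> {a..b} \<and> snd p \<le> f2 (fst p)}"
  define B where "B = {p. fst p \<in> {a..b} \<and> f1 (fst p) + H \<le> snd p}"
  have "convex A"
    unfolding convex_alt
  proof (intro ballI allI impI)
    fix p q t assume pq: "p \<in> A" "q \<in> A" and t: "0 \<le> t \<and> t \<le> (1::real)"
    have "(1 - t) * f2 (fst p) + t * f2 (fst q) \<le> f2 ((1 - t) *\<^sub>R fst p + t *\<^sub>R fst q)"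
      using pq t by (intro concave_onD[OF f2_concave]) (auto simp: A_def)
    moreover have "(1 - t) * snd p + t * snd q \<le> (1 - t) * f2 (fst p) + t * f2 (fst q)"
      using pq t by (intro add_mono mult_left_mono) (auto simp: A_def)
    moreover have "(1 - t) *\<^sub>R fst p + t *\<^sub>R fst q \<in> {a..b}"
      using pq t convex_real_interval(5)[of a b] unfolding convex_alt A_def by blast
    ultimately show "(1 - t) *\<^sub>R p + t *\<^sub>R q \<in> A" by (simp add: A_def)
  qed
  moreover have "convex B"
    unfolding convex_alt
  proof (intro ballI allI impI)
    fix p q t assume pq: "p \<in> B" "q \<in> B" and t: "0 \<le> t \<and> t \<le> (1::real)"
    have "f1 ((1 - t) *\<^sub>R fst p + t *\<^sub>R fst q) \<le> (1 - t) * f1 (fst p) + t * f1 (fst q)"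
      using pq t by (intro convex_onD[OF f1_convex]) (auto simp: B_def)
    moreover have "(1 - t) * (f1 (fst p) + H) + t * (f1 (fst q) + H) \<le> (1 - t) * snd p + t * snd q"
      using pq t by (intro add_mono mult_left_mono) (auto simp: B_def)
    moreover have "(1 - t) *\<^sub>R fst p + t *\<^sub>R fst q \<in> {a..b}"
      using pq t convex_real_interval(5)[of a b] unfolding convex_alt B_def by blast
    ultimately show "(1 - t) *\<^sub>R p + t *\<^sub>R q \<in> B" by (simp add: B_def algebra_simps)
  qed
  moreover have "(a, f2 a) \<in> A" "(a, f1 a + H) \<in> B" "A \<inter> B = {}"
    using h ab by (force simp: A_def B_def)+
  ultimately obtain m c where m: "m \<noteq> 0" "\<And>p. p \<in> A \<Longrightarrow> m \<bullet> p \<le> c" "\<And>p. p \<in> B \<Longrightarrow> m \<bullet> p \<ge> c"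
    using separating_hyperplane_sets[of A B] by (metis empty_iff)
  obtain m1 m2 where mm: "m = (m1, m2)" by (cases m)
  have A: "m1 * x + m2 * y \<le> c" if "x \<in> {a..b}" "y \<le> f2 x" for x y
    using m(2)[of "(x, y)"] that by (simp add: A_def mm)
  have B: "m1 * x + m2 * y \<ge> c" if "x \<in> {a..b}" "y \<ge> f1 x + H" for x y
    using m(3)[of "(x, y)"] that by (simp add: B_def mm)
  \<comment> \<open>\<open>A\<close> reaches arbitrarily far down, so m2 cannot be negative; a
    vertical line cannot separate, since both sets have points over a and over b.\<close>
  have "m2 > 0"
  proof (rule ccontr)
    assume "\<not> m2 > 0"
    moreover have "m2 \<ge> 0"
    proof (rule ccontr)
      assume "\<not> m2 \<ge> 0"
      define t where "t = max 0 ((c - m1 * a - m2 * f2 a) / (- m2)) + 1"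
      have "(c - m1 * a - m2 * f2 a) / (- m2) < t" by (simp add: t_def)
      then have "c - m1 * a - m2 * f2 a < t * (- m2)"
        using \<open>\<not> m2 \<ge> 0\<close> by (subst (asm) pos_divide_less_eq) auto
      moreover have "m1 * a + m2 * (f2 a - t) \<le> c"
        using ab by (intro A) (auto simp: t_def)
      ultimately show False by (simp add: algebra_simps)
    qed
    ultimately have "m2 = 0" by simp
    then have "m1 * a = c" "m1 * b = c"
      using A[of a "f2 a"] A[of b "f2 b"] B[of a "f1 a + H"] B[of b "f1 b + H"] ab by auto
    then have "m1 * (b - a) = 0" by (simp add: algebra_simps)
    then show False using ab m(1) mm \<open>m2 = 0\<close> by (simp add: zero_prod_def)
  qed
  define N where "N = norm m"
  have N: "N > 0" "m2 \<le> N" using m(1) norm_snd_le[of m2 m1] by (auto simp: N_def mm simp flip: zero_prod_def)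
  define e where "e = m /\<^sub>R N"
  have "norm e = 1" using N(1) by (simp add: e_def N_def)
  then have "1 \<le> projection_length \<Omega> e" by (rule projection_ge_1)
  \<comment> \<open>\<Omega> lies in a strip of vertical height H, whose width m2 H / N is at most H
    and hence below the smallest projection.\<close>
  also have "projection_length \<Omega> e \<le> m2 * H / N"
    unfolding projection_length_def
  proof (rule diameter_le)
    have "\<Omega> \<noteq> {}" using max1 by blast
    then show "(\<lambda>p. p \<bullet> e) ` \<Omega> \<noteq> {} \<or> 0 \<le> m2 * H / N" by blast
    fix s t assume "s \<in> (\<lambda>p. p \<bullet> e) ` \<Omega>" "t \<in> (\<lambda>p. p \<bullet> e) ` \<Omega>"
    then obtain p q where pq: "p \<in> \<Omega>" "q \<in> \<Omega>" "s = p \<bullet> e" "t = q \<bullet> e" by blast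
    have bd: "c - m2 * H \<le> m \<bullet> r \<and> m \<bullet> r \<le> c" if "r \<in> \<Omega>" for r
    proof -
      obtain x y where r: "r = (x, y)" by (cases r)
      then show ?thesis using that A[of x y] B[of x "y + H"] by (simp add: mem_iff mm algebra_simps)
    qed
    have "s - t = (m \<bullet> p - m \<bullet> q) / N"
      using N(1) by (simp add: pq e_def inner_commute[of m] divide_inverse algebra_simps)
    moreover have "\<bar>m \<bullet> p - m \<bullet> q\<bar> \<le> m2 * H" using bd[OF pq(1)] bd[OF pq(2)] by linarith
    ultimately show "norm (s - t) \<le> m2 * H / N" using N(1) by (simp add: divide_right_mono)
  qed
  finally have "N \<le> m2 * H" using N(1) by (simp add: le_divide_eq)
  also have "\<dots> < m2 * 1" using \<open>m2 > 0\<close> assms by (intro mult_strict_left_mono) auto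
  finally show False using N(2) by simp
qed

lemma rectangle_in_interior:
  assumes "a \<le> \<alpha>" "\<beta> \<le> b" and R: "\<And>x. \<alpha> < x \<Longrightarrow> x < \<beta> \<Longrightarrow> f1 x \<le> \<gamma> \<and> \<delta> \<le> f2 x"
    and "\<alpha> < \<alpha>'" "\<beta>' < \<beta>" "\<gamma> < \<gamma>'" "\<delta>' < \<delta>"
  shows "{\<alpha>'..\<beta>'} \<times> {\<gamma>'..\<delta>'} \<subseteq> interior \<Omega>"
proof -
  have "{\<alpha><..<\<beta>} \<times> {\<gamma><..<\<delta>} \<subseteq> \<Omega>"
    using assms(1,2) R by (force simp: mem_iff)
  then have "{\<alpha><..<\<beta>} \<times> {\<gamma><..<\<delta>} \<subseteq> interior \<Omega>"
    by (intro interior_maximal open_Times) auto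
  then show ?thesis using assms by force
qed

text \<open>A bound for every \<open>L\<close>: each domain contains a rectangle of sides 1/32 and
  7/32. It starts at a vertical chord of length at least 3/4; convexity keeps most of that chord
  over a distance 1/16 to the side on which [a, b] extends by at least 1/2.\<close>

lemma lam_less: "lam < 200\<^sup>2"
proof -
  obtain x where x: "x \<in> {a..b}" "f2 x - f1 x \<ge> 3 / 4" using height_ge[of "3 / 4"] by auto
  have fx: "f2 x \<ge> 3 / 4" "f1 x \<le> 1 / 4" using f1_nonneg[OF x(1)] f2_le_1[OF x(1)] x(2) by linarith+
  have near: "f1 z \<le> 3 / 8 \<and> 21 / 32 \<le> f2 z"
    if e: "e \<in> {a..b}" and z: "z = (1 - t) *\<^sub>R x + t *\<^sub>R e" "0 \<le> t" "t \<le> 1 / 8" for e z t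
  proof -
    have "(1 - t) * f2 x + t * f2 e \<le> f2 z"
      unfolding z(1) using z x e by (intro concave_onD[OF f2_concave]) auto
    moreover have "(7 / 8) * (3 / 4) \<le> (1 - t) * f2 x" using z fx by (intro mult_mono) auto
    moreover have "0 \<le> t * f2 e" using z f1_nonneg[OF e] f1_le_f2[OF e] by (intro mult_nonneg_nonneg) auto
    moreover have "f1 z \<le> (1 - t) * f1 x + t * f1 e"
      unfolding z(1) using z x e by (intro convex_onD[OF f1_convex]) auto
    moreover have "(1 - t) * f1 x \<le> 1 * (1 / 4)" using z fx f1_nonneg[OF x(1)] by (intro mult_mono) auto
    moreover have "t * f1 e \<le> (1 / 8) * 1"
      using z f1_nonneg[OF e] f1_le_f2[OF e] f2_le_1[OF e] by (intro mult_mono) auto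
    ultimately show ?thesis by simp
  qed
  have "\<exists>\<alpha>. a \<le> \<alpha> \<and> \<alpha> + 1 / 16 \<le> b \<and> (\<forall>z. \<alpha> < z \<longrightarrow> z < \<alpha> + 1 / 16 \<longrightarrow> f1 z \<le> 3 / 8 \<and> 21 / 32 \<le> f2 z)"
  proof (cases "x + 1 / 2 \<le> b")
    case True
    have "f1 z \<le> 3 / 8 \<and> 21 / 32 \<le> f2 z" if "x < z" "z < x + 1 / 16" for z
      by (rule near[of "x + 1 / 2" _ "2 * (z - x)"]) (use True x that in \<open>auto simp: algebra_simps\<close>)
    then show ?thesis using True x by (intro exI[of _ x]) auto
  next
    case False
    then have xa: "a \<le> x - 1 / 2" using ab_ge_1 by linarith
    have "f1 z \<le> 3 / 8 \<and> 21 / 32 \<le> f2 z" if "x - 1 / 16 < z" "z < x" for z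
      by (rule near[of "x - 1 / 2" _ "2 * (x - z)"]) (use xa x that in \<open>auto simp: algebra_simps\<close>)
    then show ?thesis using xa x by (intro exI[of _ "x - 1 / 16"]) auto
  qed
  then obtain \<alpha> where \<alpha>: "a \<le> \<alpha>" "\<alpha> + 1 / 16 \<le> b"
    "\<And>z. \<alpha> < z \<Longrightarrow> z < \<alpha> + 1 / 16 \<Longrightarrow> f1 z \<le> 3 / 8 \<and> 21 / 32 \<le> f2 z" by blast
  have "{\<alpha> + 1 / 64..\<alpha> + 3 / 64} \<times> {13 / 32..20 / 32} \<subseteq> interior \<Omega>"
    by (rule rectangle_in_interior[OF \<alpha>]) auto
  then have "lam \<le> (pi / ((\<alpha> + 3 / 64) - (\<alpha> + 1 / 64)))\<^sup>2 + (pi / (20 / 32 - 13 / 32))\<^sup>2"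
    by (intro lam_le_rectangle) auto
  also have "\<dots> = 32\<^sup>2 * pi\<^sup>2 + (32 / 7)\<^sup>2 * pi\<^sup>2" by (simp add: power_divide field_simps)
  also have "\<dots> \<le> 32\<^sup>2 * 4\<^sup>2 + (32 / 7)\<^sup>2 * 4\<^sup>2"
    using pi_less_4 by (intro add_mono mult_left_mono power_mono) auto
  also have "\<dots> < 200\<^sup>2" by (simp add: power_divide)
  finally show ?thesis .
qed

text \<open>The points vertically above and below on the two curves lie on the frontier, so
  \<open>le_dist_frontier\<close> applies with \<omega> = 200.\<close>

lemma le_vertical:
  assumes "(x, y) \<in> \<Omega>"
  shows "u (x, y) \<le> 200 * (f2 x - y)" "u (x, y) \<le> 200 * (y - f1 x)"
proof -
  have x: "x \<in> {a..b}" "f1 x \<le> y" "y \<le> f2 x" using assms by (auto simp: mem_iff)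
  have cl: "(x, y) \<in> closure \<Omega>" using assms closure_subset by blast
  have not_int: "(x, z) \<notin> interior \<Omega>" if z: "z = f1 x \<or> z = f2 x" for z
  proof
    assume "(x, z) \<in> interior \<Omega>"
    then have ev: "\<forall>\<^sub>F t in nhds 0. (x, z) + t *\<^sub>R (0, 1) \<in> interior \<Omega>"
      by (intro eventually_line_in_open) auto
    then obtain d where d: "d > 0" "\<And>t. \<bar>t\<bar> < d \<Longrightarrow> (x, z) + t *\<^sub>R (0, 1) \<in> interior \<Omega>"
      unfolding eventually_nhds_metric by auto
    have "(x, z + t) \<in> \<Omega>" if "\<bar>t\<bar> < d" for t using d(2)[OF that] interior_subset by auto
    from this[of "d / 2"] this[of "- (d / 2)"] z d(1) show False by (auto simp: mem_iff)
  qed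
  have "(x, f1 x) \<in> \<Omega>" "(x, f2 x) \<in> \<Omega>" using f1_le_f2 x by (auto simp: mem_iff)
  then have fr: "(x, f1 x) \<in> frontier \<Omega>" "(x, f2 x) \<in> frontier \<Omega>"
    using not_int closure_subset by (auto simp: frontier_def)
  show "u (x, y) \<le> 200 * (f2 x - y)" "u (x, y) \<le> 200 * (y - f1 x)"
    using le_dist_frontier[OF _ lam_less fr(2) cl] le_dist_frontier[OF _ lam_less fr(1) cl] x
    by (simp_all add: dist_Pair_Pair dist_real_def)
qed

text \<open>The interval of the length scale may lack its end points. Passing to two points inside
  it costs part of the length, here a quarter.\<close>

lemma length_scale_points:
  assumes L: "is_length_scale a b (\<lambda>x. f2 x - f1 x) L"
  obtains \<alpha> \<beta> where "L > 0" "a \<le> \<alpha>" "\<beta> \<le> b" "\<beta> - \<alpha> > 3 * L / 4"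
    "\<And>x. \<alpha> \<le> x \<Longrightarrow> x \<le> \<beta> \<Longrightarrow> f1 x \<le> 1 / L\<^sup>2 \<and> 1 - 1 / L\<^sup>2 \<le> f2 x"
proof -
  obtain I where I: "L > 0" "is_interval I" "I \<subseteq> {a..b}" "measure lborel I \<ge> L"
    "\<And>x. x \<in> I \<Longrightarrow> f2 x - f1 x \<ge> 1 - 1 / L\<^sup>2"
    using L unfolding is_length_scale_def length_scale_admissible_def
    by (auto simp: power_int_minus divide_inverse)
  have "\<exists>\<alpha>\<in>I. \<exists>\<beta>\<in>I. \<beta> - \<alpha> > 3 * L / 4"
  proof (rule ccontr)
    assume "\<not> ?thesis"
    then have le: "\<beta> - \<alpha> \<le> 3 * L / 4" if "\<alpha> \<in> I" "\<beta> \<in> I" for \<alpha> \<beta> using that by (meson not_le)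
    have ne: "I \<noteq> {}" using I(1,4) by auto
    have bb: "bdd_below I" using I(3) by (meson bdd_below_Icc bdd_below_mono)
    have "x \<le> Inf I + 3 * L / 4" if "x \<in> I" for x
    proof -
      have "x - 3 * L / 4 \<le> Inf I" using ne le[OF _ that] by (intro cInf_greatest) force+
      then show ?thesis by simp
    qed
    then have "I \<subseteq> {Inf I..Inf I + 3 * L / 4}" using bb by (auto intro: cInf_lower)
    then have "measure lborel I \<le> measure lborel {Inf I..Inf I + 3 * L / 4}"
      using real_interval_borel_measurable[OF I(2)]
      by (intro measure_mono_fmeasurable) (auto simp: fmeasurable_def emeasure_lborel_Icc_eq)
    then show False using I(1,4) by simp
  qed
  then obtain \<alpha> \<beta> where ab: "\<alpha> \<in> I" "\<beta> \<in> I" "\<beta> - \<alpha> > 3 * L / 4" by blast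
  show ?thesis
  proof (rule that[of \<alpha> \<beta>])
    fix x assume "\<alpha> \<le> x" "x \<le> \<beta>"
    then have "x \<in> I" using I(2) ab unfolding is_interval_1 by blast
    then show "f1 x \<le> 1 / L\<^sup>2 \<and> 1 - 1 / L\<^sup>2 \<le> f2 x"
      using I(3) I(5)[of x] f1_nonneg[of x] f2_le_1[of x] by force
  qed (use ab I in auto)
qed

text \<open>With s = 1 / L^2 there is a rectangle of length at least L / 2 and height 1 - 4 s. Its
  eigenvalue is at most 4 s pi^2 + (1 + 16 s) pi^2, and 20 pi^2 \<le> 320.\<close>

lemma lam_le:
  assumes L: "is_length_scale a b (\<lambda>x. f2 x - f1 x) L" and L4: "L \<ge> 4"
  shows "lam \<le> pi\<^sup>2 + 320 / L\<^sup>2"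
proof -
  obtain \<alpha> \<beta> where ab: "L > 0" "a \<le> \<alpha>" "\<beta> \<le> b" "\<beta> - \<alpha> > 3 * L / 4"
    and R: "\<And>x. \<alpha> \<le> x \<Longrightarrow> x \<le> \<beta> \<Longrightarrow> f1 x \<le> 1 / L\<^sup>2 \<and> 1 - 1 / L\<^sup>2 \<le> f2 x"
    using length_scale_points[OF L] by blast
  define s where "s = 1 / L\<^sup>2"
  have "4\<^sup>2 \<le> L\<^sup>2" using L4 by (intro power_mono) auto
  then have s: "s > 0" "s \<le> 1 / 16" using L4 by (auto simp: s_def divide_le_eq)
  have "{\<alpha> + L / 16..\<beta> - L / 16} \<times> {2 * s..1 - 2 * s} \<subseteq> interior \<Omega>"
    by (rule rectangle_in_interior[OF ab(2,3), of s "1 - s"]) (use R ab(1) s in \<open>auto simp: s_def[symmetric]\<close>)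
  then have "lam \<le> (pi / (\<beta> - L / 16 - (\<alpha> + L / 16)))\<^sup>2 + (pi / (1 - 2 * s - 2 * s))\<^sup>2"
    using ab s by (intro lam_le_rectangle) auto
  also have "\<dots> \<le> (pi / (L / 2))\<^sup>2 + (pi / (1 - 4 * s))\<^sup>2"
    using ab s by (intro add_mono power_mono divide_left_mono mult_pos_pos) auto
  also have "(pi / (L / 2))\<^sup>2 = 4 * s * pi\<^sup>2" by (simp add: s_def power_divide)
  also have "(pi / (1 - 4 * s))\<^sup>2 \<le> (1 + 16 * s) * pi\<^sup>2"
  proof -
    have "1 \<le> (1 + 16 * s) * (1 - 4 * s)\<^sup>2"
    proof -
      have "(1 + 16 * s) * (1 - 4 * s)\<^sup>2 - 1 = 4 * s * (2 * (1 - 16 * s) + s * (4 + 64 * s))"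
        by (simp add: power2_eq_square algebra_simps)
      also have "\<dots> \<ge> 0" using s by (intro mult_nonneg_nonneg add_nonneg_nonneg) auto
      finally show ?thesis by simp
    qed
    then have "1 / (1 - 4 * s)\<^sup>2 \<le> 1 + 16 * s" using s by (simp add: divide_le_eq)
    then have "(1 / (1 - 4 * s)\<^sup>2) * pi\<^sup>2 \<le> (1 + 16 * s) * pi\<^sup>2" by (intro mult_right_mono) auto
    then show ?thesis by (simp add: power_divide)
  qed
  finally have "lam \<le> pi\<^sup>2 + 20 * s * pi\<^sup>2" by (simp add: algebra_simps)
  also have "20 * s * pi\<^sup>2 \<le> 20 * s * 4\<^sup>2"
    using s pi_less_4 by (intro mult_left_mono power_mono) auto
  finally show ?thesis by (simp add: s_def)
qed

end

section \<open>Location of the superlevel set\<close>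

lemma sin_ge_chord:
  assumes "0 \<le> x" "x \<le> pi / 2"
  shows "2 * x / pi \<le> sin x"
proof -
  have "concave_on {0..pi / 2} sin"
    by (rule f''_le0_imp_concave[where f' = cos and f'' = "\<lambda>x. - sin x"])
       (auto intro!: derivative_eq_intros sin_ge_zero)
  from concave_onD[OF this, of "2 * x / pi" 0 "pi / 2"] show ?thesis
    using assms by (simp add: divide_le_eq)
qed

text \<open>The cosine is the ground state of a strip of width W. This bound and
  \<open>cos_le_tent\<close> make it comparable with the distance to the sides, the quantity by
  which \<open>le_vertical\<close> controls \<open>u\<close>.\<close>

lemma cos_ge_tent:
  assumes "W > 0" "\<bar>z\<bar> \<le> W / 2"
  shows "1 - 2 * \<bar>z\<bar> / W \<le> cos (pi / W * z)"
proof -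
  define t where "t = pi / 2 - pi / W * \<bar>z\<bar>"
  have "pi / W * \<bar>z\<bar> \<le> pi / W * (W / 2)" using assms by (intro mult_left_mono) auto
  then have "0 \<le> t" "t \<le> pi / 2" using assms by (auto simp: t_def)
  then have "2 * t / pi \<le> sin t" by (rule sin_ge_chord)
  moreover have "2 * t / pi = 1 - 2 * \<bar>z\<bar> / W" using assms by (simp add: t_def field_simps)
  moreover have "sin t = cos (pi / W * \<bar>z\<bar>)" by (simp add: t_def sin_diff)
  moreover have "cos (pi / W * \<bar>z\<bar>) = cos (pi / W * z)" by (cases "z \<ge> 0") auto
  ultimately show ?thesis by simp
qed

lemma cos_le_tent:
  assumes "W > 0" "\<bar>z\<bar> \<le> W / 2"
  shows "cos (pi / W * z) \<le> pi / 2 * (1 - 2 * \<bar>z\<bar> / W)"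
proof -
  define t where "t = pi / 2 - pi / W * \<bar>z\<bar>"
  have "pi / W * \<bar>z\<bar> \<le> pi / W * (W / 2)" using assms by (intro mult_left_mono) auto
  then have "0 \<le> t" using assms by (auto simp: t_def)
  then have "sin t \<le> t" by (rule sin_x_le_x)
  moreover have "sin t = cos (pi / W * \<bar>z\<bar>)" by (simp add: t_def sin_diff)
  moreover have "cos (pi / W * \<bar>z\<bar>) = cos (pi / W * z)" by (cases "z \<ge> 0") auto
  ultimately show ?thesis by (simp add: t_def algebra_simps)
qed

lemma cos_strip_pos:
  assumes "W > 0" "\<bar>z\<bar> < W / 2"
  shows "0 < cos (pi / W * z)"
proof -
  have "2 * \<bar>z\<bar> / W < 1" using assms by (simp add: divide_less_eq)
  moreover have "1 - 2 * \<bar>z\<bar> / W \<le> cos (pi / W * z)" using assms by (intro cos_ge_tent) auto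
  ultimately show ?thesis by linarith
qed

lemma abs_diff_midpoint_le:
  fixes y s0 s1 :: real
  assumes "s0 \<le> y" "y \<le> s1"
  shows "\<bar>y - (s0 + s1) / 2\<bar> \<le> (s1 - s0) / 2"
  using assms by (simp add: abs_le_iff field_simps)

lemma closure_vimage_fst_subset:
  "closure (V \<inter> fst -` J) \<subseteq> fst -` closure J" for J :: "real set"
proof (rule closure_minimal)
  show "V \<inter> fst -` J \<subseteq> fst -` closure J" using closure_subset by blast
  show "closed ((fst :: _ \<Rightarrow> real) -` closure J)" by (intro closed_vimage continuous_intros) auto
qed

section \<open>Decay of \<open>u\<close> in thin strips\<close>

context ground_state
begin

text \<open>Initial data for the barriers below: on a vertical cut through \<Omega> nothing
  vanishes, and a multiple of the strip profile has to dominate \<open>u\<close> there.\<close>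

lemma le_cos_strip:
  assumes p: "(x, y) \<in> interior \<Omega>" and s: "s0 \<le> f1 x" "f2 x \<le> s1" "s0 < s1" "s1 - s0 < W" "W \<le> 2"
  shows "u (x, y) \<le> 200 * cos (pi / W * (y - (s0 + s1) / 2))"
proof -
  define z where "z = y - (s0 + s1) / 2"
  have \<Omega>: "(x, y) \<in> \<Omega>" using p interior_subset by auto
  have y: "s0 \<le> y" "y \<le> s1" using \<Omega> s by (auto simp: mem_iff)
  have W: "W > 0" using s by linarith
  have zW: "\<bar>z\<bar> \<le> W / 2" unfolding z_def using s by (intro order_trans[OF abs_diff_midpoint_le[OF y]]) simp
  have "u (x, y) \<le> 200 * (W / 2 - \<bar>z\<bar>)"
  proof (cases "0 \<le> z")
    case True
    then show ?thesis using le_vertical(1)[OF \<Omega>] s(2,4) unfolding abs_of_nonneg[OF True] z_def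
      by (simp add: field_simps)
  next
    case False
    then have "\<bar>z\<bar> = - z" by simp
    then show ?thesis using le_vertical(2)[OF \<Omega>] s(1,4) unfolding z_def by (simp add: field_simps)
  qed
  also have "W / 2 - \<bar>z\<bar> = W / 2 * (1 - 2 * \<bar>z\<bar> / W)" using W by (simp add: field_simps)
  also have "\<dots> \<le> 1 * (1 - 2 * \<bar>z\<bar> / W)"
    using W s zW by (intro mult_right_mono) (auto simp: field_simps)
  also have "\<dots> \<le> 1 * cos (pi / W * z)"
    using W zW cos_ge_tent[of W z] by simp
  finally show ?thesis by (simp add: z_def)
qed

text \<open>A barrier X(x) cos(...) in separated variables, where X'' = \<nu> X. Taking W larger
  than s1 - s0 keeps the cosine positive on the closed strip, so that only the ends of
  \<open>J\<close> need a hypothesis.\<close>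

lemma strip_comparison:
  assumes J: "open J" and X: "continuous_on (closure J) X" "\<And>x. x \<in> closure J \<Longrightarrow> X x > 0"
    "\<And>x. x \<in> J \<Longrightarrow> has_D2 (\<lambda>t. X (x + t)) (\<nu> * X x)"
    and strip: "\<And>x. x \<in> J \<Longrightarrow> x \<in> {a..b} \<Longrightarrow> s0 \<le> f1 x \<and> f2 x \<le> s1"
    and W: "s0 < s1" "s1 - s0 < W" and lam: "lam < (pi / W)\<^sup>2 - \<nu>"
    and bd: "\<And>x y. x \<in> closure J \<Longrightarrow> x \<notin> J \<Longrightarrow> (x, y) \<in> interior \<Omega> \<Longrightarrow>
      u (x, y) \<le> X x * cos (pi / W * (y - (s0 + s1) / 2))"
    and p: "(x, y) \<in> interior \<Omega>" "x \<in> J"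
  shows "u (x, y) \<le> X x * cos (pi / W * (y - (s0 + s1) / 2))"
proof -
  define Y where "Y = (\<lambda>y. cos (pi / W * (y - (s0 + s1) / 2)))"
  define V where "V = interior \<Omega> \<inter> fst -` J"
  have V: "open V" unfolding V_def by (intro open_Int open_vimage J open_interior continuous_intros)
  have "V \<subseteq> snd -` {s0..s1}"
  proof
    fix q assume "q \<in> V"
    then have "q \<in> \<Omega>" "fst q \<in> J" using interior_subset by (auto simp: V_def)
    then show "q \<in> snd -` {s0..s1}" using strip[of "fst q"] by (cases q) (auto simp: mem_iff)
  qed
  then have "closure V \<subseteq> snd -` {s0..s1}"
    by (intro closure_minimal closed_vimage continuous_intros) auto
  then have y_in: "s0 \<le> snd q" "snd q \<le> s1" if "q \<in> closure V" for q using that by auto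
  have x_in: "fst q \<in> closure J" if "q \<in> closure V" for q
    using closure_vimage_fst_subset[of "interior \<Omega>" J] that unfolding V_def by blast
  have cl: "closure V \<subseteq> closure \<Omega>"
    unfolding V_def by (intro closure_mono) (use interior_subset in blast)
  have Wp: "W > 0" using W by simp
  have Ypos: "0 < Y (snd q)" if "q \<in> closure V" for q
    unfolding Y_def using W
    by (intro cos_strip_pos Wp order.strict_trans1[OF abs_diff_midpoint_le[OF y_in[OF that]]]) simp
  have "u (x, y) \<le> X (fst (x, y)) * Y (snd (x, y))"
  proof (rule helm_comparison[where K = "closure V" and V = V and lam = lam])
    show "compact (closure V)" using compact_closure cl by (metis closed_closure compact_Int_closed inf.absorb_iff2)
    show "continuous_on (closure V) u" using cont cl by (rule continuous_on_subset)
    show "continuous_on (closure V) (\<lambda>q. X (fst q) * Y (snd q))"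
      unfolding Y_def by (intro continuous_intros continuous_on_compose2[OF X(1)]) (use x_in in auto)
    show "0 < X (fst q) * Y (snd q)" if "q \<in> closure V" for q
      using Ypos[OF that] X(2)[OF x_in[OF that]] by simp
    show "helm V lam u" by (rule helm_subset[OF helm]) (simp add: V_def)
    show "u q \<le> X (fst q) * Y (snd q)" if q: "q \<in> closure V" "q \<notin> V" for q
    proof (cases "q \<in> interior \<Omega>")
      case True
      then have "fst q \<notin> J" using q by (simp add: V_def)
      then show ?thesis using bd[of "fst q" "snd q"] x_in[OF q(1)] True by (simp add: Y_def)
    next
      case False
      then have "u q = 0" using q(1) cl closure_cases[of q] zero[of q] by blast
      then show ?thesis using Ypos[OF q(1)] X(2)[OF x_in[OF q(1)]] by simp
    qed
    show "\<exists>e. (\<forall>k\<in>Basis. has_D2 (\<lambda>t. X (fst (q + t *\<^sub>R k)) * Y (snd (q + t *\<^sub>R k))) (e k)) \<and>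
        (\<Sum>k\<in>Basis. e k) < - lam * (X (fst q) * Y (snd q))" if q: "q \<in> V" for q
    proof -
      have Jq: "fst q \<in> J" using q by (simp add: V_def)
      have "has_D2 (\<lambda>t. Y (snd q + t)) (- ((pi / W)\<^sup>2) * Y (snd q))"
        unfolding Y_def by (rule has_D2_shifted(2))
      from has_D2_product[OF X(3)[OF Jq] this] obtain e where
        e: "\<forall>k\<in>Basis. has_D2 (\<lambda>t. X (fst (q + t *\<^sub>R k)) * Y (snd (q + t *\<^sub>R k))) (e k)"
        "(\<Sum>k\<in>Basis. e k) = \<nu> * X (fst q) * Y (snd q) + X (fst q) * (- ((pi / W)\<^sup>2) * Y (snd q))"
        by blast
      have "0 < X (fst q) * Y (snd q)" using q closure_subset Ypos X(2) x_in by (meson mult_pos_pos subsetD)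
      then have "(\<nu> - (pi / W)\<^sup>2) * (X (fst q) * Y (snd q)) < - lam * (X (fst q) * Y (snd q))"
        using lam by (intro mult_strict_right_mono) auto
      with e show ?thesis by (intro exI[of _ e]) (simp add: algebra_simps)
    qed
    have "(x, y) \<in> V" using p by (simp add: V_def)
    then show "(x, y) \<in> closure V" using closure_subset by blast
  qed (use V closure_subset in auto)
  then show ?thesis by (simp add: Y_def)
qed

text \<open>In a strip whose frequency squared exceeds lam by more than \<kappa>^2, the barrier may
  decay like exp(- \<kappa> |x - x1|). The sign \<tau> selects the side of x1.\<close>

lemma exponential_decay:
  assumes \<tau>: "\<tau> = 1 \<or> \<tau> = (-1::real)"
    and strip: "\<And>x. x \<in> {a..b} \<Longrightarrow> 0 \<le> \<tau> * (x - x1) \<Longrightarrow> s0 \<le> f1 x \<and> f2 x \<le> s1"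
    and W: "s0 < s1" "s1 - s0 < W" "W \<le> 2" and lam: "lam < (pi / W)\<^sup>2 - \<kappa>\<^sup>2"
    and p: "(x, y) \<in> interior \<Omega>" "0 < \<tau> * (x - x1)"
  shows "u (x, y) \<le> 200 * exp (- \<kappa> * (\<tau> * (x - x1))) * cos (pi / W * (y - (s0 + s1) / 2))"
proof (rule strip_comparison[where J = "{x. 0 < \<tau> * (x - x1)}" and \<nu> = "\<kappa>\<^sup>2", OF _ _ _ _ _ W(1,2) lam])
  have cl: "closure {x. 0 < \<tau> * (x - x1)} \<subseteq> {x. 0 \<le> \<tau> * (x - x1)}"
    by (intro closure_minimal closed_Collect_le continuous_intros) auto
  show "open {x. 0 < \<tau> * (x - x1)}" by (intro open_Collect_less continuous_intros)
  show "continuous_on (closure {x. 0 < \<tau> * (x - x1)}) (\<lambda>x. 200 * exp (- \<kappa> * (\<tau> * (x - x1))))"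
    by (intro continuous_intros)
  show "s0 \<le> f1 x \<and> f2 x \<le> s1" if "x \<in> {x. 0 < \<tau> * (x - x1)}" "x \<in> {a..b}" for x
    using strip that by auto
  show "has_D2 (\<lambda>t. 200 * exp (- \<kappa> * (\<tau> * (x + t - x1)))) (\<kappa>\<^sup>2 * (200 * exp (- \<kappa> * (\<tau> * (x - x1)))))" for x
    using has_D2_cmult[OF has_D2_shifted(3)[of "- \<kappa> * \<tau>" x x1], of 200] \<tau>
    by (auto simp: algebra_simps)
  fix x y assume x: "x \<in> closure {x. 0 < \<tau> * (x - x1)}" "x \<notin> {x. 0 < \<tau> * (x - x1)}" "(x, y) \<in> interior \<Omega>"
  then have "0 \<le> \<tau> * (x - x1)" using cl by blast
  then have 0: "\<tau> * (x - x1) = 0" using x(2) by simp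
  have "x \<in> {a..b}" using x(3) interior_subset mem_iff by blast
  then have "u (x, y) \<le> 200 * cos (pi / W * (y - (s0 + s1) / 2))"
    using strip[of x] 0 W by (intro le_cos_strip[OF x(3)]) auto
  then show "u (x, y) \<le> 200 * exp (- \<kappa> * (\<tau> * (x - x1))) * cos (pi / W * (y - (s0 + s1) / 2))"
    unfolding 0 by simp
qed (use p in auto)

text \<open>A chord shorter than 1 - 2 s stays away by more than s from one of the lines y = 0 and y
  = 1. The point \<alpha> of the length scale is closer than s to both, so by convexity the defect
  persists on the whole side of x1 facing away from \<alpha>.\<close>

lemma thin_strip:
  assumes L: "is_length_scale a b (\<lambda>x. f2 x - f1 x) L"
    and x1: "x1 \<in> {a..b}" "f2 x1 - f1 x1 < 1 - 2 * s" and s: "2 / L\<^sup>2 \<le> s"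
  obtains \<tau> s0 s1 where "\<tau> = 1 \<or> \<tau> = (-1::real)" "s1 - s0 = 1 - s" "\<bar>(s0 + s1) / 2 - 1 / 2\<bar> = s / 2"
    "\<And>x. x \<in> {a..b} \<Longrightarrow> 0 \<le> \<tau> * (x - x1) \<Longrightarrow> s0 \<le> f1 x \<and> f2 x \<le> s1"
proof -
  obtain \<alpha> \<beta> where I: "L > 0" "a \<le> \<alpha>" "\<beta> \<le> b" "\<beta> - \<alpha> > 3 * L / 4"
    "\<And>x. \<alpha> \<le> x \<Longrightarrow> x \<le> \<beta> \<Longrightarrow> f1 x \<le> 1 / L\<^sup>2 \<and> 1 - 1 / L\<^sup>2 \<le> f2 x"
    using length_scale_points[OF L] by metis
  have Lp: "1 / L\<^sup>2 > 0" using I(1) by simp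
  have "2 / L\<^sup>2 = 2 * (1 / L\<^sup>2)" by simp
  then have s1: "1 / L\<^sup>2 < s" "s > 0" using s Lp by linarith+
  have z: "\<alpha> \<in> {a..b}" "f1 \<alpha> < s" "1 - s < f2 \<alpha>" using I(5)[of \<alpha>] I(1-4) s1 by auto
  have "x1 \<noteq> \<alpha>" using x1(2) z by auto
  define \<tau> :: real where "\<tau> = (if \<alpha> < x1 then 1 else -1)"
  have \<tau>: "\<tau> = 1 \<or> \<tau> = -1" by (simp add: \<tau>_def)
  have between: "\<exists>t. 0 \<le> t \<and> t \<le> 1 \<and> x1 = (1 - t) *\<^sub>R \<alpha> + t *\<^sub>R x" if "0 \<le> \<tau> * (x - x1)" for x
  proof -
    have ne: "x \<noteq> \<alpha>" using that \<open>x1 \<noteq> \<alpha>\<close> by (auto simp: \<tau>_def split: if_splits)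
    have "(x1 - \<alpha>) / (x - \<alpha>) \<ge> 0" "(x1 - \<alpha>) / (x - \<alpha>) \<le> 1"
      using that \<open>x1 \<noteq> \<alpha>\<close> ne by (auto simp: \<tau>_def divide_simps split: if_splits)
    moreover have "x1 = (1 - (x1 - \<alpha>) / (x - \<alpha>)) *\<^sub>R \<alpha> + ((x1 - \<alpha>) / (x - \<alpha>)) *\<^sub>R x"
    proof -
      have "(1 - r) *\<^sub>R \<alpha> + r *\<^sub>R x = \<alpha> + r * (x - \<alpha>)" for r by (simp add: algebra_simps)
      from this[of "(x1 - \<alpha>) / (x - \<alpha>)"] show ?thesis using ne by (simp del: real_scaleR_def)
    qed
    ultimately show ?thesis by blast
  qed
  consider "f1 x1 > s" | "f2 x1 < 1 - s" using x1(2) by linarith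
  then show ?thesis
  proof cases
    case 1
    show ?thesis
    proof (rule that[OF \<tau>, of 1 s])
      fix x assume x: "x \<in> {a..b}" "0 \<le> \<tau> * (x - x1)"
      obtain t where t: "0 \<le> t" "t \<le> 1" "x1 = (1 - t) *\<^sub>R \<alpha> + t *\<^sub>R x" using between[OF x(2)] by blast
      have "f1 x1 \<le> (1 - t) * f1 \<alpha> + t * f1 x"
        unfolding t(3) using t x z by (intro convex_onD[OF f1_convex])
      moreover have "(1 - t) * f1 \<alpha> \<le> (1 - t) * s" using t z by (intro mult_left_mono) auto
      ultimately have "t * s < t * f1 x" using 1 by (simp add: algebra_simps)
      then have "s \<le> f1 x" using t by (simp add: mult_less_cancel_left split: if_splits)
      then show "s \<le> f1 x \<and> f2 x \<le> 1" using f2_le_1[OF x(1)] by simp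
    qed (use s1 in \<open>auto simp: field_simps\<close>)
  next
    case 2
    show ?thesis
    proof (rule that[OF \<tau>, of "1 - s" 0])
      fix x assume x: "x \<in> {a..b}" "0 \<le> \<tau> * (x - x1)"
      obtain t where t: "0 \<le> t" "t \<le> 1" "x1 = (1 - t) *\<^sub>R \<alpha> + t *\<^sub>R x" using between[OF x(2)] by blast
      have "(1 - t) * f2 \<alpha> + t * f2 x \<le> f2 x1"
        unfolding t(3) using t x z by (intro concave_onD[OF f2_concave])
      moreover have "(1 - t) * (1 - s) \<le> (1 - t) * f2 \<alpha>" using t z by (intro mult_left_mono) auto
      ultimately have "t * f2 x < t * (1 - s)" using 2 by (simp add: algebra_simps)
      then have "f2 x \<le> 1 - s" using t by (simp add: mult_less_cancel_left split: if_splits)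
      then show "0 \<le> f1 x \<and> f2 x \<le> 1 - s" using f1_nonneg[OF x(1)] by simp
    qed (use s1 in \<open>auto simp: field_simps\<close>)
  qed
qed

end

section \<open>Numerical comparison of strip profiles and frequencies\<close>

lemma exp_minus_20_le: "exp (- 20) \<le> (1 / 1000000 :: real)"
proof -
  have "(2::real) ^ 20 \<le> exp 1 ^ 20" using exp_ge_add_one_self[of 1] by (intro power_mono) auto
  also have "\<dots> = exp 20" using exp_of_nat_mult[of 20 "1::real"] by simp
  finally have "1000000 \<le> (exp 20 :: real)" by simp
  then have "1 / exp 20 \<le> (1 / 1000000 :: real)" by (intro divide_left_mono) auto
  then show ?thesis by (simp add: exp_minus inverse_eq_divide)
qed

text \<open>The hypotheses place the narrow strip inside the wide one, so distances to the sides
  only grow. Both profiles are compared with these distances, with pi / W \<le> 8 and W' \<le>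
  2.\<close>

lemma cos_strip_le_cos_strip:
  assumes c: "\<bar>c - c'\<bar> \<le> s / 2" and W: "1 / 2 \<le> W" "W + s \<le> W'" "W' \<le> 2" "s \<ge> 0" and y: "\<bar>y - c\<bar> \<le> W / 2"
  shows "cos (pi / W * (y - c)) \<le> 8 * cos (pi / W' * (y - c'))"
proof -
  have r: "0 \<le> W / 2 - \<bar>y - c\<bar>" "W / 2 - \<bar>y - c\<bar> \<le> W' / 2 - \<bar>y - c'\<bar>" using y c W by (auto simp: abs_if split: if_splits)
  have "cos (pi / W * (y - c)) \<le> pi / 2 * (1 - 2 * \<bar>y - c\<bar> / W)" using W y by (intro cos_le_tent) auto
  also have "\<dots> = (pi / W) * (W / 2 - \<bar>y - c\<bar>)" using W by (simp add: field_simps)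
  also have "\<dots> \<le> 8 * (W' / 2 - \<bar>y - c'\<bar>)"
    using W pi_less_4 r by (intro mult_mono) (auto simp: divide_le_eq)
  also have "\<dots> \<le> 8 * ((2 / W') * (W' / 2 - \<bar>y - c'\<bar>))"
  proof (rule mult_left_mono)
    have "1 \<le> 2 / W'" using W by (simp add: le_divide_eq)
    then have "1 * (W' / 2 - \<bar>y - c'\<bar>) \<le> (2 / W') * (W' / 2 - \<bar>y - c'\<bar>)" using r by (intro mult_right_mono) auto
    then show "W' / 2 - \<bar>y - c'\<bar> \<le> (2 / W') * (W' / 2 - \<bar>y - c'\<bar>)" by simp
  qed simp
  also have "(2 / W') * (W' / 2 - \<bar>y - c'\<bar>) = 1 - 2 * \<bar>y - c'\<bar> / W'" using W by (simp add: field_simps)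
  also have "8 * (1 - 2 * \<bar>y - c'\<bar> / W') \<le> 8 * cos (pi / W' * (y - c'))"
    using W r cos_ge_tent[of W' "y - c'"] by simp
  finally show ?thesis .
qed

text \<open>Price of the small enlargement of the unit strip that keeps the profile positive on the
  closed strip.\<close>

lemma wide_frequency:
  assumes "L \<ge> (4::real)"
  shows "pi\<^sup>2 - 1 / L\<^sup>2 \<le> (pi / (1 + 1 / (50 * L\<^sup>2)))\<^sup>2"
proof -
  define e where "e = 1 / (50 * L\<^sup>2)"
  have e: "e \<ge> 0" by (simp add: e_def)
  have "(1 - 2 * e) * (1 + e)\<^sup>2 = 1 - 3 * e\<^sup>2 - 2 * e ^ 3"
    by (simp add: power2_eq_square power3_eq_cube algebra_simps)
  moreover have "0 \<le> e\<^sup>2" "0 \<le> e ^ 3" using e by simp_all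
  ultimately have "(1 - 2 * e) * (1 + e)\<^sup>2 \<le> 1" by linarith
  then have "1 - 2 * e \<le> 1 / (1 + e)\<^sup>2" using e by (simp add: le_divide_eq)
  then have "pi\<^sup>2 * (1 - 2 * e) \<le> pi\<^sup>2 * (1 / (1 + e)\<^sup>2)" by (intro mult_left_mono) auto
  moreover have "pi\<^sup>2 * (2 * e) \<le> 4\<^sup>2 * (2 * e)" using pi_less_4 e by (intro mult_right_mono power_mono) auto
  moreover have "4\<^sup>2 * (2 * e) \<le> 1 / L\<^sup>2" using assms by (simp add: e_def field_simps)
  ultimately show ?thesis unfolding e_def[symmetric] by (simp add: power_divide algebra_simps)
qed

text \<open>Gain in a thin strip: linear in the loss of width, against which \<kappa>^2 and the
  excess of lam are balanced.\<close>

lemma narrow_frequency: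
  fixes z :: real
  assumes "0 \<le> z" "z < 1"
  shows "pi\<^sup>2 + 8 * z \<le> (pi / (1 - z))\<^sup>2"
proof -
  have "(1 + 2 * z) * (1 - z)\<^sup>2 = 1 - z\<^sup>2 * (3 - 2 * z)"
    by (simp add: power2_eq_square algebra_simps)
  also have "\<dots> \<le> 1" using assms by simp
  finally have "1 + 2 * z \<le> 1 / (1 - z)\<^sup>2" using assms by (simp add: le_divide_eq)
  then have "pi\<^sup>2 * (1 + 2 * z) \<le> pi\<^sup>2 * (1 / (1 - z)\<^sup>2)" by (intro mult_left_mono) auto
  moreover have "2\<^sup>2 * (2 * z) \<le> pi\<^sup>2 * (2 * z)" using pi_ge_two assms by (intro mult_right_mono power_mono) auto
  ultimately show ?thesis by (simp add: power_divide algebra_simps)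
qed

section \<open>Height of the domain near the superlevel set\<close>

context ground_state
begin

text \<open>Used in contrapositive form: from a point where u \<ge> 1/2, \<open>u\<close> cannot
  become small across a whole vertical line within distance 2 L / 100000. This also shows that this
  line meets the interior, because the hypothesis on x2 is vacuous otherwise.\<close>

lemma slow_growth:
  assumes L: "is_length_scale a b (\<lambda>x. f2 x - f1 x) L" "L \<ge> 4" and \<sigma>: "\<sigma> = 1 \<or> \<sigma> = (-1::real)"
    and bd: "\<And>y. (x2, y) \<in> interior \<Omega> \<Longrightarrow> u (x2, y) \<le> 1 / 8 * cos (pi / (1 + 1 / (50 * L\<^sup>2)) * (y - 1 / 2))"
    and p: "(x, y) \<in> interior \<Omega>" "\<sigma> * (x - x2) = 2 * (L / 100000)"
  shows "u (x, y) < 1 / 2"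
proof -
  define W where "W = 1 + 1 / (50 * L\<^sup>2)"
  \<comment> \<open>k^2 = 400 / L^2 covers the excess 320 / L^2 of lam and the loss 1 / L^2 of
    \<open>wide_frequency\<close>.\<close>
  define k where "k = 20 / L"
  define D where "D = pi / 80 * L"
  \<comment> \<open>X starts at 1/8, the data on x2. At distance D, where the phase is pi / 4, it
    exceeds 200 and dominates \<open>u\<close> by \<open>le_cos_strip\<close>; this fixes the
    coefficient 300. At the point in question the phase is only 1/2500, so X is at most 1/8 +
    300/2500.\<close>
  define X where "X = (\<lambda>x. 1 / 8 * cos (k * \<sigma> * (x - x2)) + 300 * sin (k * \<sigma> * (x - x2)))"
  define J where "J = {x. 0 < \<sigma> * (x - x2)} \<inter> {x. \<sigma> * (x - x2) < D}"
  have "1 \<le> L\<^sup>2" using L(2) by (simp add: one_le_power)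
  then have W: "1 < W" "W \<le> 2" by (auto simp: W_def divide_le_eq)
  have k: "k > 0" using L(2) by (simp add: k_def)
  have kD: "k * D = pi / 4" using L(2) by (simp add: k_def D_def)
  have "closure J \<subseteq> {x. 0 \<le> \<sigma> * (x - x2)} \<inter> {x. \<sigma> * (x - x2) \<le> D}"
    unfolding J_def by (intro closure_minimal closed_Int closed_Collect_le continuous_intros) auto
  then have cl: "0 \<le> \<sigma> * (x - x2)" "\<sigma> * (x - x2) \<le> D" if "x \<in> closure J" for x using that by auto
  have pi4: "0 < pi / 4" "pi / 4 < pi / 2" by auto
  have arg: "0 \<le> k * \<sigma> * (x - x2)" "k * \<sigma> * (x - x2) \<le> pi / 4" if "x \<in> closure J" for x
    using cl[OF that] k mult_left_mono[OF cl(2)[OF that], of k] kD by (simp_all add: mult.assoc)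
  have D2: "2 * (L / 100000) < D" using pi_ge_two L(2) by (simp add: D_def)
  have "u (x, y) \<le> X x * cos (pi / W * (y - (0 + 1) / 2))"
  proof (rule strip_comparison[where J = J and \<nu> = "- (k\<^sup>2)"])
    show "open J" unfolding J_def by (intro open_Int open_Collect_less continuous_intros)
    show "continuous_on (closure J) X" unfolding X_def by (intro continuous_intros)
    show "0 < X x" if "x \<in> closure J" for x
    proof -
      have "0 < cos (k * \<sigma> * (x - x2))" using arg[OF that] pi4 by (intro cos_gt_zero_pi) linarith+
      moreover have "0 \<le> sin (k * \<sigma> * (x - x2))" using arg[OF that] pi4 by (intro sin_ge_zero) linarith+
      ultimately show ?thesis by (simp add: X_def add_pos_nonneg)
    qed
    have "(k * \<sigma>)\<^sup>2 = k\<^sup>2" using \<sigma> by auto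
    then have "- (k\<^sup>2) * X x = 1 / 8 * (- ((k * \<sigma>)\<^sup>2) * cos (k * \<sigma> * (x - x2)))
        + 300 * (- ((k * \<sigma>)\<^sup>2) * sin (k * \<sigma> * (x - x2)))" for x
      unfolding X_def by (simp only:) (simp add: algebra_simps)
    then show "has_D2 (\<lambda>t. X (x + t)) (- (k\<^sup>2) * X x)" for x
      using has_D2_add[OF has_D2_cmult[OF has_D2_shifted(2)[of "k * \<sigma>" x x2], of "1 / 8"]
          has_D2_cmult[OF has_D2_shifted(1)[of "k * \<sigma>" x x2], of 300]]
      unfolding X_def by (simp only:)
    show "0 \<le> f1 x \<and> f2 x \<le> 1" if "x \<in> {a..b}" for x using f1_nonneg f2_le_1 that by auto
    show "lam < (pi / W)\<^sup>2 - - (k\<^sup>2)"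
    proof -
      have "lam \<le> pi\<^sup>2 + 320 / L\<^sup>2" by (rule lam_le[OF L])
      moreover have "pi\<^sup>2 - 1 / L\<^sup>2 \<le> (pi / W)\<^sup>2" unfolding W_def by (rule wide_frequency[OF L(2)])
      moreover have "320 / L\<^sup>2 = 320 * (1 / L\<^sup>2)" "k\<^sup>2 = 400 * (1 / L\<^sup>2)" "1 / L\<^sup>2 > 0"
        using L(2) by (auto simp: k_def power_divide)
      ultimately show ?thesis by linarith
    qed
    show "(0::real) < 1" "1 - 0 < W" using W by auto
    show "u (x, y) \<le> X x * cos (pi / W * (y - (0 + 1) / 2))"
      if x: "x \<in> closure J" "x \<notin> J" "(x, y) \<in> interior \<Omega>" for x y
    proof -
      consider "\<sigma> * (x - x2) = 0" | "\<sigma> * (x - x2) = D" using cl[OF x(1)] x(2) by (force simp: J_def)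
      then show ?thesis
      proof cases
        case 1
        then have "x = x2" using \<sigma> by auto
        then show ?thesis using bd[of y] x(3) by (simp add: X_def W_def)
      next
        case 2
        have xab: "x \<in> {a..b}" using x(3) interior_subset mem_iff by blast
        have le: "u (x, y) \<le> 200 * cos (pi / W * (y - (0 + 1) / 2))"
          using f1_nonneg[OF xab] f2_le_1[OF xab] W by (intro le_cos_strip[OF x(3)]) auto
        then have cos_pos: "0 \<le> cos (pi / W * (y - (0 + 1) / 2))" using pos[OF x(3)] by linarith
        have "k * \<sigma> * (x - x2) = pi / 4" using 2 kD by (simp add: mult.assoc)
        then have "X x = (1 / 8 + 300) * (sqrt 2 / 2)" by (simp only: X_def cos_45 sin_45) simp
        moreover have "4 / 3 \<le> sqrt 2" by (rule real_le_rsqrt) (simp add: power2_eq_square)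
        ultimately have "200 \<le> X x" by simp
        then have "200 * cos (pi / W * (y - (0 + 1) / 2)) \<le> X x * cos (pi / W * (y - (0 + 1) / 2))"
          using cos_pos by (rule mult_right_mono)
        then show ?thesis using le by linarith
      qed
    qed
    show "(x, y) \<in> interior \<Omega>" by (rule p(1))
    show xJ: "x \<in> J" using p(2) D2 L(2) by (simp add: J_def)
  qed
  moreover have "X x < 1 / 2" "0 < X x"
  proof -
    have "k * \<sigma> * (x - x2) = k * (2 * (L / 100000))" by (simp only: mult.assoc p(2))
    also have "\<dots> = 1 / 2500" using L(2) by (simp add: k_def)
    finally have arg: "k * \<sigma> * (x - x2) = 1 / 2500" .
    have "sin (1 / 2500 :: real) \<le> 1 / 2500" by (rule sin_x_le_x) simp
    moreover have "cos (1 / 2500 :: real) \<le> 1" by simp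
    moreover have "0 < cos (1 / 2500 :: real)" by (rule cos_gt_zero_pi) (use pi_ge_two in linarith)+
    moreover have "0 < sin (1 / 2500 :: real)" by (rule sin_gt_zero) (use pi_ge_two in linarith)+
    ultimately show "X x < 1 / 2" "0 < X x" unfolding X_def arg by linarith+
  qed
  moreover have "X x * cos (pi / W * (y - (0 + 1) / 2)) \<le> X x * 1"
    using \<open>0 < X x\<close> by (intro mult_left_mono) auto
  ultimately show ?thesis by linarith
qed

text \<open>The point x1 is halfway between x and x2, and \<open>u\<close> is not small over either
  of them. A short chord at x1 would force a thin strip on one side, and \<open>u\<close> would be
  exponentially small over x or over x2.\<close>

lemma location:
  assumes L: "is_length_scale a b (\<lambda>x. f2 x - f1 x) L" "L \<ge> 4000000" and \<sigma>: "\<sigma> = 1 \<or> \<sigma> = (-1::real)"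
    and p: "(x, y) \<in> \<Omega>" "u (x, y) \<ge> 1 / 2" and x1: "\<sigma> * (x - x1) = L / 100000"
  shows "x1 \<in> {a..b} \<and> f2 x1 - f1 x1 \<ge> 1 - 4 * 10 ^ 12 / L\<^sup>2"
proof (rule ccontr)
  assume no: "\<not> ?thesis"
  have i: "(x, y) \<in> interior \<Omega>"
    using pos_imp_interior[of "(x, y)"] p closure_subset by (metis in_mono less_le_trans zero_less_divide_1_iff zero_less_numeral)
  have L4: "L \<ge> 4" using L(2) by simp
  define x2 where "x2 = x1 - \<sigma> * (L / 100000)"
  define W where "W = 1 + 1 / (50 * L\<^sup>2)"
  have \<sigma>2: "\<sigma> * \<sigma> = 1" using \<sigma> by auto
  have x2: "\<sigma> * (x1 - x2) = L / 100000" "\<sigma> * (x - x2) = 2 * (L / 100000)"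
    using \<sigma>2 x1 by (auto simp: x2_def algebra_simps)
  have xab: "x \<in> {a..b}" using p(1) mem_iff by blast
  have "(4000000::real)\<^sup>2 \<le> L\<^sup>2" using L(2) by (intro power_mono) auto
  then have L2: "16 * 10 ^ 12 \<le> L\<^sup>2" by simp
  have "\<exists>y. (x2, y) \<in> interior \<Omega> \<and> \<not> u (x2, y) \<le> 1 / 8 * cos (pi / W * (y - 1 / 2))"
    using slow_growth[OF L(1) L4 \<sigma> _ i x2(2)] p(2) unfolding W_def by force
  then obtain y' where y': "(x2, y') \<in> interior \<Omega>" "\<not> u (x2, y') \<le> 1 / 8 * cos (pi / W * (y' - 1 / 2))" by blast
  have x2ab: "x2 \<in> {a..b}" using y'(1) interior_subset mem_iff by blast
  have "x1 \<in> {a..b}"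
    using xab x2ab x1 x2(1) L4 \<sigma> by auto
  \<comment> \<open>The threshold L \<ge> 4000000 is what makes s \<le> 1/8.\<close>
  define s where "s = 2 * 10 ^ 12 / L\<^sup>2"
  have s: "s > 0" "s \<le> 1 / 8" "2 / L\<^sup>2 \<le> s" using L2 by (auto simp: s_def divide_le_eq divide_simps)
  have "4 * 10 ^ 12 / L\<^sup>2 = 2 * s" by (simp add: s_def)
  then have "f2 x1 - f1 x1 < 1 - 2 * s" using no \<open>x1 \<in> {a..b}\<close> by simp
  then obtain \<tau> s0 s1 where \<tau>: "\<tau> = 1 \<or> \<tau> = (-1::real)" and s01: "s1 - s0 = 1 - s" "\<bar>(s0 + s1) / 2 - 1 / 2\<bar> = s / 2"
    and strip: "\<And>x. x \<in> {a..b} \<Longrightarrow> 0 \<le> \<tau> * (x - x1) \<Longrightarrow> s0 \<le> f1 x \<and> f2 x \<le> s1"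
    using thin_strip[OF L(1) \<open>x1 \<in> {a..b}\<close> _ s(3)] by metis
  \<comment> \<open>Slightly above the strip width 1 - s, and such that Wn + s = W: the wide profile
    at x2 then dominates the narrow one.\<close>
  define Wn where "Wn = 1 - (s - 1 / (50 * L\<^sup>2))"
  define \<kappa> where "\<kappa> = 2000000 / L"
    \<comment> \<open>chosen such that \<open>8 s\<close> exceeds \<open>\<kappa>\<^sup>2 + 320 / L\<^sup>2\<close> and \<open>\<kappa> (L / 100000) = 20\<close>\<close>
  have e: "0 < 1 / (50 * L\<^sup>2)" "1 / (50 * L\<^sup>2) \<le> s" using L2 by (auto simp: s_def divide_simps)
  have Wn: "s0 < s1" "s1 - s0 < Wn" "Wn \<le> 2" "1 / 2 \<le> Wn" using s s01 e unfolding Wn_def by linarith+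
  have lam: "lam < (pi / Wn)\<^sup>2 - \<kappa>\<^sup>2"
  proof -
    define r where "r = 1 / L\<^sup>2"
    have r: "320 / L\<^sup>2 = 320 * r" "\<kappa>\<^sup>2 = 4000000000000 * r" "r > 0"
      "s = 2000000000000 * r" "1 / (50 * L\<^sup>2) = 1 / 50 * r"
      using L4 by (auto simp: \<kappa>_def s_def power_divide r_def)
    have "lam \<le> pi\<^sup>2 + 320 / L\<^sup>2" by (rule lam_le[OF L(1) L4])
    then have 1: "lam \<le> pi\<^sup>2 + 320 * r" by (simp only: r(1))
    have "pi\<^sup>2 + 8 * (s - 1 / (50 * L\<^sup>2)) \<le> (pi / Wn)\<^sup>2"
      unfolding Wn_def using s e by (intro narrow_frequency) linarith+
    then have "pi\<^sup>2 + 8 * (2000000000000 * r - 1 / 50 * r) \<le> (pi / Wn)\<^sup>2" by (simp only: r(4,5))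
    moreover have "320 * r + 4000000000000 * r < 8 * (2000000000000 * r - 1 / 50 * r)" using r(3) by simp
    ultimately show ?thesis using 1 unfolding r(2) by linarith
  qed
  have decay: "u (x', y') \<le> 200 * (1 / 1000000) * cos (pi / Wn * (y' - (s0 + s1) / 2))"
    "0 \<le> cos (pi / Wn * (y' - (s0 + s1) / 2))"
    if q: "(x', y') \<in> interior \<Omega>" "\<tau> * (x' - x1) = L / 100000" for x' y'
  proof -
    have gt: "0 < \<tau> * (x' - x1)" unfolding q(2) using L4 by simp
    have eq: "- \<kappa> * (\<tau> * (x' - x1)) = - 20" unfolding q(2) using L4 by (simp add: \<kappa>_def)
    have le: "u (x', y') \<le> 200 * exp (- 20) * cos (pi / Wn * (y' - (s0 + s1) / 2))"
      using exponential_decay[where x = x', OF \<tau> strip Wn(1-3) lam q(1) gt] by (simp only: eq)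
    have "0 < 200 * exp (- 20) * cos (pi / Wn * (y' - (s0 + s1) / 2))" using pos[OF q(1)] le by linarith
    then show c: "0 \<le> cos (pi / Wn * (y' - (s0 + s1) / 2))" by (simp add: zero_less_mult_iff)
    have "200 * exp (- 20) * cos (pi / Wn * (y' - (s0 + s1) / 2))
        \<le> 200 * (1 / 1000000) * cos (pi / Wn * (y' - (s0 + s1) / 2))"
      by (intro mult_right_mono mult_left_mono exp_minus_20_le c) auto
    with le show "u (x', y') \<le> 200 * (1 / 1000000) * cos (pi / Wn * (y' - (s0 + s1) / 2))" by linarith
  qed
  show False
  \<comment> \<open>The thin side contains x when \<tau> = \<sigma> and x2 otherwise. In the second
    case 200 / 1000000 times the narrow profile is at most 8 * 200 / 1000000 times the wide one,
    well below 1/8.\<close>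
  proof (cases "\<tau> = \<sigma>")
    case True
    then have "u (x, y) \<le> 200 * (1 / 1000000) * cos (pi / Wn * (y - (s0 + s1) / 2))"
      using decay(1)[OF i] x1 by simp
    moreover have "cos (pi / Wn * (y - (s0 + s1) / 2)) \<le> 1" by simp
    ultimately show False using p(2) by linarith
  next
    case False
    then have q: "\<tau> * (x2 - x1) = L / 100000" using \<tau> \<sigma> x2(1) by auto
    have "(x2, y') \<in> \<Omega>" using y'(1) interior_subset by blast
    then have y'_in: "s0 \<le> y'" "y' \<le> s1" using strip[OF x2ab] q L4 by (auto simp: mem_iff)
    have "\<bar>y' - (s0 + s1) / 2\<bar> \<le> Wn / 2"
      using Wn by (intro order_trans[OF abs_diff_midpoint_le[OF y'_in]]) simp
    moreover have "Wn + s \<le> W" "W \<le> 2" "0 \<le> s" using e s(1,2) unfolding W_def Wn_def by linarith+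
    moreover have "\<bar>(s0 + s1) / 2 - 1 / 2\<bar> \<le> s / 2" using s01(2) by (rule eq_refl)
    ultimately have "cos (pi / Wn * (y' - (s0 + s1) / 2)) \<le> 8 * cos (pi / W * (y' - 1 / 2))"
      using Wn(4) by (intro cos_strip_le_cos_strip[where s = s])
    moreover have "0 \<le> cos (pi / Wn * (y' - (s0 + s1) / 2))" by (rule decay(2)[OF y'(1) q])
    ultimately have "200 * (1 / 1000000) * cos (pi / Wn * (y' - (s0 + s1) / 2)) \<le> 1 / 8 * cos (pi / W * (y' - 1 / 2))"
      by simp
    then show False using decay(1)[OF y'(1) q] y'(2) by linarith
  qed
qed

end

text \<open>Chord slopes of a concave function are monotone, so a slope at distance d from both ends
  is bounded by those of chords reaching to the ends, which have length at least d and height at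
  most w.\<close>

lemma concave_on_Lipschitz_interior:
  fixes f :: "real \<Rightarrow> real"
  assumes f: "concave_on {\<alpha>..\<beta>} f" and w: "\<And>x. x \<in> {\<alpha>..\<beta>} \<Longrightarrow> m \<le> f x \<and> f x \<le> m + w"
    and d: "d > 0" and x: "\<alpha> + d \<le> x" "x \<le> \<beta> - d" and x': "\<alpha> + d \<le> x'" "x' \<le> \<beta> - d"
  shows "\<bar>f x - f x'\<bar> \<le> w / d * \<bar>x - x'\<bar>"
proof -
  have "\<bar>f x - f x'\<bar> \<le> w / d * \<bar>x - x'\<bar>"
    if "x \<le> x'" "\<alpha> + d \<le> x" "x' \<le> \<beta> - d" for x x'
  proof (cases "x = x'")
    case False
    have sub: "concave_on {x..\<beta>} f" "concave_on {\<alpha>..x'} f"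
      using f that d unfolding concave_on_def by (auto intro: convex_on_subset)
    have wpos: "0 \<le> w" using w[of x] that d by auto
    have bd: "w / t * (x' - x) \<le> w / d * (x' - x)" if "d \<le> t" for t
      using that d wpos \<open>x \<le> x'\<close> by (intro mult_right_mono divide_left_mono) auto
    have "(f \<beta> - f x) / (\<beta> - x) * (x' - x) + f x \<le> f x'"
      using that d by (intro concave_onD_Icc'[OF sub(1)]) auto
    moreover have "- (w / (\<beta> - x)) \<le> (f \<beta> - f x) / (\<beta> - x)"
      using w[of \<beta>] w[of x] that d by (subst minus_divide_left, intro divide_right_mono) auto
    then have "- (w / (\<beta> - x)) * (x' - x) \<le> (f \<beta> - f x) / (\<beta> - x) * (x' - x)"
      using that by (intro mult_right_mono) auto
    moreover have "w / (\<beta> - x) * (x' - x) \<le> w / d * (x' - x)" using that by (intro bd) auto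
    ultimately have 1: "f x - f x' \<le> w / d * (x' - x)" by simp
    have "(f \<alpha> - f x') / (x' - \<alpha>) * (x' - x) + f x' \<le> f x"
      using that d by (intro concave_onD_Icc''[OF sub(2)]) auto
    moreover have "- (w / (x' - \<alpha>)) \<le> (f \<alpha> - f x') / (x' - \<alpha>)"
      using w[of \<alpha>] w[of x'] that d by (subst minus_divide_left, intro divide_right_mono) auto
    then have "- (w / (x' - \<alpha>)) * (x' - x) \<le> (f \<alpha> - f x') / (x' - \<alpha>) * (x' - x)"
      using that by (intro mult_right_mono) auto
    moreover have "w / (x' - \<alpha>) * (x' - x) \<le> w / d * (x' - x)" using that by (intro bd) auto
    ultimately have "f x' - f x \<le> w / d * (x' - x)" by simp
    with 1 that show ?thesis by simp
  qed simp
  note * = this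
  show ?thesis
  proof (cases "x \<le> x'")
    case False
    then show ?thesis using *[of x' x] x x' by (simp add: abs_minus_commute)
  qed (use * x x' in blast)
qed

section \<open>Comparison in four variables\<close>

lemma has_D2_cos': "(\<And>t. g t = a + b * t) \<Longrightarrow> has_D2 (\<lambda>t. cos (g t)) (- (b\<^sup>2) * cos a)"
  using has_D2_cos[of a b] by simp

text \<open>The first eigenvalue of a triangle cut from the unit square along its diagonal is
  \<open>5 \<pi>\<^sup>2\<close>. The product below, in the coordinates \<open>y + y'\<close> and \<open>y' - y\<close>, is positive on the closed
  triangle and has eigenvalue \<open>5 / 2 (99 / 100)\<^sup>2 \<pi>\<^sup>2\<close>, still larger than \<open>2 \<lambda>\<close>.\<close>

definition tri :: "real \<Rightarrow> real \<Rightarrow> real" where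
  "tri y y' = cos (pi / (200 / 99) * (y + y' - 1)) * cos (pi / (100 / 99) * (y' - y - 1 / 2))"

text \<open>The cosine widths exceed the ranges of y + y' and y' - y by the factor 100 / 99, so the
  tent bound leaves 1/100 for each factor.\<close>

lemma tri_bounds:
  assumes "0 \<le> y" "y \<le> y'" "y' \<le> 1"
  shows "1 / 10000 \<le> tri y y'" "tri y y' \<le> 1"
proof -
  have z: "\<bar>y + y' - 1\<bar> \<le> 1" "\<bar>y' - y - 1 / 2\<bar> \<le> 1 / 2" using assms unfolding abs_le_iff by linarith+
  have 1: "1 / 100 \<le> cos (pi / (200 / 99) * (y + y' - 1))"
    using cos_ge_tent[of "200 / 99" "y + y' - 1"] z by simp
  have 2: "1 / 100 \<le> cos (pi / (100 / 99) * (y' - y - 1 / 2))"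
    using cos_ge_tent[of "100 / 99" "y' - y - 1 / 2"] z by simp
  have "(1 / 100) * (1 / 100) \<le> tri y y'" unfolding tri_def using 1 2 by (intro mult_mono) auto
  then show "1 / 10000 \<le> tri y y'" by simp
  have "tri y y' \<le> 1 * 1" unfolding tri_def using 1 2 by (intro mult_mono) auto
  then show "tri y y' \<le> 1" by simp
qed

text \<open>The product separates in rotated coordinates, while derivatives are needed along y and
  y'. The product-to-sum formula gives cosines of linear forms, and (\<alpha> - \<beta>)^2 +
  (\<alpha> + \<beta>)^2 has no mixed term.\<close>

lemma has_D2_tri:
  "\<exists>e1 e2. has_D2 (\<lambda>t. tri (y + t) y') e1 \<and> has_D2 (\<lambda>t. tri y (y' + t)) e2 \<and>
     e1 + e2 = - (2 * ((pi / (200 / 99))\<^sup>2 + (pi / (100 / 99))\<^sup>2)) * tri y y'"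
proof -
  define \<alpha> where "\<alpha> = pi / (200 / 99)"
  define \<beta> where "\<beta> = pi / (100 / 99)"
  define A where "A = (\<lambda>y y'. \<alpha> * (y + y' - 1) + \<beta> * (y' - y - 1 / 2))"
  define B where "B = (\<lambda>y y'. \<alpha> * (y + y' - 1) - \<beta> * (y' - y - 1 / 2))"
  have tri: "tri y y' = 1 / 2 * cos (A y y') + 1 / 2 * cos (B y y')" for y y'
    unfolding tri_def \<alpha>_def[symmetric] \<beta>_def[symmetric] A_def B_def
    by (simp only: cos_add cos_diff) (simp add: algebra_simps)
  have 1: "has_D2 (\<lambda>t. tri (y + t) y') (1 / 2 * (- ((\<alpha> - \<beta>)\<^sup>2) * cos (A y y')) + 1 / 2 * (- ((\<alpha> + \<beta>)\<^sup>2) * cos (B y y')))"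
    unfolding tri by (intro has_D2_add has_D2_cmult has_D2_cos') (simp_all add: A_def B_def algebra_simps)
  have 2: "has_D2 (\<lambda>t. tri y (y' + t)) (1 / 2 * (- ((\<alpha> + \<beta>)\<^sup>2) * cos (A y y')) + 1 / 2 * (- ((\<alpha> - \<beta>)\<^sup>2) * cos (B y y')))"
    unfolding tri by (intro has_D2_add has_D2_cmult has_D2_cos') (simp_all add: A_def B_def algebra_simps)
  show ?thesis
    unfolding \<alpha>_def[symmetric] \<beta>_def[symmetric]
    by (intro exI conjI, rule 1, rule 2) (simp add: tri power2_eq_square algebra_simps)
qed

text \<open>With a sum of two \<open>cosh\<close> terms, each x-derivative reproduces only its own
  summand, so the weight costs 1 in total.\<close>

lemma has_D2_cross_barrier:
  fixes P :: "(real \<times> real) \<times> (real \<times> real)" and C x0 :: real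
  defines "\<Phi> \<equiv> \<lambda>P. C * (cosh (fst (fst P) - x0) + cosh (fst (snd P) - x0)) * tri (snd (fst P)) (snd (snd P))"
  shows "\<exists>e. (\<forall>k\<in>Basis. has_D2 (\<lambda>t. \<Phi> (P + t *\<^sub>R k)) (e k)) \<and>
    (\<Sum>k\<in>Basis. e k) = (1 - 2 * ((pi / (200 / 99))\<^sup>2 + (pi / (100 / 99))\<^sup>2)) * \<Phi> P"
proof -
  obtain x y x' y' where P: "P = ((x, y), (x', y'))" by (metis surj_pair)
  obtain e1 e2 where e: "has_D2 (\<lambda>t. tri (y + t) y') e1" "has_D2 (\<lambda>t. tri y (y' + t)) e2"
     "e1 + e2 = - (2 * ((pi / (200 / 99))\<^sup>2 + (pi / (100 / 99))\<^sup>2)) * tri y y'"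
    using has_D2_tri by blast
  define H where "H = C * (cosh (x - x0) + cosh (x' - x0))"
  define e :: "(real \<times> real) \<times> (real \<times> real) \<Rightarrow> real" where "e = (\<lambda>k. if k = ((1, 0), (0, 0)) then C * cosh (x - x0) * tri y y'
      else if k = ((0, 0), (1, 0)) then C * cosh (x' - x0) * tri y y'
      else if k = ((0, 1), (0, 0)) then H * e1 else H * e2)"
  have D: "has_D2 (\<lambda>t. cosh (z + t - x0)) (cosh (z - x0))" for z
    using has_D2_shifted(4)[of 1 z x0] by simp
  have x: "has_D2 (\<lambda>t. C * (cosh (x + t - x0) + cosh (x' - x0)) * tri y y') (C * cosh (x - x0) * tri y y')"
    using has_D2_cmult_right[OF has_D2_cmult[OF has_D2_add[OF D[of x] has_D2_const[of "cosh (x' - x0)"]], of C], of "tri y y'"]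
    by simp
  have x': "has_D2 (\<lambda>t. C * (cosh (x - x0) + cosh (x' + t - x0)) * tri y y') (C * cosh (x' - x0) * tri y y')"
    using has_D2_cmult_right[OF has_D2_cmult[OF has_D2_add[OF has_D2_const[of "cosh (x - x0)"] D[of x']], of C], of "tri y y'"]
    by simp
  have y: "has_D2 (\<lambda>t. C * (cosh (x - x0) + cosh (x' - x0)) * tri (y + t) y') (H * e1)"
    unfolding H_def by (rule has_D2_cmult[OF e(1)])
  have y': "has_D2 (\<lambda>t. C * (cosh (x - x0) + cosh (x' - x0)) * tri y (y' + t)) (H * e2)"
    unfolding H_def by (rule has_D2_cmult[OF e(2)])
  have "has_D2 (\<lambda>t. \<Phi> (P + t *\<^sub>R k)) (e k)" if "k \<in> Basis" for k
    using that x x' y y' unfolding Basis_real4 by (auto simp: e_def P \<Phi>_def)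
  moreover have "(\<Sum>k\<in>Basis. e k) = H * tri y y' + H * (e1 + e2)"
    unfolding sum_Basis_real4 by (simp add: e_def H_def algebra_simps)
  then have "(\<Sum>k\<in>Basis. e k) = (1 - 2 * ((pi / (200 / 99))\<^sup>2 + (pi / (100 / 99))\<^sup>2)) * \<Phi> P"
    unfolding e(3) by (simp add: \<Phi>_def P H_def algebra_simps)
  ultimately show ?thesis by blast
qed

text \<open>The linear bound absorbs |x - x'| on the lateral faces. The cubic one turns the factor
  L^(-3) into a constant at distance proportional to \<open>L\<close>.\<close>

lemma cosh_ge:
  fixes t :: real
  shows "\<bar>t\<bar> \<le> cosh t" "0 \<le> t \<Longrightarrow> t ^ 3 / 54 \<le> cosh t" "cosh t \<ge> 1"
proof -
  have half: "exp s / 2 \<le> cosh s" for s :: real by (simp add: cosh_def)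
  have "(1 + \<bar>t\<bar> / 2)\<^sup>2 \<le> exp (\<bar>t\<bar> / 2) ^ 2" by (intro power_mono exp_ge_add_one_self) auto
  also have "\<dots> = exp \<bar>t\<bar>" by (simp add: exp_double[symmetric])
  finally have "(1 + \<bar>t\<bar> / 2)\<^sup>2 / 2 \<le> cosh \<bar>t\<bar>" using half[of "\<bar>t\<bar>"] by linarith
  moreover have "\<bar>t\<bar> \<le> (1 + \<bar>t\<bar> / 2)\<^sup>2 / 2"
    using zero_le_power2[of "1 - \<bar>t\<bar> / 2"] by (simp add: power2_eq_square algebra_simps)
  ultimately show "\<bar>t\<bar> \<le> cosh t" by simp
  show "t ^ 3 / 54 \<le> cosh t" if "0 \<le> t"
  proof -
    have "(t / 3) ^ 3 \<le> exp (t / 3) ^ 3"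
      using that exp_ge_add_one_self[of "t / 3"] by (intro power_mono) linarith+
    also have "\<dots> = exp t" using exp_of_nat_mult[of 3 "t / 3"] by simp
    finally show ?thesis using half[of t] by (simp add: power_divide)
  qed
  show "cosh t \<ge> 1" by (rule cosh_real_ge_1)
qed

text \<open>On a lateral face one grid point lies on the frontier. Its product vanishes, and the
  other product is at most either of its factors.\<close>

lemma cross_le_one_factor:
  fixes A B C D :: real
  assumes "A * B = 0" "0 \<le> C" "C \<le> 1" "0 \<le> D" "D \<le> 1" "\<bar>\<sigma>\<bar> = 1"
  shows "\<sigma> * (A * B - C * D) \<le> C" "\<sigma> * (A * B - C * D) \<le> D" "\<sigma> * (C * D - A * B) \<le> C" "\<sigma> * (C * D - A * B) \<le> D"
proof -
  have "C * D \<le> C" "C * D \<le> D" "0 \<le> C * D"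
    using assms by (simp_all add: mult_right_le_one_le mult_left_le_one_le)
  moreover have "\<sigma> * (A * B - C * D) \<le> C * D" "\<sigma> * (C * D - A * B) \<le> C * D"
  proof -
    have "\<sigma> = 1 \<or> \<sigma> = -1" using assms(6) by auto
    then show "\<sigma> * (A * B - C * D) \<le> C * D" "\<sigma> * (C * D - A * B) \<le> C * D"
      using \<open>0 \<le> C * D\<close> unfolding assms(1) by fastforce+
  qed
  ultimately show "\<sigma> * (A * B - C * D) \<le> C" "\<sigma> * (A * B - C * D) \<le> D"
    "\<sigma> * (C * D - A * B) \<le> C" "\<sigma> * (C * D - A * B) \<le> D"
    by linarith+
qed

section \<open>Slopes of the boundary curves and the bound for \<open>cross u\<close>\<close>

context ground_state
begin

text \<open>\<open>location\<close> on both sides makes the curves oscillate by at most w =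
  O(L^(-2)) over [x0 - 2 d, x0 + 2 d]. Convexity turns this into the slope w / d = 8 * 10^17 / L^3
  on the inner half.\<close>

lemma slope_bound:
  assumes L: "is_length_scale a b (\<lambda>x. f2 x - f1 x) L" "L \<ge> 4000000"
    and p: "(x0, y0) \<in> \<Omega>" "u (x0, y0) \<ge> 1 / 2"
  defines "d \<equiv> L / 200000"
  shows "a \<le> x0 - 2 * d" "x0 + 2 * d \<le> b"
    and "\<And>x x'. \<bar>x - x0\<bar> \<le> d \<Longrightarrow> \<bar>x' - x0\<bar> \<le> d \<Longrightarrow>
      \<bar>f1 x - f1 x'\<bar> \<le> 8 * 10 ^ 17 / L ^ 3 * \<bar>x - x'\<bar>"
    and "\<And>x x'. \<bar>x - x0\<bar> \<le> d \<Longrightarrow> \<bar>x' - x0\<bar> \<le> d \<Longrightarrow>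
      \<bar>f2 x - f2 x'\<bar> \<le> 8 * 10 ^ 17 / L ^ 3 * \<bar>x - x'\<bar>"
proof -
  define w where "w = 4 * 10 ^ 12 / L\<^sup>2"
  define \<alpha> where "\<alpha> = x0 - 2 * d"
  define \<beta> where "\<beta> = x0 + 2 * d"
  have d: "d > 0" using L(2) by (simp add: d_def)
  have \<alpha>: "\<alpha> \<in> {a..b}" "f2 \<alpha> - f1 \<alpha> \<ge> 1 - w"
    using location[OF L, of 1 x0 y0 \<alpha>] p by (auto simp: \<alpha>_def d_def w_def)
  have \<beta>: "\<beta> \<in> {a..b}" "f2 \<beta> - f1 \<beta> \<ge> 1 - w"
    using location[OF L, of "-1" x0 y0 \<beta>] p by (auto simp: \<beta>_def d_def w_def)
  show "a \<le> x0 - 2 * d" "x0 + 2 * d \<le> b" using \<alpha> \<beta> by (auto simp: \<alpha>_def \<beta>_def)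
  have le: "\<alpha> \<le> \<beta>" using d by (simp add: \<alpha>_def \<beta>_def)
  have sub: "{\<alpha>..\<beta>} \<subseteq> {a..b}" using \<alpha> \<beta> by auto
  have ends: "f1 \<alpha> \<le> w" "1 - w \<le> f2 \<alpha>" "f1 \<beta> \<le> w" "1 - w \<le> f2 \<beta>"
    using \<alpha> \<beta> f1_nonneg[OF \<alpha>(1)] f1_nonneg[OF \<beta>(1)] f2_le_1[OF \<alpha>(1)] f2_le_1[OF \<beta>(1)] by linarith+
  have mid: "f1 x \<le> w \<and> 1 - w \<le> f2 x" if x: "x \<in> {\<alpha>..\<beta>}" for x
  proof -
    obtain t where t: "0 \<le> t" "t \<le> 1" "x = (1 - t) *\<^sub>R \<alpha> + t *\<^sub>R \<beta>"
      using x unfolding closed_segment_eq_real_ivl1[OF le, symmetric] in_segment by blast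
    have "f1 x \<le> (1 - t) * f1 \<alpha> + t * f1 \<beta>"
      unfolding t(3) using t \<alpha> \<beta> by (intro convex_onD[OF f1_convex])
    also have "\<dots> \<le> (1 - t) * w + t * w" using t ends by (intro add_mono mult_left_mono) auto
    finally have 1: "f1 x \<le> w" by (simp add: algebra_simps)
    have "(1 - t) * (1 - w) + t * (1 - w) \<le> (1 - t) * f2 \<alpha> + t * f2 \<beta>"
      using t ends by (intro add_mono mult_left_mono) auto
    also have "\<dots> \<le> f2 x" unfolding t(3) using t \<alpha> \<beta> by (intro concave_onD[OF f2_concave])
    finally show ?thesis using 1 by (simp add: algebra_simps)
  qed
  have wd: "w / d = 8 * 10 ^ 17 / L ^ 3"
    using L(2) by (simp add: w_def d_def field_simps power2_eq_square power3_eq_cube)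
  have in_ab: "x \<in> {a..b}" if "x \<in> {\<alpha>..\<beta>}" for x using sub that by blast
  show "\<bar>f2 x - f2 x'\<bar> \<le> 8 * 10 ^ 17 / L ^ 3 * \<bar>x - x'\<bar>" if "\<bar>x - x0\<bar> \<le> d" "\<bar>x' - x0\<bar> \<le> d" for x x'
    unfolding wd[symmetric]
  proof (rule concave_on_Lipschitz_interior)
    show "concave_on {\<alpha>..\<beta>} f2"
      using f2_concave sub unfolding concave_on_def by (rule convex_on_subset) simp
    show "1 - w \<le> f2 x \<and> f2 x \<le> 1 - w + w" if "x \<in> {\<alpha>..\<beta>}" for x
      using mid[OF that] f2_le_1[OF in_ab[OF that]] by simp
  qed (use that d in \<open>auto simp: \<alpha>_def \<beta>_def\<close>)
  have "\<bar>- f1 x - - f1 x'\<bar> \<le> 8 * 10 ^ 17 / L ^ 3 * \<bar>x - x'\<bar>" if "\<bar>x - x0\<bar> \<le> d" "\<bar>x' - x0\<bar> \<le> d" for x x'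
    unfolding wd[symmetric]
  proof (rule concave_on_Lipschitz_interior)
    show "concave_on {\<alpha>..\<beta>} (\<lambda>x. - f1 x)"
      unfolding concave_on_def minus_minus using f1_convex sub by (rule convex_on_subset) simp
    show "- w \<le> - f1 x \<and> - f1 x \<le> - w + w" if "x \<in> {\<alpha>..\<beta>}" for x
      using mid[OF that] f1_nonneg[OF in_ab[OF that]] by simp
  qed (use that d in \<open>auto simp: \<alpha>_def \<beta>_def\<close>)
  then show "\<bar>f1 x - f1 x'\<bar> \<le> 8 * 10 ^ 17 / L ^ 3 * \<bar>x - x'\<bar>" if "\<bar>x - x0\<bar> \<le> d" "\<bar>x' - x0\<bar> \<le> d" for x x'
    using that by (simp add: abs_minus_commute)
qed

text \<open>The comparison runs over the grids whose four points all lie in \<Omega>, with x and x'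
  within d of x0 and y \<le> y'. The weights \<open>cosh\<close> stay bounded near x0 and reach size
  L^3 on the cuts.\<close>

lemma cross_bound:
  assumes L: "is_length_scale a b (\<lambda>x. f2 x - f1 x) L" "L \<ge> 4000000"
    and p: "(x0, y0) \<in> \<Omega>" "u (x0, y0) \<ge> 1 / 2"
    and P: "((x, y), (x', y')) \<in> cross_dom \<Omega>" "y \<le> y'" and x: "\<bar>x - x0\<bar> \<le> L / 200000" "\<bar>x' - x0\<bar> \<le> L / 200000"
  shows "\<bar>cross u ((x, y), (x', y'))\<bar> \<le> 10 ^ 25 / L ^ 3 * (cosh (x - x0) + cosh (x' - x0))"
proof -
  define d where "d = L / 200000"
  define N where "N = 8 * 10 ^ 17 / L ^ 3"
  \<comment> \<open>C must satisfy 200 N \<le> C / 10000 on the lateral faces and C d^3 / 540000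
    \<ge> 1 on the cuts, where 1/10000 is the lower bound for \<open>tri\<close>.\<close>
  define C where "C = 10 ^ 25 / L ^ 3"
  note sl = slope_bound[OF L p, folded d_def N_def]
  have d: "d > 0" using L(2) by (simp add: d_def)
  have N: "N > 0" using L(2) by (simp add: N_def)
  have C: "C > 0" using L(2) by (simp add: C_def)
  define I where "I = {x0 - d..x0 + d}"
  have Iab: "z \<in> {a..b}" if "z \<in> I" for z using that sl(1,2) d by (auto simp: I_def)
  have I_iff: "z \<in> I \<longleftrightarrow> \<bar>z - x0\<bar> \<le> d" for z by (auto simp: I_def abs_le_iff)
  \<comment> \<open>The curves may jump at a and b; away from the ends the slope bound supplies the
    continuity that makes \<open>K\<close> compact and \<open>\<Omega>'\<close> open.\<close>
  have "N-lipschitz_on I f1" "N-lipschitz_on I f2"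
    using sl(3,4) N by (auto intro!: lipschitz_onI simp: I_iff dist_real_def)
  then have cf: "continuous_on I f1" "continuous_on I f2" by (auto intro: lipschitz_on_continuous_on)
  define Box where "Box = ((I \<times> {0..1::real}) \<times> (I \<times> {0..1::real}))"
  define K where "K = Box \<inter> {P. f1 (fst (fst P)) \<le> snd (fst P) \<and> f1 (fst (snd P)) \<le> snd (fst P) \<and>
      snd (fst P) \<le> snd (snd P) \<and> snd (snd P) \<le> f2 (fst (fst P)) \<and> snd (snd P) \<le> f2 (fst (snd P))}"
  have "compact Box" unfolding Box_def I_def by (intro compact_Times) auto
  have cb: "continuous_on Box (\<lambda>P. f1 (fst (fst P)))" "continuous_on Box (\<lambda>P. f1 (fst (snd P)))"
    "continuous_on Box (\<lambda>P. f2 (fst (fst P)))" "continuous_on Box (\<lambda>P. f2 (fst (snd P)))"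
    by (intro continuous_on_compose2[OF cf(1)] continuous_on_compose2[OF cf(2)] continuous_intros; force simp: Box_def)+
  have K: "compact K"
  proof -
    have cBox: "closed Box" using \<open>compact Box\<close> by (rule compact_imp_closed)
    have le: "closed {P \<in> Box. g P \<le> h P}" if "continuous_on Box g" "continuous_on Box h" for g h :: "_ \<Rightarrow> real"
      by (rule continuous_on_closed_Collect_le[OF that cBox])
    have "K = {P \<in> Box. f1 (fst (fst P)) \<le> snd (fst P)} \<inter> {P \<in> Box. f1 (fst (snd P)) \<le> snd (fst P)} \<inter>
      {P \<in> Box. snd (fst P) \<le> snd (snd P)} \<inter> {P \<in> Box. snd (snd P) \<le> f2 (fst (fst P))} \<inter>
      {P \<in> Box. snd (snd P) \<le> f2 (fst (snd P))}" by (auto simp: K_def)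
    moreover have "closed \<dots>" by (intro closed_Int le cb continuous_intros)
    ultimately have "closed K" by simp
    then show ?thesis using compact_Int_closed[OF \<open>compact Box\<close> \<open>closed K\<close>]
      by (simp add: K_def Int_assoc[symmetric])
  qed
  have K_dom: "P \<in> cross_dom \<Omega>" if "P \<in> K" for P
    using that Iab by (cases P) (force simp: K_def Box_def cross_dom_def mem_iff)
  have cl: "\<Omega> \<subseteq> closure \<Omega>" by (rule closure_subset)
  have cu: "continuous_on \<Omega> u" using cont cl by (rule continuous_on_subset)
  have ccross: "continuous_on K (cross u)"
    unfolding cross_def
    by (intro continuous_intros continuous_on_compose2[OF cu]) (use K_dom in \<open>auto simp: cross_dom_def\<close>)
  define J where "J = {x0 - d<..<x0 + d}"
  have JI: "J \<subseteq> I" by (auto simp: J_def I_def)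
  define \<Omega>' where "\<Omega>' = {q. fst q \<in> J \<and> f1 (fst q) < snd q \<and> snd q < f2 (fst q)}"
  have cJ: "continuous_on J f1" "continuous_on J f2" using cf JI by (auto intro: continuous_on_subset)
  have "open J" by (simp add: J_def)
  have "open \<Omega>'"
  proof -
    have o: "open (J \<times> (UNIV :: real set))" using \<open>open J\<close> by (intro open_Times) auto
    have lt: "open {q \<in> J \<times> UNIV. g q < h q}" if "continuous_on (J \<times> UNIV) g" "continuous_on (J \<times> UNIV) h"
      for g h :: "real \<times> real \<Rightarrow> real"
    proof -
      have "open ((J \<times> UNIV) \<inter> (\<lambda>q. h q - g q) -` {0<..})"
        using that by (intro continuous_open_preimage[OF _ o] continuous_intros) auto
      moreover have "(J \<times> UNIV) \<inter> (\<lambda>q. h q - g q) -` {0<..} = {q \<in> J \<times> UNIV. g q < h q}" by auto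
      ultimately show ?thesis by simp
    qed
    have "\<Omega>' = {q \<in> J \<times> UNIV. f1 (fst q) < snd q} \<inter> {q \<in> J \<times> UNIV. snd q < f2 (fst q)}"
      by (auto simp: \<Omega>'_def)
    moreover have "open \<dots>"
      by (intro open_Int lt continuous_intros continuous_on_compose2[OF cJ(1)] continuous_on_compose2[OF cJ(2)]; force)
    ultimately show ?thesis by simp
  qed
  moreover have "\<Omega>' \<subseteq> \<Omega>"
  proof
    fix q assume "q \<in> \<Omega>'"
    then show "q \<in> \<Omega>" using Iab[of "fst q"] JI by (cases q) (auto simp: \<Omega>'_def mem_iff)
  qed
  ultimately have int: "\<Omega>' \<subseteq> interior \<Omega>" by (intro interior_maximal)
  define V where "V = cross_dom \<Omega>' \<inter> {P. snd (fst P) < snd (snd P)}"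
  have V: "open V" unfolding V_def
    by (intro open_Int open_cross_dom \<open>open \<Omega>'\<close> open_Collect_less continuous_intros)
  have VK: "V \<subseteq> K"
  proof
    fix P assume P: "P \<in> V"
    then have J: "fst (fst P) \<in> J" "fst (snd P) \<in> J" by (auto simp: V_def cross_dom_def \<Omega>'_def)
    then have ab: "fst (fst P) \<in> I" "fst (snd P) \<in> I" using JI by auto
    have "0 \<le> snd (fst P)" "snd (snd P) \<le> 1" "snd (fst P) \<le> snd (snd P)"
      using P f1_nonneg[OF Iab[OF ab(1)]] f2_le_1[OF Iab[OF ab(1)]]
      by (auto simp: V_def cross_dom_def \<Omega>'_def)
    then show "P \<in> K" using P ab by (cases P) (auto simp: K_def Box_def V_def cross_dom_def \<Omega>'_def)
  qed
  define \<Phi> where "\<Phi> = (\<lambda>P. C * (cosh (fst (fst P) - x0) + cosh (fst (snd P) - x0)) * tri (snd (fst P)) (snd (snd P)))"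
  have tri_K: "1 / 10000 \<le> tri (snd (fst P)) (snd (snd P))" if "P \<in> K" for P
    using that by (intro tri_bounds) (auto simp: K_def Box_def)
  have \<Phi>_ge: "C / 10000 * (cosh (fst (fst P) - x0) + cosh (fst (snd P) - x0)) \<le> \<Phi> P" if "P \<in> K" for P
  proof -
    have "C * (cosh (fst (fst P) - x0) + cosh (fst (snd P) - x0)) * (1 / 10000) \<le> \<Phi> P"
      unfolding \<Phi>_def using C by (intro mult_left_mono tri_K[OF that] mult_nonneg_nonneg add_nonneg_nonneg) auto
    then show ?thesis by (simp add: algebra_simps)
  qed
  have \<Phi>_pos: "0 < \<Phi> P" if "P \<in> K" for P
  proof -
    have "0 < C / 10000 * (cosh (fst (fst P) - x0) + cosh (fst (snd P) - x0))"
      using C by (intro mult_pos_pos add_pos_pos) auto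
    then show ?thesis using \<Phi>_ge[OF that] by linarith
  qed
  \<comment> \<open>The gap: about 0.45 pi^2 remains after subtracting 2 pi^2, which exceeds the
    cost 1 of the weight plus twice the excess of lam.\<close>
  have lam2: "(1 - 2 * ((pi / (200 / 99))\<^sup>2 + (pi / (100 / 99))\<^sup>2)) < - (2 * lam)"
  proof -
    have "lam \<le> pi\<^sup>2 + 320 / L\<^sup>2" using L by (intro lam_le) auto
    moreover have "320 / L\<^sup>2 \<le> 1 / 100"
    proof -
      have "(4000000::real)\<^sup>2 \<le> L\<^sup>2" using L(2) by (intro power_mono) auto
      then show ?thesis using L(2) by (simp add: divide_le_eq)
    qed
    moreover have "2\<^sup>2 \<le> pi\<^sup>2" using pi_ge_two by (intro power_mono) auto
    moreover have "(pi / (200 / 99))\<^sup>2 = 9801 / 40000 * pi\<^sup>2" "(pi / (100 / 99))\<^sup>2 = 9801 / 10000 * pi\<^sup>2"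
      by (simp_all add: power2_eq_square)
    ultimately show ?thesis by simp
  qed
  have main: "\<sigma> * cross u P \<le> \<Phi> P" if \<sigma>: "\<bar>\<sigma>\<bar> = 1" and P: "P \<in> K" for \<sigma> P
  proof (rule helm_comparison[where K = K and V = V and lam = "2 * lam", OF K])
    show "continuous_on K (\<lambda>P. \<sigma> * cross u P)" by (intro continuous_intros ccross)
    show "continuous_on K \<Phi>" unfolding \<Phi>_def tri_def by (intro continuous_intros)
    show "open V" "V \<subseteq> K" by fact+
    show "helm V (2 * lam) (\<lambda>P. \<sigma> * cross u P)"
    proof -
      have h: "helm V (2 * lam) (cross u)"
        by (rule helm_subset[OF helm_cross[OF open_interior helm]]) (use int in \<open>auto simp: V_def cross_dom_def\<close>)
      show ?thesis using helm_cmult_add(1)[OF V h h, where a = \<sigma> and b = 0] by simp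
    qed
    show "\<exists>e. (\<forall>k\<in>Basis. has_D2 (\<lambda>t. \<Phi> (P + t *\<^sub>R k)) (e k)) \<and> sum e Basis < - (2 * lam) * \<Phi> P"
      if P: "P \<in> V" for P
    proof -
      obtain e where e: "\<forall>k\<in>Basis. has_D2 (\<lambda>t. \<Phi> (P + t *\<^sub>R k)) (e k)"
        "sum e Basis = (1 - 2 * ((pi / (200 / 99))\<^sup>2 + (pi / (100 / 99))\<^sup>2)) * \<Phi> P"
        using has_D2_cross_barrier[where C = C and ?x0.0 = x0 and P = P] unfolding \<Phi>_def by blast
      moreover have "(1 - 2 * ((pi / (200 / 99))\<^sup>2 + (pi / (100 / 99))\<^sup>2)) * \<Phi> P < - (2 * lam) * \<Phi> P"
        using P VK by (intro mult_strict_right_mono lam2 \<Phi>_pos) auto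
      ultimately show ?thesis by auto
    qed
    show "\<sigma> * cross u P \<le> \<Phi> P" if P: "P \<in> K" "P \<notin> V" for P
    proof -
      obtain x y x' y' where Pe: "P = ((x, y), (x', y'))" by (metis surj_pair)
      have dom: "(x, y) \<in> \<Omega>" "(x', y') \<in> \<Omega>" "(x, y') \<in> \<Omega>" "(x', y) \<in> \<Omega>"
        using K_dom[OF P(1)] by (auto simp: Pe cross_dom_def)
      have u01: "0 \<le> u q" "u q \<le> 1" if "q \<in> \<Omega>" for q using nonneg[OF subsetD[OF cl that]] le1[OF subsetD[OF cl that]] by auto
      have I: "\<bar>x - x0\<bar> \<le> d" "\<bar>x' - x0\<bar> \<le> d" using P(1) by (auto simp: K_def Box_def Pe I_iff[symmetric])
      have cr: "cross u P = u (x, y) * u (x', y') - u (x, y') * u (x', y)" by (simp add: cross_def Pe)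
      have ge: "C / 10000 * (cosh (x - x0) + cosh (x' - x0)) \<le> \<Phi> P" using \<Phi>_ge[OF P(1)] by (simp add: Pe)
      have lateral: "200 * (N * \<bar>x - x'\<bar>) \<le> \<Phi> P"
      proof -
        have "200 * N \<le> C / 10000" using L(2) by (simp add: N_def C_def divide_simps)
        moreover have "\<bar>x - x'\<bar> \<le> cosh (x - x0) + cosh (x' - x0)"
          using cosh_ge(1)[of "x - x0"] cosh_ge(1)[of "x' - x0"] by linarith
        ultimately have "200 * N * \<bar>x - x'\<bar> \<le> C / 10000 * (cosh (x - x0) + cosh (x' - x0))"
          using C by (intro mult_mono) auto
        then show ?thesis using ge by simp
      qed
      have far: "1 \<le> \<Phi> P" if "\<bar>x - x0\<bar> = d \<or> \<bar>x' - x0\<bar> = d"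
      proof -
        have "d ^ 3 / 54 \<le> cosh d" by (rule cosh_ge(2)) (use d in simp)
        also have "\<dots> \<le> cosh (x - x0) + cosh (x' - x0)"
          using that cosh_ge(3)[of "x - x0"] cosh_ge(3)[of "x' - x0"] cosh_real_abs[of "x - x0"] cosh_real_abs[of "x' - x0"] by auto
        finally have "C / 10000 * (d ^ 3 / 54) \<le> C / 10000 * (cosh (x - x0) + cosh (x' - x0))"
          using C by (intro mult_left_mono) auto
        moreover have "1 \<le> C / 10000 * (d ^ 3 / 54)" using L(2) by (simp add: C_def d_def power_divide)
        ultimately show ?thesis using ge by linarith
      qed
      have f1d: "f1 z - f1 z' \<le> N * \<bar>x - x'\<bar>" "f2 z - f2 z' \<le> N * \<bar>x - x'\<bar>"
        if "z \<in> {x, x'}" "z' \<in> {x, x'}" for z z'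
        using sl(3)[OF I] sl(4)[OF I] N that by auto
      have vanish: "u (z, w) = 0" if "(z, w) \<in> \<Omega>" "w = f1 z \<or> w = f2 z" for z w
        using le_vertical[OF that(1)] u01[OF that(1)] that(2) by auto
      have ge1: "\<sigma> * cross u P \<le> 1"
      proof -
        have "u (x, y) * u (x', y') \<le> 1" "u (x, y') * u (x', y) \<le> 1"
          using u01 dom by (auto intro!: mult_le_one)
        moreover have "0 \<le> u (x, y) * u (x', y')" "0 \<le> u (x, y') * u (x', y)"
          using u01 dom by auto
        ultimately show ?thesis using \<sigma> unfolding cr by (cases "\<sigma> = 1") (auto simp: abs_if split: if_splits)
      qed
      \<comment> \<open>The faces of \<open>K\<close>: the cuts, the diagonal y = y', and the faces
        where a lower or an upper grid point meets its boundary curve.\<close>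
      consider "\<bar>x - x0\<bar> = d \<or> \<bar>x' - x0\<bar> = d" | "y = y'" | "y = f1 x" | "y = f1 x'" | "y' = f2 x" | "y' = f2 x'"
      proof -
        have "P \<in> V" if "\<bar>x - x0\<bar> \<noteq> d" "\<bar>x' - x0\<bar> \<noteq> d" "y \<noteq> y'" "y \<noteq> f1 x" "y \<noteq> f1 x'" "y' \<noteq> f2 x" "y' \<noteq> f2 x'"
        proof -
          have J: "x \<in> J" "x' \<in> J" using I that by (auto simp: J_def abs_if split: if_splits)
          have "f1 x < y" "f1 x' < y" "y < y'" "y' < f2 x" "y' < f2 x'" using P(1) that by (auto simp: K_def Pe)
          then show ?thesis using J by (auto simp: V_def cross_dom_def \<Omega>'_def Pe)
        qed
        then show ?thesis using P(2) that by blast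
      qed
      then show ?thesis
      proof cases
        case 1 then show ?thesis using far ge1 by linarith
      next
        case 2 then show ?thesis using \<Phi>_pos[OF P(1)] by (simp add: cr)
      next
        case 3
        \<comment> \<open>The remaining factor sits at the same height over the other abscissa, so
          its distance to the curve is the variation of f1 between x and x'. The other three lateral
          faces are alike.\<close>
        have "\<sigma> * cross u P \<le> u (x', y)" unfolding cr
          using vanish[OF dom(1)] 3 u01 dom \<sigma> by (intro cross_le_one_factor) auto
        also have "\<dots> \<le> 200 * (f1 x - f1 x')" using le_vertical(2)[OF dom(4)] 3 by simp
        also have "\<dots> \<le> 200 * (N * \<bar>x - x'\<bar>)" using f1d(1)[of x x'] by simp
        finally show ?thesis using lateral by linarith
      next
        case 4
        have "\<sigma> * cross u P \<le> u (x, y)" unfolding cr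
          using vanish[OF dom(4)] 4 u01 dom \<sigma> by (intro cross_le_one_factor) auto
        also have "\<dots> \<le> 200 * (f1 x' - f1 x)" using le_vertical(2)[OF dom(1)] 4 by simp
        also have "\<dots> \<le> 200 * (N * \<bar>x - x'\<bar>)" using f1d(1)[of x' x] by simp
        finally show ?thesis using lateral by linarith
      next
        case 5
        have "\<sigma> * cross u P \<le> u (x', y')" unfolding cr
          using vanish[OF dom(3)] 5 u01 dom \<sigma> by (intro cross_le_one_factor) auto
        also have "\<dots> \<le> 200 * (f2 x' - f2 x)" using le_vertical(1)[OF dom(2)] 5 by simp
        also have "\<dots> \<le> 200 * (N * \<bar>x - x'\<bar>)" using f1d(2)[of x' x] by simp
        finally show ?thesis using lateral by linarith
      next
        case 6
        have "\<sigma> * cross u P \<le> u (x, y')" unfolding cr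
          using vanish[OF dom(2)] 6 u01 dom \<sigma> by (intro cross_le_one_factor) auto
        also have "\<dots> \<le> 200 * (f2 x - f2 x')" using le_vertical(1)[OF dom(3)] 6 by simp
        also have "\<dots> \<le> 200 * (N * \<bar>x - x'\<bar>)" using f1d(2)[of x x'] by simp
        finally show ?thesis using lateral by linarith
      qed
    qed
  qed (use \<Phi>_pos P in auto)
  have PK: "((x, y), (x', y')) \<in> K"
    using P x f1_nonneg[of x] f2_le_1[of x'] unfolding d_def[symmetric] I_iff[symmetric]
    by (auto simp: K_def Box_def cross_dom_def mem_iff)
  have "\<bar>cross u ((x, y), (x', y'))\<bar> \<le> \<Phi> ((x, y), (x', y'))"
    using main[OF _ PK, of 1] main[OF _ PK, of "-1"] by simp
  also have "\<dots> \<le> C * (cosh (x - x0) + cosh (x' - x0)) * 1"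
    unfolding \<Phi>_def fst_conv snd_conv using C PK
    by (intro mult_left_mono tri_bounds mult_nonneg_nonneg add_nonneg_nonneg) (auto simp: K_def Box_def)
  finally show ?thesis by (simp add: C_def)
qed


section \<open>Conclusion on the superlevel set\<close>

lemma cube_subset_interior:
  assumes p: "p \<in> \<Omega>" "u p \<ge> 1 / 2"
  shows "cube p (1 / 1000) \<subseteq> interior \<Omega>"
proof -
  have "p \<in> closure \<Omega>" using p(1) closure_subset by blast
  then have "u p \<le> 200 * dist p q" if "q \<in> frontier \<Omega>" for q
    using le_dist_frontier[OF _ lam_less that] by simp
  \<comment> \<open>Linear decay at rate 200 keeps points with u \<ge> 1/2 at distance 1/400 from
    the frontier; a ball of that radius is connected and so cannot leave \<Omega>.\<close>
  then have far: "1 / 400 \<le> dist p q" if "q \<in> frontier \<Omega>" for q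
    using p(2) that by fastforce
  have "ball p (1 / 400) - \<Omega> = {}"
  proof (rule ccontr)
    assume "ball p (1 / 400) - \<Omega> \<noteq> {}"
    moreover have "p \<in> ball p (1 / 400) \<inter> \<Omega>" using p(1) by simp
    then have "ball p (1 / 400) \<inter> \<Omega> \<noteq> {}" by blast
    ultimately have "ball p (1 / 400) \<inter> frontier \<Omega> \<noteq> {}"
      by (intro connected_Int_frontier connected_ball)
    then show False using far by force
  qed
  then have "ball p (1 / 400) \<subseteq> interior \<Omega>" by (intro interior_maximal) auto
  moreover have "cube p (1 / 1000) \<subseteq> ball p (1 / 400)"
  proof
    fix q assume q: "q \<in> cube p (1 / 1000)"
    have "norm (q - p) \<le> (\<Sum>k\<in>Basis. \<bar>(q - p) \<bullet> k\<bar>)" by (rule norm_le_l1)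
    also have "\<dots> \<le> 1 / 1000 + 1 / 1000"
      unfolding sum_Basis_real2 using q by (intro add_mono) (auto simp: cube_def Basis_real2)
    finally show "q \<in> ball p (1 / 400)" by (simp add: dist_norm norm_minus_commute)
  qed
  ultimately show ?thesis by blast
qed

text \<open>Exchanging y and y' only changes the sign of \<open>cross u\<close>, so the case y \<le>
  y' suffices. Both \<open>cosh\<close> weights are at most 3 on the cube, hence the factor
  6.\<close>

lemma cross_bound_cube:
  assumes L: "is_length_scale a b (\<lambda>x. f2 x - f1 x) L"
    and p: "p \<in> \<Omega>" "u p \<ge> 1 / 2" and P: "P \<in> cube (p, p) (1 / 1000)"
  shows "\<bar>cross u P\<bar> \<le> 6 * 10 ^ 25 / L ^ 3"
proof -
  obtain x y x' y' where Pe: "P = ((x, y), (x', y'))" by (metis surj_pair)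
  obtain x0 y0 where pe: "p = (x0, y0)" by (cases p)
  have Lpos: "L > 0" using L by (simp add: is_length_scale_def length_scale_admissible_def)
  have dom: "P \<in> cross_dom \<Omega>"
    using cube_cross_dom[OF cube_subset_interior[OF p]] P interior_subset[of \<Omega>]
    by (auto simp: cross_dom_def)
  then have mem: "(x, y) \<in> \<Omega>" "(x', y') \<in> \<Omega>" "(x, y') \<in> \<Omega>" "(x', y) \<in> \<Omega>"
    by (auto simp: Pe cross_dom_def)
  have x: "\<bar>x - x0\<bar> \<le> 1 / 1000" "\<bar>x' - x0\<bar> \<le> 1 / 1000"
    using P by (auto simp: cube_def Basis_real4 Pe pe)
  show ?thesis
  proof (cases "L \<ge> 4000000")
    case True
    have cosh: "cosh (z - x0) \<le> 3" if "\<bar>z - x0\<bar> \<le> 1 / 1000" for z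
    proof -
      have "cosh \<bar>z - x0\<bar> \<le> exp \<bar>z - x0\<bar>" unfolding cosh_def by simp
      also have "\<dots> \<le> exp 1" using that by simp
      also have "\<dots> \<le> 3" by (rule exp_le)
      finally show ?thesis by simp
    qed
    have bd: "\<bar>cross u ((x, z), (x', z'))\<bar> \<le> 6 * 10 ^ 25 / L ^ 3"
      if "((x, z), (x', z')) \<in> cross_dom \<Omega>" "z \<le> z'" for z z'
    proof -
      have "\<bar>cross u ((x, z), (x', z'))\<bar> \<le> 10 ^ 25 / L ^ 3 * (cosh (x - x0) + cosh (x' - x0))"
        using x True p that unfolding pe by (intro cross_bound[OF L True, of x0 y0]) auto
      also have "\<dots> \<le> 10 ^ 25 / L ^ 3 * (3 + 3)"
        using Lpos by (intro mult_left_mono add_mono cosh x) auto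
      finally show ?thesis by simp
    qed
    show ?thesis
    proof (cases "y \<le> y'")
      case True
      then show ?thesis using bd[of y y'] dom by (simp add: Pe)
    next
      case False
      then have "\<bar>cross u ((x, y'), (x', y))\<bar> \<le> 6 * 10 ^ 25 / L ^ 3"
        using mem by (intro bd) (auto simp: cross_dom_def)
      moreover have "cross u ((x, y'), (x', y)) = - cross u P" by (simp add: cross_def Pe)
      ultimately show ?thesis by simp
    qed
  next
    case False
    have u01: "0 \<le> u q" "u q \<le> 1" if "q \<in> \<Omega>" for q
      using nonneg[of q] le1[of q] that closure_subset[of \<Omega>] by auto
    have "0 \<le> u (x, y) * u (x', y')" "u (x, y) * u (x', y') \<le> 1"
      "0 \<le> u (x, y') * u (x', y)" "u (x, y') * u (x', y) \<le> 1"
      using u01 mem by (auto intro!: mult_le_one)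
    then have "\<bar>cross u P\<bar> \<le> 1" by (simp add: cross_def Pe abs_le_iff)
    \<comment> \<open>For bounded \<open>L\<close> the right-hand side is above the trivial bound:
      L^3 is at most 6.4 * 10^19.\<close>
    also have "1 \<le> 6 * 10 ^ 25 / L ^ 3"
    proof -
      have "L ^ 3 \<le> 4000000 ^ 3" using False Lpos by (intro power_mono) auto
      then show ?thesis using Lpos by (simp add: le_divide_eq)
    qed
    finally show ?thesis .
  qed
qed

lemma superlevel_mixed_log_bound:
  assumes L: "is_length_scale a b (\<lambda>x. f2 x - f1 x) L" and p: "p \<in> superlevel \<Omega> u (1 - 1 / 2)"
  shows "\<bar>dx (dy (\<lambda>q. ln (u q))) p\<bar> + norm (grad (dx (dy (\<lambda>q. ln (u q)))) p)
    \<le> mixed_const (200\<^sup>2) (1 / 1000) * (6 * 10 ^ 25) * L powi (- 3)"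
proof -
  have Lpos: "L > 0" using L by (simp add: is_length_scale_def length_scale_admissible_def)
  have p': "p \<in> \<Omega>" "u p \<ge> 1 / 2" using p by (auto simp: superlevel_def)
  have "\<bar>dx (dy (\<lambda>q. ln (u q))) p\<bar> + norm (grad (dx (dy (\<lambda>q. ln (u q)))) p)
      \<le> mixed_const (200\<^sup>2) (1 / 1000) * (6 * 10 ^ 25 / L ^ 3)"
  proof (rule mixed_log_bound[OF open_interior helm])
    show "\<bar>lam\<bar> \<le> \<bar>200\<^sup>2\<bar>" using lam_nonneg lam_less by simp
    show "cube p (1 / 1000) \<subseteq> interior \<Omega>" by (rule cube_subset_interior[OF p'])
    show "u q \<le> 1" if "q \<in> interior \<Omega>" for q using le1[OF interior_in_closure[OF that]] .
    show "\<bar>cross u P\<bar> \<le> 6 * 10 ^ 25 / L ^ 3" if "P \<in> cube (p, p) (1 / 1000)" for P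
      by (rule cross_bound_cube[OF L p' that])
    show "0 < 6 * 10 ^ 25 / L ^ 3" using Lpos by simp
    show "0 < (1 / 1000 :: real)" by simp
    show "0 < u q" if "q \<in> interior \<Omega>" for q by (rule pos[OF that])
    show "1 / 2 \<le> u p" by (rule p'(2))
  qed
  moreover have "6 * 10 ^ 25 / L ^ 3 = 6 * 10 ^ 25 * L powi (- 3)"
    by (simp add: power_int_minus divide_inverse)
  ultimately show ?thesis by (simp only: mult.assoc)
qed

end

theorem proposition4p1:
  "\<exists>\<epsilon>\<^sub>0 C\<^sub>0 :: real. \<epsilon>\<^sub>0 > 0 \<and> C\<^sub>0 > 0 \<and>
     (\<forall>\<Omega> a b f1 f2 L lam u.
        normalised_domain \<Omega> a b f1 f2 \<longrightarrow>
        is_length_scale a b (\<lambda>x. f2 x - f1 x) L \<longrightarrow>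
        is_first_dirichlet_eigenvalue \<Omega> lam \<longrightarrow>
        normalised_eigenfunction \<Omega> lam u \<longrightarrow>
        (\<forall>p \<in> superlevel \<Omega> u (1 - \<epsilon>\<^sub>0).
           \<bar>dx (dy (\<lambda>q. ln (u q))) p\<bar> + norm (grad (dx (dy (\<lambda>q. ln (u q)))) p)
             \<le> C\<^sub>0 * L powi (- 3)))"
proof -
  have "mixed_const (200\<^sup>2) (1 / 1000) > 0"
    unfolding mixed_const_def Let_def by (intro add_pos_pos mult_pos_pos zero_less_power grad_const_pos) auto
  then have "mixed_const (200\<^sup>2) (1 / 1000) * (6 * 10 ^ 25) > 0" by simp
  then show ?thesis
    using ground_state.superlevel_mixed_log_bound[unfolded ground_state_def]
    by (intro exI[of _ "1 / 2"] exI[of _ "mixed_const (200\<^sup>2) (1 / 1000) * (6 * 10 ^ 25)"]) auto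
qed

end
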